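(* If $\psi\in L^2(K)$ is a Parseval frame wavelet and $\psi$ is extendable to a super-wavelet of length $m+1$, where $m\in\mathbb N$, then $$\int_{\mathcal O}\frac{1-\sum_{k\in\mathbb N_0}\left|\widehat{\psi}(\xi+u(k))\right|^2}{|\xi|}\,d\xi\ \ge\ m\,\frac{q-1}{q}.$$
   Context: Local field setup. $K$ is a local field of positive characteristic, i.e. a locally compact, non-discrete, totally disconnected field of characteristic $p>0$, with absolute value $|\cdot|$. $\mathcal O=\{x\in K:|x|\le 1\}$ is the ring of integers, $\mathfrak P=\{x\in K:|x|<1\}$ its maximal ideal, $\mathfrak p$ a fixed prime element ($\mathfrak P=\mathfrak p\mathcal O$), $\mathcal O^*=\mathcal O\setminus\mathfrak P$, and $\mathcal O/\mathfrak P\cong GF(q)$ with $q=p^c$; $|\mathfrak p|=q^{-1}$. $dx$ is the Haar measure on $(K,+)$ with $|\mathcal O|=1$, where $|E|$ denotes the Haar measure of a measurable set $E$. $\mathbb N_0=\mathbb N\cup\{0\}$. The elements $u(n)$, $n\in\mathbb N_0$: fix $\{1=\epsilon_0,\epsilon_1,\dots,\epsilon_{c-1}\}\subset\mathcal O^*$ whose images in $\mathcal O/\mathfrak P$ form a basis of $GF(q)$ over $GF(p)$. For $0\le n<q$ write $n=\sum_{k=0}^{c-1}a_kp^k$, $0\le a_k<p$, and set $u(n)=\big(\sum_{k=0}^{c-1}a_k\epsilon_k\big)\mathfrak p^{-1}$. For general $n=\sum_{k=0}^s b_kq^k$, $0\le b_k<q$, set $u(n)=\sum_{k=0}^s u(b_k)\mathfrak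 p^{-k}$. The set $\{u(n)\}_{n\in\mathbb N_0}$ is a complete list of distinct coset representatives of $\mathcal O$ in $(K,+)$. Character and Fourier transform: $\chi$ is a fixed character of $(K,+)$, trivial on $\mathcal O$ and nontrivial on $\mathfrak P^{-1}=\mathfrak p^{-1}\mathcal O$; $\chi_y(x)=\chi(yx)$; the setup is such that $\chi_{u(k)}(u(l))=1$ for all $k,l\in\mathbb N_0$. $\widehat f(\xi)=\int_K f(x)\overline{\chi_\xi(x)}\,dx$ for $f\in L^1(K)$, extended to $L^2(K)$. Operators on $L^2(K)$: $D^jf(x)=q^{j/2}f(\mathfrak p^{-j}x)$ for $j\in\mathbb Z$, and $T^kf(x)=f(x-u(k))$ for $k\in\mathbb N_0$. Definitions. $\eta\in L^2(K)$ is a Parseval frame wavelet if $\|f\|^2=\sum_{(j,k)\in\mathbb Z\times\mathbb N_0}|\langle f,D^jT^k\eta\rangle|^2$ for every $f\in L^2(K)$. An $n$-tuple $(\eta_1,\dots,\eta_n)$ of Parseval frame wavelets is a super-wavelet of length $n$ if $\{D^jT^k\eta_1\oplus\cdots\oplus D^jT^k\eta_n: j\in\mathbb Z,\ k\in\mathbb N_0\}$ is an orthonormal basis for the $n$-fold direct sum Hilbert space $\bigoplus_{i=1}^n L^2(K)$. A Parseval frame wavelet $\eta_1$ is extendable to a super-wavelet of length $n$ if there exist Parseval frame wavelets $\eta_2,\dots,\eta_n$ such that $(\eta_1,\dots,\eta_n)$ is a super-wavelet of length $n$. The integral in the claim is allowed to be $+\infty$. *)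

theory Defs
  imports "HOL-Analysis.Analysis" "HOL-Computational_Algebra.Computational_Algebra"
begin

section \<open>Local fields of positive characteristic\<close>

definition int_ring :: "('a \<Rightarrow> real) \<Rightarrow> 'a set" where
  "int_ring absv = {x. absv x \<le> 1}"

definition max_ideal :: "('a \<Rightarrow> real) \<Rightarrow> 'a set" where
  "max_ideal absv = {x. absv x < 1}"

text \<open>
  The metric of the type class carries the topology of the field; \<open>dist_absv\<close> says that it is the
  one induced by the absolute value. Continuity of the field operations is a consequence.
\<close>

locale local_field_pos_char =
  fixes absv :: "'a::{field,metric_space} \<Rightarrow> real"
  assumes char_pos: "CHAR('a) > 0"
    and absv_nonneg: "absv x \<ge> 0"
    and absv_eq_0_iff: "absv x = 0 \<longleftrightarrow> x = 0"
    and absv_mult: "absv (x * y) = absv x * absv y"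
    and absv_ultrametric: "absv (x + y) \<le> max (absv x) (absv y)"
    and dist_absv: "dist x y = absv (x - y)"
    and locally_compact: "locally compact (UNIV :: 'a set)"
    and non_discrete: "\<exists>S :: 'a set. \<not> open S"
    and totally_disconnected: "connected (S :: 'a set) \<Longrightarrow> \<exists>x. S \<subseteq> {x}"

text \<open>
  \<open>pp\<close> is the prime element, \<open>eps 0, \<dots>, eps (c - 1)\<close> lift a basis of the residue field over its
  prime field. The scalars of the prime field are the images of natural numbers, so that linear
  independence and spanning modulo the maximal ideal are written with coefficients in \<open>nat\<close>.
\<close>

definition residue_basis :: "('a::field \<Rightarrow> real) \<Rightarrow> nat \<Rightarrow> (nat \<Rightarrow> 'a) \<Rightarrow> bool" where
  "residue_basis absv c eps \<longleftrightarrow>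
     (\<forall>a :: nat \<Rightarrow> nat. (\<Sum>k<c. of_nat (a k) * eps k) \<in> max_ideal absv
        \<longrightarrow> (\<forall>k<c. of_nat (a k) \<in> max_ideal absv)) \<and>
     (\<forall>x \<in> int_ring absv. \<exists>a :: nat \<Rightarrow> nat.
        x - (\<Sum>k<c. of_nat (a k) * eps k) \<in> max_ideal absv)"

definition u_digit :: "'a::field \<Rightarrow> nat \<Rightarrow> (nat \<Rightarrow> 'a) \<Rightarrow> nat \<Rightarrow> 'a" where
  "u_digit pp c eps n =
     (\<Sum>k<c. of_nat (n div CHAR('a) ^ k mod CHAR('a)) * eps k) * inverse pp"

text \<open>
  With \<open>q = p ^ c\<close>, the number \<open>n div q ^ k mod q\<close> is the \<open>k\<close>-th digit of \<open>n\<close> in base \<open>q\<close>; it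
  vanishes for \<open>k > n\<close>, and \<open>u_digit pp c eps 0 = 0\<close>, so the bound \<open>k \<le> n\<close> loses no digit.
\<close>

definition u :: "'a::field \<Rightarrow> nat \<Rightarrow> (nat \<Rightarrow> 'a) \<Rightarrow> nat \<Rightarrow> 'a" where
  "u pp c eps n =
     (\<Sum>k\<le>n. u_digit pp c eps (n div (CHAR('a) ^ c) ^ k mod CHAR('a) ^ c) * inverse pp ^ k)"

text \<open>
  \<open>mu\<close> is the normalised Haar measure: a translation-invariant Borel measure, finite on compact
  sets. Regularity need not be demanded, as the field is locally compact and second countable.
\<close>

locale local_field_setup = local_field_pos_char absv
  for absv :: "'a::{field,metric_space} \<Rightarrow> real" +
  fixes pp :: 'a and c :: nat and eps :: "nat \<Rightarrow> 'a"
    and chi :: "'a \<Rightarrow> complex" and mu :: "'a measure"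
  assumes prime_element: "max_ideal absv = (\<lambda>x. pp * x) ` int_ring absv"
    and card_residue_field:
      "card (int_ring absv //
         {(x, y). x \<in> int_ring absv \<and> y \<in> int_ring absv \<and> x - y \<in> max_ideal absv})
       = CHAR('a) ^ c"
    and absv_prime: "absv pp = inverse (real (CHAR('a) ^ c))"
    and eps_units: "k < c \<Longrightarrow> eps k \<in> int_ring absv - max_ideal absv"
    and eps_0: "eps 0 = 1"
    and eps_basis: "residue_basis absv c eps"
    and sets_mu: "sets mu = sets borel"
    and translation_invariant: "distr mu borel ((+) a) = mu"
    and finite_on_compact: "compact C \<Longrightarrow> emeasure mu C < \<infinity>"
    and normalised: "emeasure mu (int_ring absv) = 1"
    and chi_add: "chi (x + y) = chi x * chi y"
    and chi_unit: "cmod (chi x) = 1"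
    and chi_continuous: "continuous_on UNIV chi"
    and chi_trivial: "x \<in> int_ring absv \<Longrightarrow> chi x = 1"
    and chi_nontrivial: "\<exists>x \<in> int_ring absv. chi (inverse pp * x) \<noteq> 1"
    and chi_u: "chi (u pp c eps k * u pp c eps l) = 1"

section \<open>Square-integrable functions and the Fourier transform\<close>

text \<open>Elements of \<open>L\<^sup>2\<close> are represented by functions, equality being equality almost everywhere.\<close>

definition L1 :: "'a measure \<Rightarrow> ('a \<Rightarrow> complex) set" where
  "L1 M = {f. integrable M f}"

definition L2 :: "'a measure \<Rightarrow> ('a \<Rightarrow> complex) set" where
  "L2 M = {f \<in> borel_measurable M. integrable M (\<lambda>x. (cmod (f x))\<^sup>2)}"

definition L2_inner :: "'a measure \<Rightarrow> ('a \<Rightarrow> complex) \<Rightarrow> ('a \<Rightarrow> complex) \<Rightarrow> complex" where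
  "L2_inner M f g = (LINT x|M. f x * cnj (g x))"

definition norm_L2 :: "'a measure \<Rightarrow> ('a \<Rightarrow> complex) \<Rightarrow> real" where
  "norm_L2 M f = sqrt (LINT x|M. (cmod (f x))\<^sup>2)"

definition L2_converges ::
    "'a measure \<Rightarrow> (nat \<Rightarrow> 'a \<Rightarrow> complex) \<Rightarrow> ('a \<Rightarrow> complex) \<Rightarrow> bool" where
  "L2_converges M F f \<longleftrightarrow>
     (\<lambda>n. \<integral>\<^sup>+x. ennreal ((cmod (F n x - f x))\<^sup>2) \<partial>M) \<longlonglongrightarrow> 0"

definition fourier_L1 ::
    "('a::field \<Rightarrow> complex) \<Rightarrow> 'a measure \<Rightarrow> ('a \<Rightarrow> complex) \<Rightarrow> 'a \<Rightarrow> complex" where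
  "fourier_L1 chi M f \<xi> = (LINT x|M. f x * cnj (chi (\<xi> * x)))"

text \<open>
  Extension by continuity from \<open>L\<^sup>1 \<inter> L\<^sup>2\<close> to \<open>L\<^sup>2\<close>; the transform is determined up to equality
  almost everywhere, and \<open>fourier_L2\<close> picks a representative.
\<close>

definition is_fourier_L2 ::
    "('a::field \<Rightarrow> complex) \<Rightarrow> 'a measure \<Rightarrow> ('a \<Rightarrow> complex) \<Rightarrow> ('a \<Rightarrow> complex) \<Rightarrow> bool" where
  "is_fourier_L2 chi M f g \<longleftrightarrow> g \<in> L2 M \<and>
     (\<forall>F. (\<forall>n. F n \<in> L1 M \<inter> L2 M) \<longrightarrow> L2_converges M F f \<longrightarrow>
        L2_converges M (\<lambda>n. fourier_L1 chi M (F n)) g)"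

definition fourier_L2 ::
    "('a::field \<Rightarrow> complex) \<Rightarrow> 'a measure \<Rightarrow> ('a \<Rightarrow> complex) \<Rightarrow> 'a \<Rightarrow> complex" where
  "fourier_L2 chi M f = (SOME g. is_fourier_L2 chi M f g)"

section \<open>Parseval frame wavelets and super-wavelets\<close>

definition dil :: "'a::field \<Rightarrow> nat \<Rightarrow> int \<Rightarrow> ('a \<Rightarrow> complex) \<Rightarrow> 'a \<Rightarrow> complex" where
  "dil pp c j f x =
     of_real (real (CHAR('a) ^ c) powr (of_int j / 2)) * f (pp powi (- j) * x)"

definition trans_u ::
    "'a::field \<Rightarrow> nat \<Rightarrow> (nat \<Rightarrow> 'a) \<Rightarrow> nat \<Rightarrow> ('a \<Rightarrow> complex) \<Rightarrow> 'a \<Rightarrow> complex" where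
  "trans_u pp c eps k f x = f (x - u pp c eps k)"

definition parseval_frame_wavelet ::
    "'a::field \<Rightarrow> nat \<Rightarrow> (nat \<Rightarrow> 'a) \<Rightarrow> 'a measure \<Rightarrow> ('a \<Rightarrow> complex) \<Rightarrow> bool" where
  "parseval_frame_wavelet pp c eps M \<eta> \<longleftrightarrow> \<eta> \<in> L2 M \<and>
     (\<forall>f \<in> L2 M.
        ((\<lambda>(j, k). (cmod (L2_inner M f (dil pp c j (trans_u pp c eps k \<eta>))))\<^sup>2)
           has_sum (norm_L2 M f)\<^sup>2) (UNIV :: (int \<times> nat) set))"

text \<open>Elements of the \<open>n\<close>-fold direct sum are families indexed by \<open>{1..n}\<close>.\<close>

definition dsum_L2 :: "'a measure \<Rightarrow> nat \<Rightarrow> (nat \<Rightarrow> 'a \<Rightarrow> complex) set" where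
  "dsum_L2 M n = {F. \<forall>i\<in>{1..n}. F i \<in> L2 M}"

definition dsum_inner ::
    "'a measure \<Rightarrow> nat \<Rightarrow> (nat \<Rightarrow> 'a \<Rightarrow> complex) \<Rightarrow> (nat \<Rightarrow> 'a \<Rightarrow> complex) \<Rightarrow> complex" where
  "dsum_inner M n F G = (\<Sum>i=1..n. L2_inner M (F i) (G i))"

definition dsum_norm :: "'a measure \<Rightarrow> nat \<Rightarrow> (nat \<Rightarrow> 'a \<Rightarrow> complex) \<Rightarrow> real" where
  "dsum_norm M n F = sqrt (\<Sum>i=1..n. (norm_L2 M (F i))\<^sup>2)"

definition dsum_orthonormal_basis ::
    "'a measure \<Rightarrow> nat \<Rightarrow> ('i \<Rightarrow> nat \<Rightarrow> 'a \<Rightarrow> complex) \<Rightarrow> bool" where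
  "dsum_orthonormal_basis M n e \<longleftrightarrow>
     (\<forall>a. e a \<in> dsum_L2 M n) \<and>
     (\<forall>a b. dsum_inner M n (e a) (e b) = (if a = b then 1 else 0)) \<and>
     (\<forall>F \<in> dsum_L2 M n. \<forall>\<epsilon>>0. \<exists>A z. finite A \<and>
        dsum_norm M n (\<lambda>i x. F i x - (\<Sum>a\<in>A. z a * e a i x)) < \<epsilon>)"

definition super_wavelet ::
    "'a::field \<Rightarrow> nat \<Rightarrow> (nat \<Rightarrow> 'a) \<Rightarrow> 'a measure \<Rightarrow> nat \<Rightarrow> (nat \<Rightarrow> 'a \<Rightarrow> complex) \<Rightarrow> bool" where
  "super_wavelet pp c eps M n \<eta> \<longleftrightarrow>
     (\<forall>i\<in>{1..n}. parseval_frame_wavelet pp c eps M (\<eta> i)) \<and>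
     dsum_orthonormal_basis M n
       (\<lambda>(j :: int, k :: nat). \<lambda>i. dil pp c j (trans_u pp c eps k (\<eta> i)))"

definition extendable_to_super_wavelet ::
    "'a::field \<Rightarrow> nat \<Rightarrow> (nat \<Rightarrow> 'a) \<Rightarrow> 'a measure \<Rightarrow> ('a \<Rightarrow> complex) \<Rightarrow> nat \<Rightarrow> bool" where
  "extendable_to_super_wavelet pp c eps M \<psi> n \<longleftrightarrow>
     (\<exists>\<eta>. \<eta> 1 = \<psi> \<and> super_wavelet pp c eps M n \<eta>)"

section \<open>Extended-valued integrals\<close>

text \<open>
  Integral of the positive part minus integral of the negative part. If the negative part has
  infinite integral the value is set to \<open>-\<infinity>\<close> (in \<open>ereal\<close>, \<open>\<infinity> - \<infinity> = \<infinity>\<close>), so that a lower bound by a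
  real number also asserts that the integral is well defined.
\<close>

definition ext_set_integral :: "'a measure \<Rightarrow> 'a set \<Rightarrow> ('a \<Rightarrow> ereal) \<Rightarrow> ereal" where
  "ext_set_integral M A f =
     (let P = (\<integral>\<^sup>+x\<in>A. e2ennreal (f x) \<partial>M); N = (\<integral>\<^sup>+x\<in>A. e2ennreal (- f x) \<partial>M)
      in if N = \<infinity> then - \<infinity> else enn2ereal P - enn2ereal N)"

end

theory Submission
  imports Defs
begin

text \<open>
  Write \<open>\<eta>\<^sub>1, \<dots>, \<eta>\<^sub>m\<^sub>+\<^sub>1\<close> for a super-wavelet with \<open>\<eta>\<^sub>1 = \<psi>\<close>, and \<open>G\<^sub>i \<xi>\<close> for the periodization
  \<open>\<Sum>k. |\<eta>\<^sub>i^(\<xi> + u k)|\<^sup>2\<close> of the squared modulus of the transform of \<open>\<eta>\<^sub>i\<close>. Two facts give the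
  bound.

  First, \<open>\<Sum>i. G\<^sub>i \<le> 1\<close> almost everywhere on the ring of integers \<open>O\<close> (\<open>periodization_le_1\<close>). For a
  coset \<open>B\<close> of a fractional ideal inside \<open>O\<close> there is a trigonometric polynomial \<open>p\<close> in the
  characters of the \<open>u l\<close> which on \<open>O\<close> is the indicator of \<open>B\<close>. Since \<open>p\<close> is invariant under
  translation by every \<open>u k\<close>, the integral of \<open>\<Sum>i. G\<^sub>i\<close> over \<open>B\<close> is the sum over \<open>i\<close> of the squared
  norms of \<open>p \<eta>\<^sub>i^\<close>. As \<open>p \<eta>\<^sub>i^\<close> is the transform of a combination of translates of \<open>\<eta>\<^sub>i\<close>, its norm
  is at most that of this combination, and by orthonormality the squared norms of the combinations
  add up to the measure of \<open>B\<close>. Borel sets are approximated by finite unions of cosets.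

  Second, the integral of \<open>|\<eta>\<^sub>i^(\<xi>)|\<^sup>2 / |\<xi>|\<close> over the field is at least \<open>(q - 1) / q\<close>
  (\<open>Calderon_lower_bound\<close>). This is the lower half of the Calderon condition
  \<open>\<Sum>j. |\<eta>\<^sub>i^(pp^j \<xi>)|\<^sup>2 = 1\<close> of a Parseval frame wavelet, integrated over the unit sphere: the Parseval identity is applied to the
  functions whose transforms are the indicators of the cosets of radius \<open>q^-N\<close> in the unit sphere,
  Bessel's inequality bounds the coefficients of each scale, and \<open>N\<close> tends to infinity. The unit
  sphere has measure \<open>(q - 1) / q\<close>.

  Now \<open>1 - G\<^sub>1 \<ge> \<Sum>i\<ge>2. G\<^sub>i\<close> on \<open>O\<close>. For \<open>\<xi> \<in> O\<close> one has \<open>|\<xi> + u k| \<ge> |\<xi>|\<close>, so the integral of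
  \<open>G\<^sub>i(\<xi>) / |\<xi>|\<close> over \<open>O\<close> dominates that of \<open>|\<eta>\<^sub>i^(\<xi>)|\<^sup>2 / |\<xi>|\<close> over the field. Summing over the \<open>m\<close>
  indices \<open>i \<ge> 2\<close> gives \<open>m (q - 1) / q\<close>.

  All of this rests on the norm bound of the Fourier transform, which comes from Bessel's
  inequality: the transform of a function of bounded support is locally constant, and its values on
  distinct cosets are coefficients with respect to orthogonal characters.
\<close>

section \<open>Square-integrable functions\<close>

lemma L2_measurable: "f \<in> L2 M \<Longrightarrow> f \<in> borel_measurable M"
  by (simp add: L2_def)

lemma L2_integrable: "f \<in> L2 M \<Longrightarrow> integrable M (\<lambda>x. (cmod (f x))\<^sup>2)"
  by (simp add: L2_def)

lemma L2_iff_nn_integral: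
  "f \<in> L2 M \<longleftrightarrow> f \<in> borel_measurable M \<and> (\<integral>\<^sup>+x. ennreal ((cmod (f x))\<^sup>2) \<partial>M) < \<infinity>"
  by (auto simp: L2_def integrable_iff_bounded)

lemma norm_L2_nonneg [simp]: "norm_L2 M f \<ge> 0"
  by (simp add: norm_L2_def)

lemma norm_L2_squared: "(norm_L2 M f)\<^sup>2 = (LINT x|M. (cmod (f x))\<^sup>2)"
  by (simp add: norm_L2_def)

lemma nn_integral_L2: "f \<in> L2 M \<Longrightarrow> (\<integral>\<^sup>+x. ennreal ((cmod (f x))\<^sup>2) \<partial>M) = ennreal ((norm_L2 M f)\<^sup>2)"
  unfolding norm_L2_squared by (rule nn_integral_eq_integral) (auto simp: L2_def)

lemma cnj_borel [measurable]: "cnj \<in> borel_measurable borel"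
  by (intro borel_measurable_continuous_onI continuous_intros)

lemma L2_mult_integrable:
  assumes "f \<in> L2 M" "g \<in> L2 M"
  shows "integrable M (\<lambda>x. f x * cnj (g x))"
proof (rule Bochner_Integration.integrable_bound)
  show "integrable M (\<lambda>x. (cmod (f x))\<^sup>2 + (cmod (g x))\<^sup>2)"
    using assms by (simp add: L2_def)
  have [measurable]: "f \<in> borel_measurable M" "g \<in> borel_measurable M"
    using assms by (auto simp: L2_def)
  show "(\<lambda>x. f x * cnj (g x)) \<in> borel_measurable M" by measurable
  have "a * b \<le> a\<^sup>2 + b\<^sup>2" if "a \<ge> 0" "b \<ge> 0" for a b :: real
    using sum_squares_bound[of a b] mult_nonneg_nonneg[OF that] by linarith
  then show "AE x in M. norm (f x * cnj (g x)) \<le> norm ((cmod (f x))\<^sup>2 + (cmod (g x))\<^sup>2)"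
    by (auto simp: norm_mult)
qed

lemma L2_mult_bounded:
  assumes "f \<in> L2 M" "g \<in> borel_measurable M" "\<And>x. cmod (g x) \<le> B"
  shows "(\<lambda>x. g x * f x) \<in> L2 M"
proof -
  have [measurable]: "f \<in> borel_measurable M" "g \<in> borel_measurable M"
    using assms by (auto simp: L2_def)
  have "integrable M (\<lambda>x. (cmod (g x * f x))\<^sup>2)"
  proof (rule Bochner_Integration.integrable_bound)
    show "integrable M (\<lambda>x. B\<^sup>2 * (cmod (f x))\<^sup>2)" using assms by (simp add: L2_def)
    show "AE x in M. norm ((cmod (g x * f x))\<^sup>2) \<le> norm (B\<^sup>2 * (cmod (f x))\<^sup>2)"
      using assms(3) by (auto simp: norm_mult power_mult_distrib intro!: mult_right_mono power_mono)
  qed measurable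
  then show ?thesis by (simp add: L2_def)
qed

lemma L2_cmult: "f \<in> L2 M \<Longrightarrow> (\<lambda>x. c * f x) \<in> L2 M"
  by (rule L2_mult_bounded[of f M "\<lambda>_. c" "cmod c"]) auto

lemma cmod_add_squared: "(cmod (a + b))\<^sup>2 = (cmod a)\<^sup>2 + (cmod b)\<^sup>2 + 2 * Re (a * cnj b)"
  unfolding cmod_power2 by (simp add: power2_eq_square algebra_simps)

lemma L2_add:
  assumes "f \<in> L2 M" "g \<in> L2 M" shows "(\<lambda>x. f x + g x) \<in> L2 M"
proof -
  have [measurable]: "f \<in> borel_measurable M" "g \<in> borel_measurable M"
    using assms by (auto simp: L2_def)
  have "integrable M (\<lambda>x. (cmod (f x + g x))\<^sup>2)"
    unfolding cmod_add_squared
    by (intro Bochner_Integration.integrable_add integrable_mult_right integrable_Re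
        L2_integrable L2_mult_integrable assms)
  then show ?thesis by (simp add: L2_def)
qed

lemma L2_diff: "f \<in> L2 M \<Longrightarrow> g \<in> L2 M \<Longrightarrow> (\<lambda>x. f x - g x) \<in> L2 M"
  using L2_add[OF _ L2_cmult[of g M "-1"], of f] by simp

lemma L2_zero: "(\<lambda>x. 0) \<in> L2 M"
  by (simp add: L2_def)

lemma L2_sum: "(\<And>i. i \<in> A \<Longrightarrow> f i \<in> L2 M) \<Longrightarrow> (\<lambda>x. \<Sum>i\<in>A. f i x) \<in> L2 M"
  by (induction A rule: infinite_finite_induct) (auto intro: L2_add L2_zero)

lemma L2_inner_sum_left:
  assumes "\<And>i. i \<in> A \<Longrightarrow> f i \<in> L2 M" "g \<in> L2 M"
  shows "L2_inner M (\<lambda>x. \<Sum>i\<in>A. c i * f i x) g = (\<Sum>i\<in>A. c i * L2_inner M (f i) g)"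
proof -
  have "L2_inner M (\<lambda>x. \<Sum>i\<in>A. c i * f i x) g = (LINT x|M. (\<Sum>i\<in>A. c i * (f i x * cnj (g x))))"
    by (simp add: L2_inner_def sum_distrib_right mult.assoc)
  also have "\<dots> = (\<Sum>i\<in>A. (LINT x|M. c i * (f i x * cnj (g x))))"
    by (rule Bochner_Integration.integral_sum) (intro integrable_mult_right L2_mult_integrable assms)
  finally show ?thesis by (simp add: L2_inner_def)
qed

lemma cnj_L2_inner: "cnj (L2_inner M f g) = L2_inner M g f"
  unfolding L2_inner_def by (subst Bochner_Integration.integral_cnj[symmetric]) (simp add: mult.commute)

lemma L2_inner_sum_right:
  assumes "\<And>i. i \<in> A \<Longrightarrow> f i \<in> L2 M" "g \<in> L2 M"
  shows "L2_inner M g (\<lambda>x. \<Sum>i\<in>A. c i * f i x) = (\<Sum>i\<in>A. cnj (c i) * L2_inner M g (f i))"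
proof -
  have "cnj (L2_inner M (\<lambda>x. \<Sum>i\<in>A. c i * f i x) g) = cnj (\<Sum>i\<in>A. c i * L2_inner M (f i) g)"
    using L2_inner_sum_left[of A f M g c] assms by simp
  then show ?thesis by (simp add: cnj_L2_inner)
qed

lemma L2_inner_self: "f \<in> L2 M \<Longrightarrow> L2_inner M f f = of_real ((norm_L2 M f)\<^sup>2)"
  by (simp add: L2_inner_def norm_L2_squared complex_norm_square[symmetric] flip: integral_complex_of_real)

lemma norm_L2_add_squared:
  assumes "f \<in> L2 M" "g \<in> L2 M"
  shows "(norm_L2 M (\<lambda>x. f x + g x))\<^sup>2 = (norm_L2 M f)\<^sup>2 + (norm_L2 M g)\<^sup>2 + 2 * Re (L2_inner M f g)"
proof -
  have "integrable M (\<lambda>x. 2 * Re (f x * cnj (g x)))"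
    by (intro integrable_mult_right integrable_Re L2_mult_integrable assms)
  moreover have "(LINT x|M. 2 * Re (f x * cnj (g x))) = 2 * Re (L2_inner M f g)"
    unfolding L2_inner_def integral_mult_right_zero
    by (subst Bochner_Integration.integral_Re[OF L2_mult_integrable[OF assms]]) simp
  ultimately show ?thesis
    unfolding norm_L2_squared cmod_add_squared
    using L2_integrable[OF assms(1)] L2_integrable[OF assms(2)]
    by (simp only: Bochner_Integration.integral_add Bochner_Integration.integrable_add)
qed

lemma norm_L2_cmult: "norm_L2 M (\<lambda>x. c * f x) = cmod c * norm_L2 M f"
  by (simp add: norm_L2_def norm_mult power_mult_distrib real_sqrt_mult)

text \<open>
  Bessel's inequality for an orthogonal family of common squared norm \<open>w\<close>: the distance from \<open>f\<close>
  to its projection on the span is nonnegative.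
\<close>

lemma Bessel:
  assumes fin: "finite A" and e: "\<And>k. k \<in> A \<Longrightarrow> e k \<in> L2 M" and f: "f \<in> L2 M" and w: "w > 0"
    and orth: "\<And>k l. k \<in> A \<Longrightarrow> l \<in> A \<Longrightarrow> L2_inner M (e k) (e l) = (if k = l then of_real w else 0)"
  shows "(\<Sum>k\<in>A. (cmod (L2_inner M f (e k)))\<^sup>2) \<le> w * (norm_L2 M f)\<^sup>2"
proof -
  define a where "a k = - L2_inner M f (e k) / of_real w" for k
  define S where "S x = (\<Sum>k\<in>A. a k * e k x)" for x
  have S: "S \<in> L2 M" unfolding S_def by (intro L2_sum L2_cmult e)
  have aw: "cnj (a k) * a k * of_real w = of_real ((cmod (L2_inner M f (e k)))\<^sup>2 / w)" for k
    using w complex_norm_square[of "L2_inner M f (e k)"]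
    by (simp add: a_def field_simps)
  have "L2_inner M f S = (\<Sum>k\<in>A. cnj (a k) * L2_inner M f (e k))"
    unfolding S_def by (rule L2_inner_sum_right) (use e f in auto)
  also have "\<dots> = (\<Sum>k\<in>A. - (cnj (a k) * a k * of_real w))"
    using w by (simp add: a_def)
  finally have 1: "L2_inner M f S = of_real (- (\<Sum>k\<in>A. (cmod (L2_inner M f (e k)))\<^sup>2 / w))"
    unfolding aw by (simp add: sum_negf)
  have "L2_inner M S S = (\<Sum>k\<in>A. a k * L2_inner M (e k) S)"
    unfolding S_def[abs_def] by (rule L2_inner_sum_left) (use e S S_def[abs_def] in auto)
  also have "\<dots> = (\<Sum>k\<in>A. cnj (a k) * a k * of_real w)"
  proof (rule sum.cong)
    fix k assume k: "k \<in> A"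
    have "L2_inner M (e k) S = (\<Sum>l\<in>A. cnj (a l) * L2_inner M (e k) (e l))"
      unfolding S_def by (rule L2_inner_sum_right) (use e k in auto)
    also have "\<dots> = (\<Sum>l\<in>A. if k = l then cnj (a l) * of_real w else 0)"
      using k by (intro sum.cong) (auto simp: orth)
    also have "\<dots> = cnj (a k) * of_real w" using k fin by simp
    finally show "a k * L2_inner M (e k) S = cnj (a k) * a k * of_real w" by simp
  qed simp
  finally have "of_real ((norm_L2 M S)\<^sup>2) = complex_of_real (\<Sum>k\<in>A. (cmod (L2_inner M f (e k)))\<^sup>2 / w)"
    unfolding aw L2_inner_self[OF S] by simp
  then have 2: "(norm_L2 M S)\<^sup>2 = (\<Sum>k\<in>A. (cmod (L2_inner M f (e k)))\<^sup>2 / w)"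
    using of_real_eq_iff by blast
  have "0 \<le> (norm_L2 M f)\<^sup>2 + (norm_L2 M S)\<^sup>2 + 2 * Re (L2_inner M f S)"
    using norm_L2_add_squared[OF f S] by (metis zero_le_power2)
  then have "(\<Sum>k\<in>A. (cmod (L2_inner M f (e k)))\<^sup>2 / w) \<le> (norm_L2 M f)\<^sup>2"
    unfolding 2 1 by simp
  then show ?thesis using w by (simp add: sum_divide_distrib[symmetric] pos_divide_le_eq mult.commute)
qed

lemma Cauchy_Schwarz_L2:
  assumes "f \<in> L2 M" "g \<in> L2 M"
  shows "cmod (L2_inner M f g) \<le> norm_L2 M f * norm_L2 M g"
proof (cases "norm_L2 M g = 0")
  case True
  then have "(LINT x|M. (cmod (g x))\<^sup>2) = 0" using norm_L2_squared[of M g] by simp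
  then have "AE x in M. g x = 0"
    using integral_nonneg_eq_0_iff_AE[of M "\<lambda>x. (cmod (g x))\<^sup>2"] L2_integrable[OF assms(2)] by auto
  then have "L2_inner M f g = (LINT x|M. 0)" unfolding L2_inner_def
    using assms[THEN L2_measurable] by (intro integral_cong_AE) auto
  then show ?thesis by simp
next
  case False
  then have "norm_L2 M g > 0" using norm_L2_nonneg[of M g] by linarith
  then have "(\<Sum>k\<in>{()}. (cmod (L2_inner M f g))\<^sup>2) \<le> (norm_L2 M g)\<^sup>2 * (norm_L2 M f)\<^sup>2"
    using assms by (intro Bessel) (auto simp: L2_inner_self)
  then have "(cmod (L2_inner M f g))\<^sup>2 \<le> (norm_L2 M f * norm_L2 M g)\<^sup>2"
    by (simp add: power_mult_distrib mult.commute)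
  then show ?thesis by (rule power2_le_imp_le) simp
qed

lemma norm_L2_triangle:
  assumes "f \<in> L2 M" "g \<in> L2 M"
  shows "norm_L2 M (\<lambda>x. f x + g x) \<le> norm_L2 M f + norm_L2 M g"
proof (rule power2_le_imp_le)
  have "Re (L2_inner M f g) \<le> norm_L2 M f * norm_L2 M g"
    using Cauchy_Schwarz_L2[OF assms] complex_Re_le_cmod[of "L2_inner M f g"] by linarith
  then show "(norm_L2 M (\<lambda>x. f x + g x))\<^sup>2 \<le> (norm_L2 M f + norm_L2 M g)\<^sup>2"
    unfolding norm_L2_add_squared[OF assms] by (simp add: power2_sum)
qed simp

lemma norm_L2_minus_commute: "norm_L2 M (\<lambda>x. f x - g x) = norm_L2 M (\<lambda>x. g x - f x)"
  by (simp add: norm_L2_def norm_minus_commute)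

lemma norm_L2_triangle_diff:
  assumes "f \<in> L2 M" "g \<in> L2 M" "h \<in> L2 M"
  shows "norm_L2 M (\<lambda>x. f x - h x) \<le> norm_L2 M (\<lambda>x. f x - g x) + norm_L2 M (\<lambda>x. g x - h x)"
  using norm_L2_triangle[OF L2_diff[OF assms(1,2)] L2_diff[OF assms(2,3)]] by simp

lemma L2_converges_iff:
  assumes "\<And>n. F n \<in> L2 M" "f \<in> L2 M"
  shows "L2_converges M F f \<longleftrightarrow> (\<lambda>n. norm_L2 M (\<lambda>x. F n x - f x)) \<longlonglongrightarrow> 0"
proof -
  have "L2_converges M F f \<longleftrightarrow> (\<lambda>n. ennreal ((norm_L2 M (\<lambda>x. F n x - f x))\<^sup>2)) \<longlonglongrightarrow> ennreal 0"
    by (simp add: L2_converges_def nn_integral_L2[OF L2_diff[OF assms]])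
  also have "\<dots> \<longleftrightarrow> (\<lambda>n. (norm_L2 M (\<lambda>x. F n x - f x))\<^sup>2) \<longlonglongrightarrow> 0"
    by (rule tendsto_ennreal_iff) auto
  also have "\<dots> \<longleftrightarrow> (\<lambda>n. norm_L2 M (\<lambda>x. F n x - f x)) \<longlonglongrightarrow> 0"
  proof
    assume "(\<lambda>n. (norm_L2 M (\<lambda>x. F n x - f x))\<^sup>2) \<longlonglongrightarrow> 0"
    from tendsto_real_sqrt[OF this] show "(\<lambda>n. norm_L2 M (\<lambda>x. F n x - f x)) \<longlonglongrightarrow> 0" by simp
  next
    assume "(\<lambda>n. norm_L2 M (\<lambda>x. F n x - f x)) \<longlonglongrightarrow> 0"
    from tendsto_power[OF this, of 2] show "(\<lambda>n. (norm_L2 M (\<lambda>x. F n x - f x))\<^sup>2) \<longlonglongrightarrow> 0" by simp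
  qed
  finally show ?thesis .
qed

lemma L2_converges_norm:
  assumes F: "\<And>n. F n \<in> L2 M" and f: "f \<in> L2 M" and c: "L2_converges M F f"
  shows "(\<lambda>n. norm_L2 M (F n)) \<longlonglongrightarrow> norm_L2 M f"
proof (rule LIM_zero_cancel, rule Lim_null_comparison)
  show "(\<lambda>n. norm_L2 M (\<lambda>x. F n x - f x)) \<longlonglongrightarrow> 0" using c L2_converges_iff[of F M f] F f by simp
  show "\<forall>\<^sub>F n in sequentially. norm (norm_L2 M (F n) - norm_L2 M f) \<le> norm_L2 M (\<lambda>x. F n x - f x)"
    using norm_L2_triangle_diff[OF F f L2_zero] norm_L2_triangle_diff[OF f F L2_zero]
    by (auto intro!: always_eventually simp: norm_L2_minus_commute[of M f] abs_le_iff algebra_simps)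
qed

lemma L2_converges_inner:
  assumes F: "\<And>n. F n \<in> L2 M" and f: "f \<in> L2 M" and h: "h \<in> L2 M" and c: "L2_converges M F f"
  shows "(\<lambda>n. L2_inner M (F n) h) \<longlonglongrightarrow> L2_inner M f h"
proof (rule LIM_zero_cancel, rule Lim_null_comparison)
  show "(\<lambda>n. norm_L2 M (\<lambda>x. F n x - f x) * norm_L2 M h) \<longlonglongrightarrow> 0"
    using c L2_converges_iff[of F M f] F f by (auto intro!: tendsto_mult_left_zero)
  have "L2_inner M (F n) h - L2_inner M f h = L2_inner M (\<lambda>x. F n x - f x) h" for n
    using L2_mult_integrable[OF F[of n] h] L2_mult_integrable[OF f h]
    by (simp add: L2_inner_def left_diff_distrib)
  then show "\<forall>\<^sub>F n in sequentially. norm (L2_inner M (F n) h - L2_inner M f h)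
      \<le> norm_L2 M (\<lambda>x. F n x - f x) * norm_L2 M h"
    using Cauchy_Schwarz_L2[OF L2_diff[OF F f] h] by simp
qed

lemma L2_converges_mult_bounded:
  assumes F: "\<And>n. F n \<in> L2 M" and f: "f \<in> L2 M"
    and g: "g \<in> borel_measurable M" "\<And>x. cmod (g x) \<le> B" and c: "L2_converges M F f"
  shows "L2_converges M (\<lambda>n x. g x * F n x) (\<lambda>x. g x * f x)"
proof -
  have B: "B \<ge> 0" using g(2) norm_ge_zero order_trans by blast
  have "norm_L2 M (\<lambda>x. g x * F n x - g x * f x) \<le> norm_L2 M (\<lambda>x. of_real B * (F n x - f x))" for n
    unfolding norm_L2_def
  proof (intro real_sqrt_le_mono integral_mono)
    have "(\<lambda>x. g x * (F n x - f x)) \<in> L2 M" by (rule L2_mult_bounded[OF L2_diff[OF F f] g])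
    then show "integrable M (\<lambda>x. (cmod (g x * F n x - g x * f x))\<^sup>2)"
      by (simp add: L2_def right_diff_distrib)
    show "integrable M (\<lambda>x. (cmod (of_real B * (F n x - f x)))\<^sup>2)"
      by (intro L2_integrable L2_cmult L2_diff F f)
    show "(cmod (g x * F n x - g x * f x))\<^sup>2 \<le> (cmod (of_real B * (F n x - f x)))\<^sup>2" for x
      using g(2)[of x] B
      by (intro power_mono) (auto simp: norm_mult right_diff_distrib[symmetric] intro!: mult_right_mono)
  qed
  then have le: "norm_L2 M (\<lambda>x. g x * F n x - g x * f x) \<le> B * norm_L2 M (\<lambda>x. F n x - f x)" for n
    using B by (simp add: norm_L2_cmult)
  have "(\<lambda>n. norm_L2 M (\<lambda>x. g x * F n x - g x * f x)) \<longlonglongrightarrow> 0"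
  proof (rule Lim_null_comparison)
    show "(\<lambda>n. B * norm_L2 M (\<lambda>x. F n x - f x)) \<longlonglongrightarrow> 0"
      using c L2_converges_iff[of F M f] F f by (auto intro!: tendsto_mult_right_zero)
  qed (use le in auto)
  then show ?thesis using L2_mult_bounded[OF _ g] F f by (subst L2_converges_iff) auto
qed

lemma L2_converges_add:
  assumes F: "\<And>n. F n \<in> L2 M" "f \<in> L2 M" "L2_converges M F f"
    and G: "\<And>n. G n \<in> L2 M" "g \<in> L2 M" "L2_converges M G g"
  shows "L2_converges M (\<lambda>n x. F n x + G n x) (\<lambda>x. f x + g x)"
proof -
  have "(\<lambda>n. norm_L2 M (\<lambda>x. (F n x + G n x) - (f x + g x))) \<longlonglongrightarrow> 0"
  proof (rule Lim_null_comparison)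
    show "(\<lambda>n. norm_L2 M (\<lambda>x. F n x - f x) + norm_L2 M (\<lambda>x. G n x - g x)) \<longlonglongrightarrow> 0"
      using F(3) G(3) unfolding L2_converges_iff[OF F(1,2)] L2_converges_iff[OF G(1,2)]
      by (rule tendsto_add_zero)
    show "\<forall>\<^sub>F n in sequentially. norm (norm_L2 M (\<lambda>x. (F n x + G n x) - (f x + g x)))
        \<le> norm_L2 M (\<lambda>x. F n x - f x) + norm_L2 M (\<lambda>x. G n x - g x)"
      using norm_L2_triangle[OF L2_diff[OF F(1,2)] L2_diff[OF G(1,2)]] by (simp add: add_diff_add)
  qed
  then show ?thesis using F G by (subst L2_converges_iff) (auto intro: L2_add)
qed

lemma L2_converges_sum:
  assumes "\<And>i n. i \<in> A \<Longrightarrow> F i n \<in> L2 M" "\<And>i. i \<in> A \<Longrightarrow> f i \<in> L2 M"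
    "\<And>i. i \<in> A \<Longrightarrow> L2_converges M (F i) (f i)"
  shows "L2_converges M (\<lambda>n x. \<Sum>i\<in>A. F i n x) (\<lambda>x. \<Sum>i\<in>A. f i x)"
  using assms
proof (induction A rule: infinite_finite_induct)
  case (insert i A)
  have "L2_converges M (\<lambda>n x. F i n x + (\<Sum>i\<in>A. F i n x)) (\<lambda>x. f i x + (\<Sum>i\<in>A. f i x))"
  proof (rule L2_converges_add)
    show "L2_converges M (\<lambda>n x. \<Sum>i\<in>A. F i n x) (\<lambda>x. \<Sum>i\<in>A. f i x)"
      by (rule insert.IH) (use insert.prems in auto)
  qed (use insert.prems in \<open>auto intro!: L2_sum\<close>)
  then show ?case using insert.hyps by simp
qed (simp_all add: L2_converges_def)

text \<open>
  Riesz-Fischer. Along a subsequence whose successive differences \<open>d\<^sub>k\<close> satisfy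
  \<open>\<parallel>d\<^sub>k\<parallel>\<^sup>2 \<le> 4\<^sup>-\<^sup>k\<close>, the function \<open>\<Sum>k. 2\<^sup>k |d\<^sub>k|\<^sup>2\<close> is integrable, hence finite almost
  everywhere, and then \<open>\<Sum>k. |d\<^sub>k|\<close> converges; Fatou's lemma turns the pointwise limit into a limit
  in the mean.
\<close>

lemma L2_complete:
  assumes F: "\<And>n. F n \<in> L2 M"
    and Cauchy: "\<And>e. e > 0 \<Longrightarrow> \<exists>N. \<forall>m\<ge>N. \<forall>n\<ge>N. norm_L2 M (\<lambda>x. F m x - F n x) \<le> e"
  obtains g where "g \<in> L2 M" "L2_converges M F g"
proof -
  have [measurable]: "F n \<in> borel_measurable M" for n using F by (rule L2_measurable)
  have "\<exists>N. \<forall>m\<ge>N. \<forall>n\<ge>N. norm_L2 M (\<lambda>x. F m x - F n x) \<le> (1/2) ^ k" for k :: nat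
    by (rule Cauchy) simp
  then obtain N where N: "\<And>k m n. m \<ge> N k \<Longrightarrow> n \<ge> N k \<Longrightarrow> norm_L2 M (\<lambda>x. F m x - F n x) \<le> (1/2) ^ k"
    by metis
  define r where "r k = (\<Sum>i\<le>k. N i) + k" for k
  have rN: "r k \<ge> N k" for k by (simp add: r_def atMost_Suc member_le_sum trans_le_add1)
  have rmono: "r k \<le> r (Suc k)" for k by (simp add: r_def)
  have rk: "r k \<ge> k" for k by (simp add: r_def)
  define d where "d k x = F (r (Suc k)) x - F (r k) x" for k x
  have [measurable]: "d k \<in> borel_measurable M" for k unfolding d_def by measurable
  have dL2: "d k \<in> L2 M" for k unfolding d_def by (intro L2_diff F)
  have dn: "(norm_L2 M (d k))\<^sup>2 \<le> (1/4) ^ k" for k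
  proof -
    have "norm_L2 M (d k) \<le> (1/2) ^ k"
      unfolding d_def using rN[of k] rmono[of k] by (intro N) auto
    then have "(norm_L2 M (d k))\<^sup>2 \<le> ((1/2) ^ k)\<^sup>2" by (intro power_mono) auto
    also have "\<dots> = (1/4) ^ k" by (simp add: power2_eq_square flip: power_mult_distrib)
    finally show ?thesis .
  qed
  have "(\<integral>\<^sup>+x. (\<Sum>k. ennreal (2 ^ k * (cmod (d k x))\<^sup>2)) \<partial>M) = (\<Sum>k. \<integral>\<^sup>+x. ennreal (2 ^ k * (cmod (d k x))\<^sup>2) \<partial>M)"
    by (rule nn_integral_suminf) measurable
  also have "\<dots> = (\<Sum>k. ennreal (2 ^ k * (norm_L2 M (d k))\<^sup>2))"
    by (simp add: ennreal_mult nn_integral_cmult nn_integral_L2[OF dL2])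
  also have "\<dots> \<le> (\<Sum>k. ennreal ((1/2) ^ k))"
  proof (intro suminf_le ennreal_leI)
    show "2 ^ k * (norm_L2 M (d k))\<^sup>2 \<le> (1/2) ^ k" for k
    proof -
      have "2 ^ k * (norm_L2 M (d k))\<^sup>2 \<le> 2 ^ k * (1/4) ^ k" using dn by (intro mult_left_mono) auto
      also have "\<dots> = (1/2) ^ k" by (simp flip: power_mult_distrib)
      finally show ?thesis .
    qed
  qed auto
  also have "\<dots> < \<infinity>"
    by (subst suminf_ennreal2) (simp_all add: summable_geometric)
  finally have "AE x in M. (\<Sum>k. ennreal (2 ^ k * (cmod (d k x))\<^sup>2)) \<noteq> \<infinity>"
    by (intro nn_integral_noteq_infinite) auto
  then have conv: "AE x in M. (\<lambda>k. F (r k) x) \<longlonglongrightarrow> lim (\<lambda>k. F (r k) x)"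
  proof (rule AE_mp, intro AE_I2 impI)
    fix x assume fin: "(\<Sum>k. ennreal (2 ^ k * (cmod (d k x))\<^sup>2)) \<noteq> \<infinity>"
    define C where "C = enn2real (\<Sum>k. ennreal (2 ^ k * (cmod (d k x))\<^sup>2))"
    have C: "C \<ge> 0" "(\<Sum>k. ennreal (2 ^ k * (cmod (d k x))\<^sup>2)) = ennreal C"
      unfolding C_def ennreal_enn2real_if using fin by simp_all
    have "ennreal (2 ^ k * (cmod (d k x))\<^sup>2) \<le> ennreal C" for k
      using sum_le_suminf[of "\<lambda>k. ennreal (2 ^ k * (cmod (d k x))\<^sup>2)" "{k}"] C by simp
    then have "2 ^ k * (cmod (d k x))\<^sup>2 \<le> C" for k using C(1) by (simp add: ennreal_le_iff)
    then have "(cmod (d k x))\<^sup>2 \<le> C * (1/2) ^ k" for k by (simp add: field_simps power_divide)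
    then have "sqrt ((cmod (d k x))\<^sup>2) \<le> sqrt (C * (1/2) ^ k)" for k by (intro real_sqrt_le_mono)
    then have dle: "cmod (d k x) \<le> sqrt C * sqrt (1/2) ^ k" for k
      by (simp add: real_sqrt_mult real_sqrt_power)
    have "summable (\<lambda>k. sqrt C * sqrt (1/2) ^ k)"
      by (intro summable_mult summable_geometric) (simp add: real_sqrt_divide)
    then have "summable (\<lambda>k. d k x)" using dle by (rule summable_comparison_test'[where N = 0])
    then have "convergent (\<lambda>n. \<Sum>k<n. d k x)" by (simp add: summable_iff_convergent)
    moreover have "(\<Sum>k<n. d k x) = F (r n) x - F (r 0) x" for n
      unfolding d_def by (rule sum_lessThan_telescope)
    ultimately have "convergent (\<lambda>n. F (r n) x - F (r 0) x)" by simp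
    then have "convergent (\<lambda>n. F (r n) x)" using convergent_diff_const_right_iff by blast
    then show "(\<lambda>k. F (r k) x) \<longlonglongrightarrow> lim (\<lambda>k. F (r k) x)" by (simp add: convergent_LIMSEQ_iff)
  qed
  define g where "g x = lim (\<lambda>k. F (r k) x)" for x
  have [measurable]: "g \<in> borel_measurable M" unfolding g_def by (rule borel_measurable_lim_metric) measurable
  have le: "(\<integral>\<^sup>+x. ennreal ((cmod (F n x - g x))\<^sup>2) \<partial>M) \<le> ennreal (e\<^sup>2)"
    if e: "e > 0" "\<And>m. m \<ge> K \<Longrightarrow> norm_L2 M (\<lambda>x. F n x - F m x) \<le> e" for e n K
  proof -
    have "(\<integral>\<^sup>+x. ennreal ((cmod (F n x - g x))\<^sup>2) \<partial>M)
        = (\<integral>\<^sup>+x. liminf (\<lambda>k. ennreal ((cmod (F n x - F (r k) x))\<^sup>2)) \<partial>M)"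
    proof (rule nn_integral_cong_AE, use conv in eventually_elim)
      fix x assume "(\<lambda>k. F (r k) x) \<longlonglongrightarrow> lim (\<lambda>k. F (r k) x)"
      then have "(\<lambda>k. ennreal ((cmod (F n x - F (r k) x))\<^sup>2)) \<longlonglongrightarrow> ennreal ((cmod (F n x - g x))\<^sup>2)"
        unfolding g_def by (intro tendsto_intros) auto
      then show "ennreal ((cmod (F n x - g x))\<^sup>2) = liminf (\<lambda>k. ennreal ((cmod (F n x - F (r k) x))\<^sup>2))"
        using lim_imp_Liminf[OF trivial_limit_sequentially] by metis
    qed
    also have "\<dots> \<le> liminf (\<lambda>k. \<integral>\<^sup>+x. ennreal ((cmod (F n x - F (r k) x))\<^sup>2) \<partial>M)"
      by (rule nn_integral_liminf) measurable
    also have "\<dots> \<le> ennreal (e\<^sup>2)"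
    proof (rule Liminf_le)
      show "\<forall>\<^sub>F k in sequentially. (\<integral>\<^sup>+x. ennreal ((cmod (F n x - F (r k) x))\<^sup>2) \<partial>M) \<le> ennreal (e\<^sup>2)"
      proof (rule eventually_sequentiallyI[of K])
        fix k assume "k \<ge> K"
        then have "norm_L2 M (\<lambda>x. F n x - F (r k) x) \<le> e" using rk[of k] by (intro e) auto
        then show "(\<integral>\<^sup>+x. ennreal ((cmod (F n x - F (r k) x))\<^sup>2) \<partial>M) \<le> ennreal (e\<^sup>2)"
          by (simp add: nn_integral_L2[OF L2_diff[OF F F]] ennreal_leI power_mono)
      qed
    qed simp
    finally show ?thesis .
  qed
  obtain K where K: "\<forall>m\<ge>K. \<forall>n\<ge>K. norm_L2 M (\<lambda>x. F m x - F n x) \<le> 1" using Cauchy[of 1] by auto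
  have "(\<lambda>x. F K x - g x) \<in> L2 M"
    using le[of 1 K K] K by (auto simp: L2_iff_nn_integral less_top[symmetric] top_unique)
  then have gL2: "g \<in> L2 M" using L2_diff[OF F[of K], of "\<lambda>x. F K x - g x"] by simp
  have "(\<lambda>n. norm_L2 M (\<lambda>x. F n x - g x)) \<longlonglongrightarrow> 0"
  proof (rule LIMSEQ_I)
    fix e :: real assume e: "e > 0"
    obtain K where K: "\<forall>m\<ge>K. \<forall>n\<ge>K. norm_L2 M (\<lambda>x. F m x - F n x) \<le> e / 2"
      using Cauchy[of "e / 2"] e by auto
    have "norm_L2 M (\<lambda>x. F n x - g x) < e" if "n \<ge> K" for n
    proof -
      have "ennreal ((norm_L2 M (\<lambda>x. F n x - g x))\<^sup>2) \<le> ennreal ((e/2)\<^sup>2)"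
        unfolding nn_integral_L2[OF L2_diff[OF F gL2], symmetric]
        by (rule le[of "e / 2" K]) (use K that e in auto)
      then have "(norm_L2 M (\<lambda>x. F n x - g x))\<^sup>2 \<le> (e/2)\<^sup>2"
        by (simp only: ennreal_le_iff zero_le_power2)
      then have "norm_L2 M (\<lambda>x. F n x - g x) \<le> e / 2"
        by (rule power2_le_imp_le) (use e in simp)
      then show ?thesis using e by simp
    qed
    then show "\<exists>no. \<forall>n\<ge>no. norm (norm_L2 M (\<lambda>x. F n x - g x) - 0) < e" by auto
  qed
  then have "L2_converges M F g" by (simp add: L2_converges_iff[OF F gL2])
  with gL2 show thesis by (rule that)
qed

context local_field_setup
begin

section \<open>Valuation and the coset representatives\<close>

text \<open>
  Read off from the absolute value of the prime element; \<open>q_eq\<close> gives the usual form.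
\<close>

definition q :: nat where "q = nat \<lfloor>inverse (absv pp)\<rfloor>"

lemma q_eq: "q = CHAR('a) ^ c"
  by (simp add: q_def absv_prime del: of_nat_power)

abbreviation Q :: real where "Q \<equiv> real q"

abbreviation uu :: "nat \<Rightarrow> 'a" where "uu \<equiv> u pp c eps"

text \<open>
  With \<open>P\<close> the maximal ideal this is \<open>a + P\<^sup>n\<close>, also for negative \<open>n\<close>.
\<close>

definition coset :: "int \<Rightarrow> 'a \<Rightarrow> 'a set" where
  "coset n a = {x. absv (x - a) \<le> Q powi (- n)}"

lemma absv_0 [simp]: "absv 0 = 0"
  using absv_eq_0_iff by simp

lemma absv_1 [simp]: "absv 1 = 1"
proof -
  have "absv 1 * absv 1 = absv 1 * 1" using absv_mult[of 1 1] by simp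
  then show ?thesis using absv_eq_0_iff[of 1] by (metis mult_cancel_left zero_neq_one)
qed

lemma absv_minus [simp]: "absv (- x) = absv x"
proof -
  have "absv (-1) * absv (-1) = 1" using absv_mult[of "-1" "-1"] by simp
  then have "absv (-1) = 1" using absv_nonneg[of "-1"]
    by (metis abs_of_nonneg abs_square_eq_1 power2_eq_square)
  then show ?thesis using absv_mult[of "-1" x] by simp
qed

lemma absv_diff_commute: "absv (x - y) = absv (y - x)"
  using absv_minus[of "x - y"] by simp

lemma absv_add_le: "absv x \<le> r \<Longrightarrow> absv y \<le> r \<Longrightarrow> absv (x + y) \<le> r"
  using absv_ultrametric[of x y] by linarith

lemma absv_diff_le: "absv x \<le> r \<Longrightarrow> absv y \<le> r \<Longrightarrow> absv (x - y) \<le> r"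
  using absv_add_le[of x r "- y"] by simp

lemma absv_sum_le:
  "r \<ge> 0 \<Longrightarrow> (\<And>i. i \<in> A \<Longrightarrow> absv (f i) \<le> r) \<Longrightarrow> absv (\<Sum>i\<in>A. f i) \<le> r"
  by (induction A rule: infinite_finite_induct) (auto intro: absv_add_le)

lemma absv_inverse: "absv (inverse x) = inverse (absv x)"
proof (cases "x = 0")
  case False
  then have "absv x * absv (inverse x) = 1" using absv_mult[of x "inverse x"] by simp
  then show ?thesis by (metis inverse_unique)
qed simp

lemma absv_power: "absv (x ^ n) = absv x ^ n"
  by (induction n) (auto simp: absv_mult)

lemma absv_powi: "absv (x powi n) = absv x powi n"
  by (auto simp: power_int_def absv_power absv_inverse)

lemma q_pos: "q > 0"
  using char_pos by (simp add: q_eq)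

lemma absv_pp: "absv pp = 1 / Q"
  using absv_prime by (simp add: q_eq field_simps del: of_nat_power)

lemma q_gt_1: "q > 1"
proof (rule ccontr)
  assume "\<not> q > 1"
  then have "q = 1" using q_pos by linarith
  then have "absv pp = 1" using absv_pp by simp
  moreover have "pp \<in> max_ideal absv"
    using prime_element by (auto simp: int_ring_def image_iff intro!: exI[of _ 1] bexI[of _ 1])
  ultimately show False by (simp add: max_ideal_def)
qed

lemma Q_gt_1: "Q > 1" using q_gt_1 by simp

lemma pp_nonzero [simp]: "pp \<noteq> 0"
  using absv_pp Q_gt_1 absv_eq_0_iff[of pp] by auto

lemma absv_pp_powi: "absv (pp powi n) = Q powi (- n)"
  by (simp add: absv_powi absv_pp power_int_minus power_int_inverse field_simps)

lemma powi_Q_pos [simp]: "Q powi n > 0"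
  using Q_gt_1 by simp

lemma powi_Q_le_iff: "Q powi m \<le> Q powi n \<longleftrightarrow> m \<le> n"
  using Q_gt_1 by (metis linorder_not_less power_int_increasing power_int_strict_increasing order_less_imp_le)

lemma max_ideal_iff: "x \<in> max_ideal absv \<longleftrightarrow> absv x \<le> 1 / Q"
proof
  assume "x \<in> max_ideal absv"
  then obtain y where "x = pp * y" "absv y \<le> 1" using prime_element by (auto simp: int_ring_def)
  then show "absv x \<le> 1 / Q"
    using mult_left_mono[of "absv y" 1 "1/Q"] by (simp add: absv_mult absv_pp)
next
  assume "absv x \<le> 1 / Q"
  moreover have "1 / Q < 1" using Q_gt_1 by simp
  ultimately show "x \<in> max_ideal absv" by (simp add: max_ideal_def)
qed

lemma absv_less_1_iff: "absv x < 1 \<longleftrightarrow> absv x \<le> 1 / Q"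
  using max_ideal_iff[of x] by (simp add: max_ideal_def)

text \<open>
  The value group is discrete: an element of absolute value below \<open>1\<close> is a multiple of the prime
  element, so no absolute value lies strictly between consecutive powers of \<open>q\<close>.
\<close>

lemma absv_less_powi_iff: "absv x < Q powi n \<longleftrightarrow> absv x \<le> Q powi (n - 1)"
proof -
  have "absv (x * pp powi n) = absv x / Q powi n"
    by (simp add: absv_mult absv_pp_powi power_int_minus field_simps)
  moreover have "Q powi (n - 1) = Q powi n * (1 / Q)"
    using Q_gt_1 by (simp add: power_int_diff)
  ultimately show ?thesis
    using absv_less_1_iff[of "x * pp powi n"] powi_Q_pos[of n]
    by (simp only: divide_less_eq_1_pos pos_divide_le_eq mult.commute[of "1 / Q"])
qed

lemma prime_char: "prime CHAR('a)"
  using char_pos prime_CHAR_semidom by blast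

text \<open>
  The images of the natural numbers have absolute value at most \<open>1\<close>, and Bezout's identity inverts
  those prime to the characteristic among them; these are therefore units.
\<close>

lemma of_nat_in_max_ideal_iff: "(of_nat a :: 'a) \<in> max_ideal absv \<longleftrightarrow> CHAR('a) dvd a"
proof
  assume a: "(of_nat a :: 'a) \<in> max_ideal absv"
  show "CHAR('a) dvd a"
  proof (rule ccontr)
    assume "\<not> CHAR('a) dvd a"
    then have "a \<noteq> 0" by (metis dvd_0_right)
    have "gcd a CHAR('a) = 1" using \<open>\<not> CHAR('a) dvd a\<close> prime_imp_coprime[OF prime_char]
      by (auto simp: coprime_iff_gcd_eq_1 gcd.commute)
    with \<open>a \<noteq> 0\<close> obtain b k where "a * b = CHAR('a) * k + 1"
      using bezout_nat[of a "CHAR('a)"] by auto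
    then have "(of_nat (a * b) :: 'a) = of_nat (CHAR('a) * k + 1)" by simp
    then have "(of_nat a * of_nat b :: 'a) = 1" by simp
    moreover have "absv (of_nat b) \<le> 1"
      by (induction b) (auto intro: absv_add_le)
    moreover have "absv (of_nat a) < 1" using a by (simp add: max_ideal_def)
    ultimately show False using absv_mult[of "of_nat a" "of_nat b"] absv_nonneg[of "of_nat a"]
      by (metis absv_1 absv_nonneg less_irrefl mult_left_le order_le_less_trans)
  qed
next
  assume "CHAR('a) dvd a"
  then have "(of_nat a :: 'a) = 0" by (simp add: of_nat_eq_0_iff_char_dvd)
  then show "(of_nat a :: 'a) \<in> max_ideal absv" by (simp add: max_ideal_def)
qed

lemma mod_power_eqI:
  fixes n m p :: nat
  assumes "\<And>k. k < d \<Longrightarrow> n div p ^ k mod p = m div p ^ k mod p"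
  shows "n mod p ^ d = m mod p ^ d"
  using assms
proof (induction d)
  case (Suc d)
  have "i mod p ^ Suc d = p ^ d * (i div p ^ d mod p) + i mod p ^ d" for i :: nat
    using mod_mult2_eq[of i "p ^ d" p] by (simp add: mult.commute)
  then show ?case using Suc by simp
qed simp

text \<open>
  Together with \<open>mod_power_eqI\<close> this identifies the numbers below \<open>p ^ d\<close> with their digit
  sequences, in the form in which the digits enter \<open>u_digit\<close>.
\<close>

lemma digits_exist:
  fixes a :: "nat \<Rightarrow> nat" and p :: nat
  assumes "p > 0"
  shows "\<exists>b < p ^ d. \<forall>k<d. b div p ^ k mod p = a k mod p"
proof (induction d)
  case (Suc d)
  then obtain b where b: "b < p ^ d" "\<And>k. k < d \<Longrightarrow> b div p ^ k mod p = a k mod p" by blast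
  define b' where "b' = b + p ^ d * (a d mod p)"
  have "b' < p ^ d + p ^ d * (a d mod p)" using b by (simp add: b'_def)
  also have "\<dots> = p ^ d * (1 + a d mod p)" by simp
  also have "\<dots> \<le> p ^ d * p" using assms by (intro mult_le_mono) (auto simp: Suc_le_eq)
  finally have "b' < p ^ Suc d" by (simp add: mult.commute)
  moreover have "b' div p ^ k mod p = a k mod p" if "k < Suc d" for k
  proof (cases "k = d")
    case True
    then show ?thesis using b(1) assms by (simp add: b'_def)
  next
    case False
    then have k: "k < d" using that by simp
    then have e: "p ^ d = p ^ k * (p * p ^ (d - Suc k))"
      by (metis (no_types, lifting) Suc_diff_Suc add_diff_inverse_nat less_imp_not_less power_Suc power_add)
    have "b' div p ^ k = b div p ^ k + p * p ^ (d - Suc k) * (a d mod p)"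
      using assms unfolding b'_def e by (simp add: mult.assoc)
    then have "b' div p ^ k mod p = b div p ^ k mod p" by (simp add: mult.assoc)
    then show ?thesis using b(2)[OF k] by simp
  qed
  ultimately show ?case by blast
qed simp

lemma u_digit_0 [simp]: "u_digit pp c eps 0 = 0"
  by (simp add: u_digit_def)

lemma absv_u_digit_le: "absv (u_digit pp c eps b) \<le> Q"
proof -
  have "absv (of_nat n) \<le> 1" for n
    by (induction n) (auto intro: absv_add_le)
  moreover have "absv (eps k) \<le> 1" if "k < c" for k
    using eps_units[OF that] by (simp add: int_ring_def)
  ultimately have "absv (\<Sum>k<c. of_nat (b div CHAR('a) ^ k mod CHAR('a)) * eps k) \<le> 1"
    by (intro absv_sum_le) (auto simp: absv_mult mult_le_one absv_nonneg)
  then show ?thesis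
    using Q_gt_1 by (simp add: u_digit_def absv_mult absv_inverse absv_pp)
qed

lemma u_digit_inj:
  assumes "b < q" "b' < q" "absv (u_digit pp c eps b - u_digit pp c eps b') \<le> 1"
  shows "b = b'"
proof -
  let ?p = "CHAR('a)"
  define d where "d k = b div ?p ^ k mod ?p" for k
  define d' where "d' k = b' div ?p ^ k mod ?p" for k
  have p: "?p > 0" by (rule char_pos)
  \<comment> \<open>In characteristic \<open>p\<close> the coefficient \<open>p - 1\<close> is \<open>-1\<close>, so differences of digits have natural
    coefficients, as linear independence in \<open>residue_basis\<close> demands.\<close>
  have "(of_nat (?p - 1) :: 'a) = - 1" using p by (simp add: of_nat_diff)
  then have "(of_nat (d k + (?p - 1) * d' k) :: 'a) = of_nat (d k) - of_nat (d' k)" for k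
    by (simp only: of_nat_add of_nat_mult) simp
  then have "(\<Sum>k<c. of_nat (d k + (?p - 1) * d' k) * eps k)
      = (\<Sum>k<c. of_nat (d k) * eps k) - (\<Sum>k<c. of_nat (d' k) * eps k)"
    by (simp add: sum_subtractf[symmetric] left_diff_distrib)
  also have "\<dots> = pp * (u_digit pp c eps b - u_digit pp c eps b')"
    by (simp add: u_digit_def d_def d'_def left_diff_distrib[symmetric])
  also have "\<dots> \<in> max_ideal absv"
    using assms(3) prime_element by (simp add: int_ring_def)
  finally have "\<forall>k<c. (of_nat (d k + (?p - 1) * d' k) :: 'a) \<in> max_ideal absv"
    using eps_basis unfolding residue_basis_def by fast
  then have dv: "?p dvd d k + (?p - 1) * d' k" if "k < c" for k
    using that of_nat_in_max_ideal_iff by blast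
  have "d k = d' k" if "k < c" for k
  proof -
    have "int ?p dvd int (d k + (?p - 1) * d' k)" using dv[OF that] by (simp only: of_nat_dvd_iff)
    also have "int (d k + (?p - 1) * d' k) = (int (d k) - int (d' k)) + int ?p * int (d' k)"
    proof -
      have "int (?p - 1) = int ?p - 1" using p by simp
      then show ?thesis by (simp only: of_nat_add of_nat_mult) (simp add: algebra_simps)
    qed
    finally have "int ?p dvd int (d k) - int (d' k)" by (metis dvd_add_left_iff dvd_triv_left)
    then have "int (d k) mod int ?p = int (d' k) mod int ?p" by (simp add: mod_eq_dvd_iff)
    then show ?thesis by (simp add: d_def d'_def flip: of_nat_mod)
  qed
  then have "b mod ?p ^ c = b' mod ?p ^ c"
    by (intro mod_power_eqI) (auto simp: d_def d'_def)
  then show ?thesis using assms by (simp add: q_eq)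
qed

lemma u_digit_surj:
  assumes "absv x \<le> Q" obtains b where "b < q" "absv (x - u_digit pp c eps b) \<le> 1"
proof -
  have "absv (pp * x) \<le> 1" using assms Q_gt_1 by (simp add: absv_mult absv_pp)
  then obtain a :: "nat \<Rightarrow> nat" where a: "pp * x - (\<Sum>k<c. of_nat (a k) * eps k) \<in> max_ideal absv"
    using eps_basis unfolding residue_basis_def int_ring_def by blast
  obtain b where b: "b < q" "\<forall>k<c. b div CHAR('a) ^ k mod CHAR('a) = a k mod CHAR('a)"
    using digits_exist[OF char_pos, of c a] unfolding q_eq by blast
  have "of_nat (a k mod CHAR('a)) = (of_nat (a k) :: 'a)" for k
  proof -
    have "(of_nat (a k) :: 'a) = of_nat (CHAR('a) * (a k div CHAR('a)) + a k mod CHAR('a))" by simp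
    also have "\<dots> = of_nat (a k mod CHAR('a))" by (simp only: of_nat_add of_nat_mult of_nat_CHAR mult_zero_left add_0)
    finally show ?thesis by simp
  qed
  then have "pp * (x - u_digit pp c eps b) = pp * x - (\<Sum>k<c. of_nat (a k) * eps k)"
    using b(2) by (simp add: u_digit_def algebra_simps)
  then have "absv (pp * (x - u_digit pp c eps b)) \<le> 1 / Q" using a max_ideal_iff by simp
  then have "absv (x - u_digit pp c eps b) \<le> 1" using Q_gt_1 by (simp add: absv_mult absv_pp divide_simps)
  then show thesis using b that by blast
qed

lemma u_eq_sum:
  assumes "n < q ^ N"
  shows "uu n = (\<Sum>k<N. u_digit pp c eps (n div q ^ k mod q) * inverse pp ^ k)"
proof -
  let ?f = "\<lambda>k. u_digit pp c eps (n div q ^ k mod q) * inverse pp ^ k"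
  have z: "?f k = 0" if "n < q ^ k" for k using that by simp
  have mono: "n < q ^ k" if "n < q ^ l" "l \<le> k" for k l
    using that power_increasing[of l k q] q_gt_1 by linarith
  have "n < q ^ Suc n" using power_gt_expt[of q "Suc n"] q_gt_1 by simp
  have "uu n = (\<Sum>k<Suc n. ?f k)" by (simp add: u_def q_eq lessThan_Suc_atMost)
  also have "\<dots> = (\<Sum>k<N + Suc n. ?f k)"
    by (rule sum.mono_neutral_left) (use z[OF mono[OF \<open>n < q ^ Suc n\<close>]] in auto)
  also have "\<dots> = (\<Sum>k<N. ?f k)"
    by (rule sum.mono_neutral_right) (use z[OF mono[OF assms]] in auto)
  finally show ?thesis .
qed

lemma u_0 [simp]: "uu 0 = 0"
  by (simp add: u_def)

text \<open>
  Splitting off the leading digit: for \<open>b > 0\<close> its contribution has absolute value \<open>q ^ (N + 1)\<close>,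
  which exceeds all that the lower digits contribute. Existence and uniqueness of representatives
  follow from this by induction on the number of digits.
\<close>

lemma u_add_digit:
  assumes "n < q ^ N" "b < q"
  shows "uu (n + b * q ^ N) = uu n + u_digit pp c eps b * inverse pp ^ N"
proof -
  have "n + b * q ^ N < (1 + b) * q ^ N" using assms by simp
  also have "\<dots> \<le> q * q ^ N" using assms(2) by (intro mult_le_mono) auto
  finally have lt: "n + b * q ^ N < q ^ Suc N" by simp
  have "(n + b * q ^ N) div q ^ k mod q = n div q ^ k mod q" if "k < N" for k
  proof -
    have e: "q ^ N = q ^ k * (q * q ^ (N - Suc k))"
      using that by (metis (no_types, lifting) Suc_diff_Suc add_diff_inverse_nat less_imp_not_less power_Suc power_add)
    have "(n + b * q ^ N) div q ^ k = n div q ^ k + q * (q ^ (N - Suc k) * b)"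
      using q_pos unfolding e by (simp add: mult.assoc mult.left_commute[of b] mult.commute[of b])
    then show ?thesis by simp
  qed
  moreover have "(n + b * q ^ N) div q ^ N mod q = b" using assms q_pos by simp
  ultimately show ?thesis
    by (simp add: u_eq_sum[OF lt] u_eq_sum[OF assms(1)])
qed

lemma nat_digit_split:
  assumes "n < q ^ Suc N" obtains n' b where "n' < q ^ N" "b < q" "n = n' + b * q ^ N"
proof (rule that)
  show "n mod q ^ N < q ^ N" using q_pos by simp
  show "n div q ^ N < q" using assms q_pos by (simp add: less_mult_imp_div_less)
  show "n = n mod q ^ N + n div q ^ N * q ^ N" by (metis mod_div_mult_eq)
qed

lemma absv_u_le: "n < q ^ N \<Longrightarrow> absv (uu n) \<le> Q ^ N"
proof (induction N arbitrary: n)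
  case (Suc N)
  obtain n' b where nb: "n' < q ^ N" "b < q" "n = n' + b * q ^ N"
    using nat_digit_split[OF Suc.prems] by blast
  have "absv (uu n') \<le> Q ^ Suc N"
    using Suc.IH[OF nb(1)] power_increasing[of N "Suc N" Q] Q_gt_1 by linarith
  moreover have "absv (u_digit pp c eps b * inverse pp ^ N) \<le> Q ^ Suc N"
    using absv_u_digit_le[of b] Q_gt_1
    by (simp add: absv_mult absv_power absv_inverse absv_pp mult_right_mono)
  ultimately show ?case unfolding nb(3) u_add_digit[OF nb(1,2)] by (rule absv_add_le)
qed (auto simp: u_def)

lemma u_surj_bounded:
  "absv x \<le> Q ^ N \<Longrightarrow> \<exists>n < q ^ N. absv (x - uu n) \<le> 1"
proof (induction N arbitrary: x)
  case (Suc N)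
  have "absv (x * pp ^ N) \<le> Q"
    using Suc.prems Q_gt_1 by (simp add: absv_mult absv_power absv_pp divide_simps)
  then obtain b where b: "b < q" "absv (x * pp ^ N - u_digit pp c eps b) \<le> 1"
    by (rule u_digit_surj)
  have "x - u_digit pp c eps b * inverse pp ^ N = (x * pp ^ N - u_digit pp c eps b) * inverse pp ^ N"
    by (simp add: field_simps)
  then have "absv (x - u_digit pp c eps b * inverse pp ^ N) \<le> Q ^ N"
    using b(2) Q_gt_1 by (simp add: absv_mult absv_power absv_inverse absv_pp mult_left_le_one_le absv_nonneg)
  then obtain n where n: "n < q ^ N" "absv (x - u_digit pp c eps b * inverse pp ^ N - uu n) \<le> 1"
    using Suc.IH by blast
  have "n + b * q ^ N < (1 + b) * q ^ N" using n by simp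
  also have "\<dots> \<le> q * q ^ N" using b(1) by (intro mult_le_mono) auto
  finally have "n + b * q ^ N < q ^ Suc N" by simp
  moreover have "absv (x - uu (n + b * q ^ N)) \<le> 1"
    using n(2) by (simp add: u_add_digit[OF n(1) b(1)] algebra_simps)
  ultimately show ?case by blast
qed auto

lemma u_inj_bounded:
  "n < q ^ N \<Longrightarrow> m < q ^ N \<Longrightarrow> absv (uu n - uu m) \<le> 1 \<Longrightarrow> n = m"
proof (induction N arbitrary: n m)
  case (Suc N)
  obtain n' b where nb: "n' < q ^ N" "b < q" "n = n' + b * q ^ N"
    using nat_digit_split[OF Suc.prems(1)] by blast
  obtain m' b' where mb: "m' < q ^ N" "b' < q" "m = m' + b' * q ^ N"
    using nat_digit_split[OF Suc.prems(2)] by blast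
  let ?D = "(u_digit pp c eps b - u_digit pp c eps b') * inverse pp ^ N"
  have QN: "1 \<le> Q ^ N" using Q_gt_1 by simp
  have e: "uu n - uu m = (uu n' - uu m') + ?D"
    by (simp add: nb(3) mb(3) u_add_digit[OF nb(1,2)] u_add_digit[OF mb(1,2)] algebra_simps)
  have "absv (uu n - uu m - (uu n' - uu m')) \<le> Q ^ N"
    using Suc.prems(3) QN absv_u_le[OF nb(1)] absv_u_le[OF mb(1)]
    by (intro absv_diff_le[of "uu n - uu m"] absv_diff_le[of "uu n'"]) linarith+
  then have "absv ?D \<le> Q ^ N" unfolding e by simp
  then have "absv (u_digit pp c eps b - u_digit pp c eps b') \<le> 1"
    using Q_gt_1 by (simp add: absv_mult absv_power absv_inverse absv_pp)
  then have bb: "b = b'" using u_digit_inj nb(2) mb(2) by blast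
  then have "absv (uu n' - uu m') \<le> 1" using Suc.prems(3) unfolding e by simp
  then show ?case using Suc.IH nb mb bb by blast
qed simp

lemma ex_power_bound: "\<exists>N. x \<le> Q ^ N"
  using real_arch_pow[OF Q_gt_1, of x] less_imp_le by blast

lemma u_surj: "\<exists>k. absv (x - uu k) \<le> 1"
  using u_surj_bounded ex_power_bound by blast

lemma u_inj: "absv (uu k - uu l) \<le> 1 \<Longrightarrow> k = l"
proof -
  assume a: "absv (uu k - uu l) \<le> 1"
  obtain N where "max (real k) (real l) < Q ^ N" using real_arch_pow[OF Q_gt_1] by blast
  then have "real k < real (q ^ N)" "real l < real (q ^ N)" by auto
  then show "k = l" using a by (intro u_inj_bounded[of k N l]) (simp_all only: of_nat_less_iff)
qed

lemma absv_u_le_iff: "absv (uu k) \<le> Q ^ N \<longleftrightarrow> k < q ^ N"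
proof
  assume "absv (uu k) \<le> Q ^ N"
  then obtain n where "n < q ^ N" "absv (uu k - uu n) \<le> 1" using u_surj_bounded by blast
  then show "k < q ^ N" using u_inj by blast
qed (rule absv_u_le)

lemma absv_u_gt_1: "k \<noteq> 0 \<Longrightarrow> absv (uu k) > 1"
  using u_inj[of k 0] by fastforce

section \<open>Cosets of the fractional ideals and Haar measure\<close>

lemma mem_coset: "x \<in> coset n a \<longleftrightarrow> absv (x - a) \<le> Q powi (- n)"
  by (simp add: coset_def)

lemma coset_eq_cball: "coset n a = cball a (Q powi (- n))"
  by (auto simp: coset_def dist_absv absv_diff_commute)

lemma coset_self [simp]: "a \<in> coset n a"
  using less_imp_le[OF powi_Q_pos] by (simp add: mem_coset)

lemma coset_eqI: "b \<in> coset n a \<Longrightarrow> coset n b = coset n a"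
proof -
  assume b: "b \<in> coset n a"
  have "absv (x - b) \<le> Q powi (- n) \<longleftrightarrow> absv (x - a) \<le> Q powi (- n)" for x
    using absv_add_le[of "x - b" "Q powi (- n)" "b - a"] absv_diff_le[of "x - a" "Q powi (- n)" "b - a"] b
    by (auto simp: mem_coset)
  then show ?thesis by (simp add: coset_def)
qed

lemma coset_mono: "m \<le> n \<Longrightarrow> coset n a \<subseteq> coset m a"
  using powi_Q_le_iff[of "- n" "- m"] by (auto simp: mem_coset)

lemma coset_subset: "m \<le> n \<Longrightarrow> b \<in> coset m a \<Longrightarrow> coset n b \<subseteq> coset m a"
  using coset_mono[of m n b] coset_eqI[of b m a] by blast

lemma int_ring_eq_coset: "int_ring absv = coset 0 0"
  by (simp add: int_ring_def coset_def)

lemma space_mu [simp]: "space mu = UNIV"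
  using sets_eq_imp_space_eq[OF sets_mu] by simp

declare sets_mu [measurable_cong]

lemma coset_borel [measurable]: "coset n a \<in> sets borel"
  unfolding coset_eq_cball by simp

lemma coset_mu [simp]: "coset n a \<in> sets mu"
  unfolding sets_mu by (rule coset_borel)

lemma measurable_mu: "f \<in> borel_measurable mu \<longleftrightarrow> f \<in> borel_measurable borel"
  by (rule arg_cong[where f = "\<lambda>S. f \<in> S", OF measurable_cong_sets[OF sets_mu refl]])

lemma plus_borel [measurable]: "(+) (a :: 'a) \<in> measurable borel borel"
  by (rule borel_measurable_continuous_onI) (auto simp: continuous_on_iff dist_absv)

lemma plus_borel' [measurable]: "(\<lambda>x. x + (a :: 'a)) \<in> measurable borel borel"
  using plus_borel[of a] by (simp add: add.commute[of _ a])

lemma minus_borel [measurable]: "(\<lambda>x. x - (a :: 'a)) \<in> measurable borel borel"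
  using plus_borel'[of "- a"] by simp

lemma times_borel [measurable]: "(*) (a :: 'a) \<in> measurable borel borel"
proof (rule borel_measurable_continuous_onI, rule lipschitz_on_continuous_on)
  show "(absv a)-lipschitz_on UNIV ((*) a)"
    by (rule lipschitz_onI)
       (auto simp: dist_absv absv_mult absv_nonneg right_diff_distrib[symmetric])
qed

lemma absv_borel [measurable]: "absv \<in> borel_measurable borel"
proof -
  have "(\<lambda>x. dist x (0 :: 'a)) \<in> borel_measurable borel"
    by (intro borel_measurable_continuous_onI continuous_intros)
  then show ?thesis by (simp add: dist_absv)
qed

lemma chi_borel [measurable]: "(\<lambda>x. chi (y * x)) \<in> borel_measurable borel"
  using measurable_compose[OF times_borel borel_measurable_continuous_onI[OF chi_continuous]] .

text \<open>
  Scaling by \<open>pp powi n\<close> turns representatives of the ring of integers into representatives of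
  \<open>P\<^sup>n\<close>. In particular the field is a countable union of cosets of each radius.
\<close>

definition rep :: "int \<Rightarrow> nat \<Rightarrow> 'a" where
  "rep n k = pp powi n * uu k"

lemma rep_0: "rep 0 k = uu k" by (simp add: rep_def)

lemma rep_scale: "pp powi j * rep n k = rep (j + n) k"
  by (simp add: rep_def power_int_add)

lemma scaled_absv_le_iff: "absv (pp powi n * x) \<le> Q powi m \<longleftrightarrow> absv x \<le> Q powi (m + n)"
  using Q_gt_1 by (simp add: absv_mult absv_pp_powi power_int_add power_int_minus field_simps)

lemma rep_surj: "\<exists>k. x \<in> coset n (rep n k)"
proof -
  obtain k where k: "absv (pp powi (- n) * x - uu k) \<le> 1" using u_surj by blast
  have "x - rep n k = pp powi n * (pp powi (- n) * x - uu k)"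
    by (simp add: rep_def power_int_minus algebra_simps)
  then have "x \<in> coset n (rep n k)"
    using k scaled_absv_le_iff[of n "pp powi (- n) * x - uu k" "- n"] by (simp add: mem_coset)
  then show ?thesis ..
qed

lemma rep_diff_le_iff: "absv (rep n k - rep n l) \<le> Q powi (- n) \<longleftrightarrow> k = l"
proof -
  have "rep n k - rep n l = pp powi n * (uu k - uu l)" by (simp add: rep_def algebra_simps)
  then show ?thesis using scaled_absv_le_iff[of n "uu k - uu l" "- n"] u_inj by auto
qed

lemma rep_inj: "x \<in> coset n (rep n k) \<Longrightarrow> x \<in> coset n (rep n l) \<Longrightarrow> k = l"
  using absv_diff_le[of "x - rep n l" "Q powi (- n)" "x - rep n k"] rep_diff_le_iff[of n k l]
  by (simp add: mem_coset)

lemma disjoint_cosets: "disjoint_family (\<lambda>k. coset n (rep n k))"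
  using rep_inj by (auto simp: disjoint_family_on_def)

lemma nn_integral_cosets:
  assumes [measurable]: "f \<in> borel_measurable borel"
  shows "(\<integral>\<^sup>+x. f x \<partial>mu) = (\<Sum>k. \<integral>\<^sup>+x. f x * indicator (coset n (rep n k)) x \<partial>mu)"
proof -
  have "(\<integral>\<^sup>+x. f x \<partial>mu) = (\<integral>\<^sup>+x. (\<Sum>k. f x * indicator (coset n (rep n k)) x) \<partial>mu)"
  proof (rule nn_integral_cong)
    fix x
    obtain k where "x \<in> coset n (rep n k)" using rep_surj by blast
    then show "f x = (\<Sum>k. f x * indicator (coset n (rep n k)) x)"
      using suminf_cmult_indicator[OF disjoint_cosets, of x n k "\<lambda>_. f x"] by simp
  qed
  also have "\<dots> = (\<Sum>k. \<integral>\<^sup>+x. f x * indicator (coset n (rep n k)) x \<partial>mu)"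
    by (rule nn_integral_suminf) measurable
  finally show ?thesis .
qed

lemma nn_integral_translate:
  assumes [measurable]: "f \<in> borel_measurable borel"
  shows "(\<integral>\<^sup>+x. f (a + x) \<partial>mu) = (\<integral>\<^sup>+x. f x \<partial>mu)"
  using nn_integral_distr[of "(+) a" mu borel f] by (simp add: translation_invariant)

lemma integral_translate:
  fixes f :: "'a \<Rightarrow> complex"
  assumes [measurable]: "f \<in> borel_measurable borel"
  shows "(LINT x|mu. f (a + x)) = (LINT x|mu. f x)"
  using integral_distr[of "(+) a" mu borel f] by (simp add: translation_invariant)

lemma emeasure_coset_0: "emeasure mu (coset n a) = emeasure mu (coset n 0)"
proof -
  have "(+) a -` coset n a = coset n 0" by (auto simp: mem_coset)
  then have "emeasure (distr mu borel ((+) a)) (coset n a) = emeasure mu (coset n 0)"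
    by (subst emeasure_distr) auto
  then show ?thesis by (simp add: translation_invariant)
qed

text \<open>
  The representatives \<open>u k\<close> with \<open>k < q\<close>, scaled, split a coset into \<open>q\<close> cosets of the next smaller
  radius, which have equal measure.
\<close>

lemma emeasure_coset_step: "emeasure mu (coset n 0) = of_nat q * emeasure mu (coset (n + 1) 0)"
proof -
  have "coset n 0 = (\<Union>k<q. coset (n + 1) (rep (n + 1) k))"
  proof (rule set_eqI)
    fix x
    obtain k where k: "x \<in> coset (n + 1) (rep (n + 1) k)" using rep_surj by blast
    have sub: "b \<in> coset n 0 \<Longrightarrow> coset (n + 1) b \<subseteq> coset n 0" for b
      by (rule coset_subset) simp_all
    have "x \<in> coset n 0 \<longleftrightarrow> rep (n + 1) k \<in> coset n 0"
      using sub[of x] sub[of "rep (n + 1) k"] coset_eqI[OF k] k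
        coset_self[of "rep (n+1) k" "n+1"] by blast
    also have "\<dots> \<longleftrightarrow> absv (uu k) \<le> Q ^ 1"
      using scaled_absv_le_iff[of "n + 1" "uu k" "- n"] by (simp add: mem_coset rep_def)
    also have "\<dots> \<longleftrightarrow> k < q" using absv_u_le_iff[of k 1] by simp
    finally show "x \<in> coset n 0 \<longleftrightarrow> x \<in> (\<Union>k<q. coset (n + 1) (rep (n + 1) k))"
      using k rep_inj by blast
  qed
  also have "emeasure mu \<dots> = (\<Sum>k<q. emeasure mu (coset (n + 1) (rep (n + 1) k)))"
    by (rule sum_emeasure[symmetric])
       (auto intro: disjoint_family_on_mono[OF _ disjoint_cosets])
  also have "\<dots> = of_nat q * emeasure mu (coset (n + 1) 0)"
    by (subst emeasure_coset_0) simp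
  finally show ?thesis .
qed

lemma emeasure_coset: "emeasure mu (coset n a) = ennreal (Q powi (- n))"
proof -
  have "emeasure mu (coset n 0) = ennreal (Q powi (- n))"
  proof (induction n rule: int_induct[of _ 0])
    case base
    then show ?case using normalised by (simp add: int_ring_eq_coset)
  next
    case (step1 i)
    have "ennreal (1 / Q) * (ennreal Q * emeasure mu (coset (i + 1) 0)) = ennreal (1 / Q) * ennreal (Q powi (- i))"
      using step1 emeasure_coset_step[of i] by (simp add: ennreal_of_nat_eq_real_of_nat)
    moreover have "ennreal (1 / Q) * (ennreal Q * x) = x" for x
      using Q_gt_1 by (simp add: mult.assoc[symmetric] ennreal_mult[symmetric] del: of_nat_less_iff)
    moreover have "ennreal (1 / Q) * ennreal (Q powi (- i)) = ennreal (Q powi (- (i + 1)))"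
      using Q_gt_1 by (subst ennreal_mult[symmetric]) (auto simp: power_int_diff power_int_add power_int_minus field_simps)
    ultimately show ?case by simp
  next
    case (step2 i)
    have "emeasure mu (coset (i - 1) 0) = ennreal Q * ennreal (Q powi (- i))"
      using step2 emeasure_coset_step[of "i - 1"] by (simp add: ennreal_of_nat_eq_real_of_nat)
    also have "\<dots> = ennreal (Q * Q powi (- i))"
      using Q_gt_1 by (subst ennreal_mult) auto
    also have "Q * Q powi (- i) = Q powi (- (i - 1))"
      using Q_gt_1 by (simp add: power_int_diff power_int_minus field_simps)
    finally show ?case .
  qed
  then show ?thesis using emeasure_coset_0 by metis
qed

lemma measure_coset: "measure mu (coset n a) = Q powi (- n)"
  using less_imp_le[OF powi_Q_pos] by (simp add: measure_def emeasure_coset)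

definition cosets :: "'a set set" where
  "cosets = insert {} (range (\<lambda>(n, a). coset n a))"

lemma Int_stable_cosets: "Int_stable cosets"
proof -
  have key: "coset n a \<inter> coset m b \<in> cosets" if "m \<le> n" for n m a b
  proof (cases "coset n a \<inter> coset m b = {}")
    case False
    then obtain x where "x \<in> coset n a" "x \<in> coset m b" by blast
    then have "coset n a = coset n x" "coset n x \<subseteq> coset m b"
      using coset_eqI coset_subset[OF that] by blast+
    then have "coset n a \<inter> coset m b = coset n a" by blast
    then show ?thesis by (auto simp: cosets_def)
  qed (simp add: cosets_def)
  have "coset n a \<inter> coset m b \<in> cosets" for n m a b
    using key[of m n a b] key[of n m b a] by (cases "m \<le> n") (auto simp: Int_commute)
  then show ?thesis by (auto simp: Int_stable_def cosets_def)
qed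

lemma powi_small:
  assumes "e > 0" shows "\<exists>n::nat. Q powi (- int n) < e"
proof -
  obtain n where "1 / e < Q ^ n" using real_arch_pow[OF Q_gt_1] by blast
  then have "inverse (Q ^ n) < e"
    using assms Q_gt_1 by (simp add: field_simps)
  then show ?thesis by (auto simp: power_int_minus)
qed

lemma sets_borel_cosets: "sets borel = sigma_sets UNIV cosets"
proof -
  have "sigma_sets UNIV {S::'a set. open S} = sigma_sets UNIV cosets"
  proof (rule sigma_sets_eqI)
    fix S :: "'a set" assume "S \<in> {S. open S}"
    then have S: "open S" by simp
    define I where "I = {(n, k). coset (int n) (rep (int n) k) \<subseteq> S}"
    have "S = (\<Union>(n, k)\<in>I. coset (int n) (rep (int n) k))"
    proof (intro equalityI subsetI)
      fix x assume "x \<in> S"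
      then obtain e where e: "e > 0" "ball x e \<subseteq> S" using S open_contains_ball by blast
      obtain n :: nat where n: "Q powi (- int n) < e" using powi_small[OF e(1)] by blast
      obtain k where k: "x \<in> coset (int n) (rep (int n) k)" using rep_surj by blast
      have "coset (int n) x \<subseteq> ball x e" using n by (auto simp: coset_eq_cball)
      then have "coset (int n) (rep (int n) k) \<subseteq> S" using coset_eqI[OF k] e(2) by blast
      then show "x \<in> (\<Union>(n, k)\<in>I. coset (int n) (rep (int n) k))" using k by (auto simp: I_def)
    qed (auto simp: I_def)
    moreover have "(\<Union>(n, k)\<in>I. coset (int n) (rep (int n) k)) \<in> sigma_sets UNIV cosets"
      by (rule sigma_sets_UNION) (auto simp: cosets_def image_iff intro!: sigma_sets.Basic countable_image)
    ultimately show "S \<in> sigma_sets UNIV cosets" by simp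
  next
    fix A assume "A \<in> cosets"
    then have "A \<in> sets borel" by (auto simp: cosets_def)
    then show "A \<in> sigma_sets UNIV {S. open S}" by (simp add: sets_borel)
  qed
  then show ?thesis by (simp add: sets_borel)
qed

text \<open>
  Two cosets are nested or disjoint, so together with the empty set they form a generator of the
  Borel sets that is stable under intersection and determines the measure.
\<close>

lemma measure_eq_mu:
  assumes M: "sets M = sets borel"
    and eq: "\<And>n a. emeasure M (coset n a) = emeasure mu (coset n a)"
  shows "M = mu"
proof (rule measure_eqI_generator_eq[OF Int_stable_cosets, of UNIV _ _ "\<lambda>i. coset (- int i) 0"])
  show "emeasure M X = emeasure mu X" if "X \<in> cosets" for X
    using that eq by (auto simp: cosets_def)
  show "sets M = sigma_sets UNIV cosets" "sets mu = sigma_sets UNIV cosets"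
    using M sets_mu sets_borel_cosets by auto
  show "(\<Union>i. coset (- int i) 0) = UNIV"
    using ex_power_bound by (auto simp: mem_coset)
  show "emeasure M (coset (- int i) 0) \<noteq> \<infinity>" for i
    by (simp add: eq emeasure_coset)
qed (auto simp: cosets_def)

lemma density_distr_scale:
  "density (distr mu borel (\<lambda>x. pp powi j * x)) (\<lambda>_. ennreal (Q powi (- j))) = mu"
proof (rule measure_eq_mu)
  fix n a
  have "(\<lambda>x. pp powi j * x) -` coset n a = coset (n - j) (pp powi (- j) * a)"
  proof -
    have "pp powi j * x - a = pp powi j * (x - pp powi (- j) * a)" for x
      by (simp add: power_int_minus algebra_simps)
    then show ?thesis using scaled_absv_le_iff[of j _ "- n"] by (auto simp: mem_coset)
  qed
  then have "emeasure (distr mu borel (\<lambda>x. pp powi j * x)) (coset n a) = ennreal (Q powi (- (n - j)))"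
    by (subst emeasure_distr) (auto simp: emeasure_coset)
  moreover have "ennreal (Q powi (- j)) * ennreal (Q powi (- (n - j))) = ennreal (Q powi (- n))"
    using Q_gt_1 by (subst ennreal_mult[symmetric]) (auto simp: power_int_add[symmetric])
  ultimately show "emeasure (density (distr mu borel (\<lambda>x. pp powi j * x)) (\<lambda>_. ennreal (Q powi (- j)))) (coset n a)
      = emeasure mu (coset n a)"
    by (simp add: emeasure_density_const emeasure_coset)
qed simp

lemma integral_scale:
  fixes f :: "'a \<Rightarrow> complex"
  assumes [measurable]: "f \<in> borel_measurable borel"
  shows "(LINT x|mu. f (pp powi j * x)) = of_real (Q powi j) * (LINT x|mu. f x)"
proof -
  have "(LINT x|mu. f x) = Q powi (- j) *\<^sub>R (LINT x|mu. f (pp powi j * x))"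
    using Q_gt_1
    by (subst density_distr_scale[symmetric, of j], subst integral_density) (auto simp: integral_distr)
  then show ?thesis using Q_gt_1 by (simp add: scaleR_conv_of_real power_int_minus)
qed

section \<open>Characters\<close>

lemma chi_0 [simp]: "chi 0 = 1"
  using chi_trivial[of 0] by (simp add: int_ring_def)

lemma chi_minus: "chi (- x) = cnj (chi x)"
proof -
  have "chi x * chi (- x) = 1" using chi_add[of x "- x"] by simp
  moreover have "chi x * cnj (chi x) = 1"
    using complex_norm_square[of "chi x"] chi_unit by simp
  moreover have "chi x \<noteq> 0" using chi_unit[of x] by auto
  ultimately show ?thesis by (metis mult_cancel_left)
qed

lemma chi_diff: "chi (x - y) = chi x * cnj (chi y)"
  using chi_add[of x "- y"] by (simp add: chi_minus)

lemma chi_eqI: "absv (x - y) \<le> 1 \<Longrightarrow> chi x = chi y"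
  using chi_add[of "x - y" y] chi_trivial[of "x - y"] by (simp add: int_ring_def)

lemma integrable_on_coset:
  fixes g :: "'a \<Rightarrow> complex"
  assumes [measurable]: "g \<in> borel_measurable borel" and "\<And>x. cmod (g x) \<le> B"
  shows "integrable mu (\<lambda>x. g x * indicator (coset n a) x)"
  by (rule integrableI_bounded_set[of "coset n a" _ _ B])
     (auto simp: emeasure_coset assms)

lemma integral_indicator_coset:
  "(LINT x|mu. (indicator (coset n a) x :: complex)) = of_real (Q powi (- n))"
proof -
  have "(LINT x|mu. (indicator (coset n a) x :: complex)) = (LINT x|mu. of_real (indicator (coset n a) x))"
    by (rule Bochner_Integration.integral_cong) (auto simp: indicator_def)
  then show ?thesis by (simp only: integral_complex_of_real) (simp add: measure_coset)
qed

text \<open>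
  A character that is not trivial on a subgroup has mean zero over each of its cosets: translating
  the integral by an element on which the character differs from \<open>1\<close> multiplies it by that value.
\<close>

lemma integral_chi_coset:
  "(LINT x|mu. chi (y * x) * indicator (coset n a) x)
     = (if absv y \<le> Q powi n then chi (y * a) * of_real (Q powi (- n)) else 0)"
proof (cases "absv y \<le> Q powi n")
  case True
  have eq: "chi (y * x) = chi (y * a)" if "x \<in> coset n a" for x
  proof (rule chi_eqI)
    have "absv y * absv (x - a) \<le> Q powi n * Q powi (- n)"
      using True that less_imp_le[OF powi_Q_pos[of n]] by (intro mult_mono) (auto simp: mem_coset absv_nonneg)
    then show "absv (y * x - y * a) \<le> 1"
      using Q_gt_1 by (simp add: absv_mult right_diff_distrib[symmetric] power_int_minus)
  qed
  have "chi (y * x) * indicator (coset n a) x = chi (y * a) * indicator (coset n a) x" for x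
    using eq[of x] by (cases "x \<in> coset n a") simp_all
  then have "(LINT x|mu. chi (y * x) * indicator (coset n a) x)
      = (LINT x|mu. chi (y * a) * indicator (coset n a) x)"
    by presburger
  also have "\<dots> = chi (y * a) * of_real (Q powi (- n))"
    by (simp add: integral_indicator_coset)
  finally show ?thesis using True by simp
next
  case False
  obtain x0 where x0: "absv x0 \<le> 1" "chi (inverse pp * x0) \<noteq> 1"
    using chi_nontrivial by (auto simp: int_ring_def)
  have y: "y \<noteq> 0" using False less_imp_le[OF powi_Q_pos[of n]] by auto
  have "absv y > Q powi n" using False by simp
  then have ge: "absv y \<ge> Q powi (n + 1)" using absv_less_powi_iff[of y "n + 1"] by force
  define h where "h = inverse pp * x0 / y"
  have yh: "y * h = inverse pp * x0" using y by (simp add: h_def)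
  have "absv y * absv h = Q * absv x0"
    using arg_cong[OF yh, of absv] by (simp add: absv_mult absv_inverse absv_pp)
  also have "\<dots> \<le> Q" using x0 Q_gt_1 by (simp add: mult_left_le)
  finally have "absv h * Q powi (n + 1) \<le> Q"
    using mult_right_mono[OF ge absv_nonneg[of h]] by (simp add: mult.commute)
  then have "absv h \<le> Q powi (- n)"
    using Q_gt_1 by (simp add: power_int_add power_int_minus field_simps)
  then have hx: "h + x \<in> coset n a \<longleftrightarrow> x \<in> coset n a" for x
    using coset_eqI[of "h + x" n x] coset_eqI[of "h + x" n a] coset_eqI[of x n a]
      coset_self[of x n] coset_self[of "h + x" n]
    by (auto simp: mem_coset)
  let ?I = "LINT x|mu. chi (y * x) * indicator (coset n a) x"
  have "?I = (LINT x|mu. chi (y * (h + x)) * indicator (coset n a) (h + x))"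
    using integral_translate[of "\<lambda>x. chi (y * x) * indicator (coset n a) x" h] by simp
  also have "\<dots> = (LINT x|mu. chi (y * h) * (chi (y * x) * indicator (coset n a) x))"
    by (intro Bochner_Integration.integral_cong) (auto simp: hx distrib_left chi_add indicator_def)
  also have "\<dots> = chi (y * h) * ?I" by simp
  finally have "?I = 0" using x0(2) yh by simp
  then show ?thesis using False by simp
qed

text \<open>
  Invariance under translation by \<open>P\<^sup>n\<close>. The bounded sets of this kind are the finite unions of
  cosets of \<open>P\<^sup>n\<close>, numbered by the representatives that lie in them.
\<close>

definition step_set :: "int \<Rightarrow> 'a set \<Rightarrow> bool" where
  "step_set n E \<longleftrightarrow> (\<forall>x\<in>E. coset n x \<subseteq> E)"

definition reps :: "int \<Rightarrow> 'a set \<Rightarrow> nat set" where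
  "reps n E = {k. rep n k \<in> E}"

lemma step_set_mem_iff: "step_set n E \<Longrightarrow> y \<in> coset n x \<Longrightarrow> y \<in> E \<longleftrightarrow> x \<in> E"
  using coset_eqI[of y n x] coset_self[of x n] coset_self[of y n] unfolding step_set_def by blast

lemma step_set_coset: "m \<le> n \<Longrightarrow> step_set n (coset m a)"
  using coset_subset by (simp add: step_set_def)

lemma step_set_mono: "step_set m E \<Longrightarrow> m \<le> n \<Longrightarrow> step_set n E"
  using coset_mono by (fastforce simp: step_set_def)

lemma step_set_eq_Union: "step_set n E \<Longrightarrow> E = (\<Union>k\<in>reps n E. coset n (rep n k))"
proof (intro equalityI subsetI)
  fix x assume E: "step_set n E" and "x \<in> E"
  obtain k where "x \<in> coset n (rep n k)" using rep_surj by blast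
  then show "x \<in> (\<Union>k\<in>reps n E. coset n (rep n k))"
    using step_set_mem_iff[OF E] \<open>x \<in> E\<close> by (auto simp: reps_def)
qed (auto simp: reps_def step_set_def)

lemma step_set_borel: "step_set n E \<Longrightarrow> E \<in> sets borel"
  by (subst step_set_eq_Union[of n E]) auto

lemma finite_reps:
  assumes "E \<subseteq> coset m 0" shows "finite (reps n E)"
proof -
  obtain N where N: "Q powi (n - m) \<le> Q ^ N" using ex_power_bound by blast
  have "k < q ^ N" if "k \<in> reps n E" for k
  proof -
    have "absv (pp powi n * uu k) \<le> Q powi (- m)"
      using that assms by (auto simp: reps_def mem_coset rep_def)
    then have "absv (uu k) \<le> Q powi (n - m)" unfolding scaled_absv_le_iff by simp
    then show ?thesis using N absv_u_le_iff[of k N] by linarith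
  qed
  then show ?thesis by (meson finite_lessThan finite_subset lessThan_iff subsetI)
qed

lemma indicator_step_set:
  assumes "step_set n E" "finite (reps n E)"
  shows "(indicator E x :: 'b::semiring_1) = (\<Sum>k\<in>reps n E. indicator (coset n (rep n k)) x)"
proof -
  obtain l where l: "x \<in> coset n (rep n l)" using rep_surj by blast
  have "indicator (coset n (rep n k)) x = (if k = l then 1 else 0 :: 'b)" for k
    using l rep_inj by (auto simp: indicator_def)
  moreover have "x \<in> E \<longleftrightarrow> l \<in> reps n E"
    using step_set_mem_iff[OF assms(1) l] by (simp add: reps_def)
  ultimately show ?thesis using assms(2) by (simp add: indicator_def)
qed

lemma integral_step_set:
  fixes g :: "'a \<Rightarrow> complex"
  assumes "step_set n E" "finite (reps n E)"
    and g: "\<And>x y. y \<in> coset n x \<Longrightarrow> g y = g x"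
  shows "(LINT x|mu. g x * indicator E x) = (\<Sum>k\<in>reps n E. g (rep n k) * of_real (Q powi (- n)))"
proof -
  have eq: "g x * indicator (coset n (rep n k)) x = g (rep n k) * indicator (coset n (rep n k)) x" for x k
    using g[of x "rep n k"] by (cases "x \<in> coset n (rep n k)") simp_all
  have "(LINT x|mu. g x * indicator E x)
      = (LINT x|mu. (\<Sum>k\<in>reps n E. g (rep n k) * indicator (coset n (rep n k)) x))"
    by (simp only: indicator_step_set[OF assms(1,2)] sum_distrib_left eq)
  also have "\<dots> = (\<Sum>k\<in>reps n E. (LINT x|mu. g (rep n k) * indicator (coset n (rep n k)) x))"
    by (rule Bochner_Integration.integral_sum) (auto intro: integrable_on_coset)
  also have "\<dots> = (\<Sum>k\<in>reps n E. g (rep n k) * of_real (Q powi (- n)))"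
    by (simp add: integral_indicator_coset)
  finally show ?thesis .
qed

lemma nn_integral_locally_const:
  assumes g: "\<And>x y. y \<in> coset n x \<Longrightarrow> g y = g x" and [measurable]: "g \<in> borel_measurable borel"
  shows "(\<integral>\<^sup>+x. g x \<partial>mu) = (\<Sum>k. g (rep n k) * ennreal (Q powi (- n)))"
proof -
  have "(\<integral>\<^sup>+x. g x * indicator (coset n (rep n k)) x \<partial>mu)
      = (\<integral>\<^sup>+x. g (rep n k) * indicator (coset n (rep n k)) x \<partial>mu)" for k
    by (rule nn_integral_cong) (auto simp: indicator_def g)
  then show ?thesis
    by (simp add: nn_integral_cosets[of g n] nn_integral_cmult_indicator emeasure_coset)
qed

lemma borel_locally_const:
  fixes g :: "'a \<Rightarrow> 'b::topological_space"
  assumes g: "\<And>x y. y \<in> coset n x \<Longrightarrow> g y = g x"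
  shows "g \<in> borel_measurable borel"
proof (rule borel_measurableI)
  fix S :: "'b set"
  have "step_set n (g -` S)" using g by (auto simp: step_set_def)
  then show "g -` S \<inter> space borel \<in> sets borel" using step_set_borel by simp
qed

section \<open>The Fourier transform\<close>

text \<open>
  The characters restricted to cosets serve both as test functions and, up to a factor, as their
  transforms.
\<close>

definition chi_on :: "'a \<Rightarrow> int \<Rightarrow> 'a \<Rightarrow> 'a \<Rightarrow> complex" where
  "chi_on y n a x = chi (y * x) * indicator (coset n a) x"

definition trunc :: "nat \<Rightarrow> ('a \<Rightarrow> complex) \<Rightarrow> 'a \<Rightarrow> complex" where
  "trunc N f x = indicator (coset (- int N) 0) x * f x"

abbreviation hat :: "('a \<Rightarrow> complex) \<Rightarrow> 'a \<Rightarrow> complex" where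
  "hat \<equiv> fourier_L1 chi mu"

lemma chi_on_borel [measurable]: "chi_on y n a \<in> borel_measurable borel"
  unfolding chi_on_def[abs_def] by measurable

lemma chi_on_L2: "chi_on y n a \<in> L2 mu"
proof -
  have "(\<integral>\<^sup>+x. ennreal ((cmod (chi_on y n a x))\<^sup>2) \<partial>mu) = (\<integral>\<^sup>+x. indicator (coset n a) x \<partial>mu)"
    by (rule nn_integral_cong) (auto simp: chi_on_def norm_mult chi_unit indicator_def)
  then show ?thesis by (simp add: L2_iff_nn_integral emeasure_coset measurable_mu)
qed

lemma chi_on_inner:
  "L2_inner mu (chi_on y n a) (chi_on z n a)
     = (if absv (y - z) \<le> Q powi n then chi ((y - z) * a) * of_real (Q powi (- n)) else 0)"
proof -
  have "chi_on y n a x * cnj (chi_on z n a x) = chi ((y - z) * x) * indicator (coset n a) x" for x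
    by (auto simp: chi_on_def indicator_def left_diff_distrib chi_diff)
  then show ?thesis by (simp only: L2_inner_def integral_chi_coset)
qed

lemma norm_chi_on: "(norm_L2 mu (chi_on y n a))\<^sup>2 = Q powi (- n)"
proof -
  have "complex_of_real ((norm_L2 mu (chi_on y n a))\<^sup>2) = complex_of_real (Q powi (- n))"
    using L2_inner_self[OF chi_on_L2, of y n a] chi_on_inner[of y n a y] less_imp_le[OF powi_Q_pos[of n]] by simp
  then show ?thesis by (simp only: of_real_eq_iff)
qed

lemma Bessel_coset:
  assumes "finite A" "f \<in> L2 mu"
    and "\<And>k l. k \<in> A \<Longrightarrow> l \<in> A \<Longrightarrow> absv (y k - y l) \<le> Q powi n \<Longrightarrow> k = l"
  shows "(\<Sum>k\<in>A. (cmod (L2_inner mu f (chi_on (y k) n a)))\<^sup>2) \<le> Q powi (- n) * (norm_L2 mu f)\<^sup>2"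
proof (rule Bessel)
  fix k l assume kl: "k \<in> A" "l \<in> A"
  have "0 \<le> Q powi n" by (rule less_imp_le) simp
  then show "L2_inner mu (chi_on (y k) n a) (chi_on (y l) n a) = (if k = l then of_real (Q powi (- n)) else 0)"
    using assms(3)[OF kl] by (auto simp: chi_on_inner)
qed (use assms chi_on_L2 in auto)

lemma trunc_L2:
  assumes "f \<in> L2 mu" shows "trunc N f \<in> L2 mu"
  unfolding trunc_def[abs_def]
  by (rule L2_mult_bounded[OF assms, of _ 1]) (auto simp: indicator_def)

lemma trunc_L1:
  assumes "f \<in> L2 mu" shows "trunc N f \<in> L1 mu"
proof -
  have "integrable mu (\<lambda>x. f x * cnj (chi_on 0 (- int N) 0 x))"
    by (rule L2_mult_integrable[OF assms chi_on_L2])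
  moreover have "(\<lambda>x. f x * cnj (chi_on 0 (- int N) 0 x)) = trunc N f"
    by (auto simp: chi_on_def trunc_def indicator_def)
  ultimately show ?thesis by (simp add: L1_def)
qed

lemma inner_trunc: "L2_inner mu (trunc N f) h = L2_inner mu f (trunc N h)"
  unfolding L2_inner_def by (rule Bochner_Integration.integral_cong) (auto simp: trunc_def indicator_def)

lemma hat_trunc: "hat (trunc N f) \<xi> = L2_inner mu f (chi_on \<xi> (- int N) 0)"
  unfolding fourier_L1_def L2_inner_def
  by (rule Bochner_Integration.integral_cong) (auto simp: trunc_def chi_on_def indicator_def)

lemma chi_on_eq: "absv (y - z) \<le> Q powi n \<Longrightarrow> chi_on y n 0 = chi_on z n 0"
proof
  fix x assume yz: "absv (y - z) \<le> Q powi n"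
  show "chi_on y n 0 x = chi_on z n 0 x"
  proof (cases "x \<in> coset n 0")
    case True
    have "absv (y - z) * absv x \<le> Q powi n * Q powi (- n)"
      using True yz less_imp_le[OF powi_Q_pos[of n]] by (intro mult_mono) (auto simp: mem_coset absv_nonneg)
    then have "absv (y * x - z * x) \<le> 1"
      using Q_gt_1 by (simp add: absv_mult left_diff_distrib[symmetric] power_int_minus)
    then show ?thesis using chi_eqI by (simp add: chi_on_def)
  qed (simp add: chi_on_def)
qed

lemma hat_trunc_const: "\<zeta> \<in> coset (int N) \<xi> \<Longrightarrow> hat (trunc N f) \<zeta> = hat (trunc N f) \<xi>"
  using chi_on_eq[of \<zeta> \<xi> "- int N"] by (simp add: hat_trunc mem_coset)

lemma hat_trunc_borel [measurable]: "hat (trunc N f) \<in> borel_measurable borel"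
  by (rule borel_locally_const[where n = "int N"]) (rule hat_trunc_const)

text \<open>
  The transform of a function supported in the ball of radius \<open>q^N\<close> is constant on the cosets of
  the ball of radius \<open>q^-N\<close>, where its values are the coefficients of the function with respect
  to pairwise orthogonal characters. Bessel's inequality for these is the bound of the transform.
\<close>

lemma nn_integral_hat_trunc_le:
  assumes f: "f \<in> L2 mu"
  shows "(\<integral>\<^sup>+\<xi>. ennreal ((cmod (hat (trunc N f) \<xi>))\<^sup>2) \<partial>mu) \<le> ennreal ((norm_L2 mu f)\<^sup>2)"
proof -
  let ?h = "\<lambda>\<xi>. ennreal ((cmod (hat (trunc N f) \<xi>))\<^sup>2)"
  have "(\<integral>\<^sup>+\<xi>. ?h \<xi> \<partial>mu) = (\<Sum>k. ?h (rep (int N) k) * ennreal (Q powi (- int N)))"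
    by (rule nn_integral_locally_const) (use hat_trunc_const in simp, measurable)
  also have "\<dots> \<le> ennreal ((norm_L2 mu f)\<^sup>2)"
  proof (rule suminf_le_const)
    fix K
    have "(\<Sum>k<K. (cmod (L2_inner mu f (chi_on (rep (int N) k) (- int N) 0)))\<^sup>2) \<le> Q powi (int N) * (norm_L2 mu f)\<^sup>2"
      using Bessel_coset[of "{..<K}" f "rep (int N)" "- int N" 0] f rep_diff_le_iff by simp
    then have "(\<Sum>k<K. (cmod (hat (trunc N f) (rep (int N) k)))\<^sup>2) * Q powi (- int N)
        \<le> Q powi (int N) * (norm_L2 mu f)\<^sup>2 * Q powi (- int N)"
      unfolding hat_trunc by (rule mult_right_mono) (simp add: less_imp_le)
    also have "\<dots> = (norm_L2 mu f)\<^sup>2" using Q_gt_1 by (simp add: power_int_minus)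
    finally have "(\<Sum>k<K. (cmod (hat (trunc N f) (rep (int N) k)))\<^sup>2 * Q powi (- int N)) \<le> (norm_L2 mu f)\<^sup>2"
      by (simp only: sum_distrib_right)
    then have "ennreal (\<Sum>k<K. (cmod (hat (trunc N f) (rep (int N) k)))\<^sup>2 * Q powi (- int N)) \<le> ennreal ((norm_L2 mu f)\<^sup>2)"
      by (rule ennreal_leI)
    moreover have "0 \<le> Q powi (- int N)" by (rule less_imp_le) simp
    ultimately show "(\<Sum>k<K. ?h (rep (int N) k) * ennreal (Q powi (- int N))) \<le> ennreal ((norm_L2 mu f)\<^sup>2)"
      by (simp add: sum_ennreal[symmetric] ennreal_mult)
  qed simp
  finally show ?thesis .
qed

lemma eventually_in_coset: "\<forall>\<^sub>F N in sequentially. x \<in> coset (- int N) 0"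
proof -
  obtain N0 where "absv x \<le> Q ^ N0" using ex_power_bound by blast
  then have "x \<in> coset (- int N) 0" if "N \<ge> N0" for N
  proof -
    have "Q ^ N0 \<le> Q ^ N" by (rule power_increasing[OF that]) (use Q_gt_1 in simp)
    then show ?thesis using \<open>absv x \<le> Q ^ N0\<close> by (simp add: mem_coset)
  qed
  then show ?thesis by (auto simp: eventually_sequentially)
qed

lemma trunc_tendsto: "(\<lambda>N. trunc N f x) \<longlonglongrightarrow> f x"
  by (rule tendsto_eventually, rule eventually_mono[OF eventually_in_coset[of x]]) (simp add: trunc_def)

lemma trunc_converges:
  assumes f: "f \<in> L2 mu" shows "L2_converges mu (\<lambda>N. trunc N f) f"
proof -
  have [measurable]: "f \<in> borel_measurable borel" using L2_measurable[OF f] by (simp add: measurable_mu)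
  have [measurable]: "trunc N f \<in> borel_measurable borel" for N unfolding trunc_def[abs_def] by measurable
  have "(\<lambda>n. \<integral>\<^sup>+x. ennreal ((cmod (trunc n f x - f x))\<^sup>2) \<partial>mu) \<longlonglongrightarrow> (\<integral>\<^sup>+x. 0 \<partial>mu)"
  proof (rule nn_integral_dominated_convergence[where w = "\<lambda>x. ennreal ((cmod (f x))\<^sup>2)"])
    show "(\<integral>\<^sup>+x. ennreal ((cmod (f x))\<^sup>2) \<partial>mu) < \<infinity>" using f by (simp add: L2_iff_nn_integral)
    show "AE x in mu. ennreal ((cmod (trunc n f x - f x))\<^sup>2) \<le> ennreal ((cmod (f x))\<^sup>2)" for n
      by (auto simp: trunc_def indicator_def)
    show "AE x in mu. (\<lambda>n. ennreal ((cmod (trunc n f x - f x))\<^sup>2)) \<longlonglongrightarrow> 0"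
    proof (rule AE_I2)
      fix x
      have "(\<lambda>n. ennreal ((cmod (trunc n f x - f x))\<^sup>2)) \<longlonglongrightarrow> ennreal ((cmod (f x - f x))\<^sup>2)"
        by (intro tendsto_intros trunc_tendsto)
      then show "(\<lambda>n. ennreal ((cmod (trunc n f x - f x))\<^sup>2)) \<longlonglongrightarrow> 0" by simp
    qed
  qed measurable
  then show ?thesis by (simp add: L2_converges_def)
qed

lemma hat_integrable:
  assumes "f \<in> L1 mu" shows "integrable mu (\<lambda>x. f x * cnj (chi (\<xi> * x)))"
proof (rule Bochner_Integration.integrable_bound[of _ f])
  have [measurable]: "f \<in> borel_measurable mu" using assms by (auto simp: L1_def)
  show "(\<lambda>x. f x * cnj (chi (\<xi> * x))) \<in> borel_measurable mu" by measurable
qed (use assms in \<open>auto simp: L1_def norm_mult chi_unit\<close>)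

lemma hat_trunc_tendsto:
  assumes f: "f \<in> L1 mu" shows "(\<lambda>N. hat (trunc N f) \<xi>) \<longlonglongrightarrow> hat f \<xi>"
  unfolding fourier_L1_def
proof (rule integral_dominated_convergence[where w = "\<lambda>x. cmod (f x)"])
  have [measurable]: "f \<in> borel_measurable mu" using f by (auto simp: L1_def)
  have [measurable]: "trunc N f \<in> borel_measurable mu" for N unfolding trunc_def[abs_def] by measurable
  show "(\<lambda>x. f x * cnj (chi (\<xi> * x))) \<in> borel_measurable mu" by measurable
  show "(\<lambda>x. trunc N f x * cnj (chi (\<xi> * x))) \<in> borel_measurable mu" for N by measurable
  show "integrable mu (\<lambda>x. cmod (f x))" using f by (simp add: L1_def)
  show "AE x in mu. (\<lambda>N. trunc N f x * cnj (chi (\<xi> * x))) \<longlonglongrightarrow> f x * cnj (chi (\<xi> * x))"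
    by (intro AE_I2 tendsto_intros trunc_tendsto)
  show "AE x in mu. norm (trunc N f x * cnj (chi (\<xi> * x))) \<le> cmod (f x)" for N
    by (auto simp: trunc_def indicator_def norm_mult chi_unit)
qed

lemma hat_borel:
  assumes f: "f \<in> L1 mu" shows "hat f \<in> borel_measurable borel"
  by (rule borel_measurable_LIMSEQ_metric[OF _ hat_trunc_tendsto[OF f]]) measurable

text \<open>
  Fatou's lemma carries the bound from the truncations to the function.
\<close>

lemma hat_L2:
  assumes f: "f \<in> L1 mu" "f \<in> L2 mu"
  shows "hat f \<in> L2 mu" "norm_L2 mu (hat f) \<le> norm_L2 mu f"
proof -
  note [measurable] = hat_borel[OF f(1)]
  have "(\<integral>\<^sup>+\<xi>. ennreal ((cmod (hat f \<xi>))\<^sup>2) \<partial>mu)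
      = (\<integral>\<^sup>+\<xi>. liminf (\<lambda>N. ennreal ((cmod (hat (trunc N f) \<xi>))\<^sup>2)) \<partial>mu)"
  proof (rule nn_integral_cong)
    fix \<xi>
    have "(\<lambda>N. ennreal ((cmod (hat (trunc N f) \<xi>))\<^sup>2)) \<longlonglongrightarrow> ennreal ((cmod (hat f \<xi>))\<^sup>2)"
      by (intro tendsto_intros hat_trunc_tendsto f)
    then show "ennreal ((cmod (hat f \<xi>))\<^sup>2) = liminf (\<lambda>N. ennreal ((cmod (hat (trunc N f) \<xi>))\<^sup>2))"
      using lim_imp_Liminf[OF trivial_limit_sequentially] by metis
  qed
  also have "\<dots> \<le> liminf (\<lambda>N. \<integral>\<^sup>+\<xi>. ennreal ((cmod (hat (trunc N f) \<xi>))\<^sup>2) \<partial>mu)"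
    by (rule nn_integral_liminf) measurable
  also have "\<dots> \<le> ennreal ((norm_L2 mu f)\<^sup>2)"
    by (rule Liminf_le) (intro trivial_limit_sequentially always_eventually allI nn_integral_hat_trunc_le f)+
  finally have le: "(\<integral>\<^sup>+\<xi>. ennreal ((cmod (hat f \<xi>))\<^sup>2) \<partial>mu) \<le> ennreal ((norm_L2 mu f)\<^sup>2)" .
  then show L2: "hat f \<in> L2 mu"
    using hat_borel[OF f(1)] by (auto simp: L2_iff_nn_integral measurable_mu less_top[symmetric] top_unique)
  from le have "(norm_L2 mu (hat f))\<^sup>2 \<le> (norm_L2 mu f)\<^sup>2"
    unfolding nn_integral_L2[OF L2] by (simp only: ennreal_le_iff zero_le_power2)
  then show "norm_L2 mu (hat f) \<le> norm_L2 mu f" by (rule power2_le_imp_le) simp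
qed

lemma L1_diff: "f \<in> L1 mu \<Longrightarrow> g \<in> L1 mu \<Longrightarrow> (\<lambda>x. f x - g x) \<in> L1 mu"
  by (simp add: L1_def)

lemma hat_diff: "f \<in> L1 mu \<Longrightarrow> g \<in> L1 mu \<Longrightarrow> hat (\<lambda>x. f x - g x) \<xi> = hat f \<xi> - hat g \<xi>"
  using hat_integrable by (simp add: fourier_L1_def left_diff_distrib)

lemma norm_hat_diff_le:
  assumes "f \<in> L1 mu" "f \<in> L2 mu" "g \<in> L1 mu" "g \<in> L2 mu"
  shows "norm_L2 mu (\<lambda>\<xi>. hat f \<xi> - hat g \<xi>) \<le> norm_L2 mu (\<lambda>x. f x - g x)"
proof -
  have "hat (\<lambda>x. f x - g x) = (\<lambda>\<xi>. hat f \<xi> - hat g \<xi>)" using hat_diff assms by blast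
  then show ?thesis
    using hat_L2(2)[OF L1_diff[OF assms(1,3)] L2_diff[OF assms(2,4)]] by simp
qed

text \<open>
  The transforms of the truncations form a Cauchy sequence by the norm bound, and the same bound shows
  that every other approximating sequence has the same limit.
\<close>

lemma is_fourier_L2_fourier_L2:
  assumes f: "f \<in> L2 mu" shows "is_fourier_L2 chi mu f (fourier_L2 chi mu f)"
proof -
  note c = trunc_L1[OF f] trunc_L2[OF f]
  note cc = trunc_converges[OF f, unfolded L2_converges_iff[OF trunc_L2[OF f] f]]
  have "\<exists>N. \<forall>m\<ge>N. \<forall>n\<ge>N. norm_L2 mu (\<lambda>\<xi>. hat (trunc m f) \<xi> - hat (trunc n f) \<xi>) \<le> e" if "e > 0" for e
  proof -
    have "\<forall>\<^sub>F n in sequentially. norm_L2 mu (\<lambda>x. trunc n f x - f x) < e / 2"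
      using order_tendstoD(2)[OF cc, of "e/2"] that by simp
    then obtain N where N: "\<And>n. n \<ge> N \<Longrightarrow> norm_L2 mu (\<lambda>x. trunc n f x - f x) < e / 2"
      by (auto simp: eventually_sequentially)
    have "norm_L2 mu (\<lambda>\<xi>. hat (trunc m f) \<xi> - hat (trunc n f) \<xi>) \<le> e" if "m \<ge> N" "n \<ge> N" for m n
    proof -
      have "norm_L2 mu (\<lambda>\<xi>. hat (trunc m f) \<xi> - hat (trunc n f) \<xi>) \<le> norm_L2 mu (\<lambda>x. trunc m f x - trunc n f x)"
        by (rule norm_hat_diff_le[OF c c])
      also have "\<dots> \<le> norm_L2 mu (\<lambda>x. trunc m f x - f x) + norm_L2 mu (\<lambda>x. f x - trunc n f x)"
        by (rule norm_L2_triangle_diff[OF c(2) f c(2)])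
      also have "\<dots> \<le> e"
        using N[OF that(1)] N[OF that(2)] norm_L2_minus_commute[of mu f "trunc n f"] by simp
      finally show ?thesis .
    qed
    then show ?thesis by blast
  qed
  then obtain g where g: "g \<in> L2 mu" "L2_converges mu (\<lambda>n. hat (trunc n f)) g"
    using L2_complete[of "\<lambda>n. hat (trunc n f)" mu] hat_L2(1)[OF c] by blast
  have "L2_converges mu (\<lambda>n. hat (F n)) g"
    if F: "\<And>n. F n \<in> L1 mu \<inter> L2 mu" and conv: "L2_converges mu F f" for F
  proof -
    have F1: "F n \<in> L1 mu" and F2: "F n \<in> L2 mu" for n using F by auto
    have "(\<lambda>n. norm_L2 mu (\<lambda>\<xi>. hat (F n) \<xi> - g \<xi>)) \<longlonglongrightarrow> 0"
    proof (rule Lim_null_comparison)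
      show "(\<lambda>n. norm_L2 mu (\<lambda>x. F n x - f x) + norm_L2 mu (\<lambda>x. trunc n f x - f x)
          + norm_L2 mu (\<lambda>\<xi>. hat (trunc n f) \<xi> - g \<xi>)) \<longlonglongrightarrow> 0"
        by (intro tendsto_add_zero cc conv[unfolded L2_converges_iff[OF F2 f]]
            g(2)[unfolded L2_converges_iff[OF hat_L2(1)[OF c] g(1)]])
      have "norm_L2 mu (\<lambda>\<xi>. hat (F n) \<xi> - g \<xi>)
          \<le> norm_L2 mu (\<lambda>x. F n x - f x) + norm_L2 mu (\<lambda>x. trunc n f x - f x)
            + norm_L2 mu (\<lambda>\<xi>. hat (trunc n f) \<xi> - g \<xi>)" for n
        using norm_L2_triangle_diff[OF hat_L2(1)[OF F1 F2] hat_L2(1)[OF c] g(1), of n n]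
          norm_hat_diff_le[OF F1 F2 c, of n n] norm_L2_triangle_diff[OF F2 f c(2), of n n]
          norm_L2_minus_commute[of mu f "trunc n f"] by simp
      then show "\<forall>\<^sub>F n in sequentially. norm (norm_L2 mu (\<lambda>\<xi>. hat (F n) \<xi> - g \<xi>))
          \<le> norm_L2 mu (\<lambda>x. F n x - f x) + norm_L2 mu (\<lambda>x. trunc n f x - f x)
            + norm_L2 mu (\<lambda>\<xi>. hat (trunc n f) \<xi> - g \<xi>)" by simp
    qed
    then show ?thesis by (simp add: L2_converges_iff[OF hat_L2(1)[OF F1 F2] g(1)])
  qed
  then have "is_fourier_L2 chi mu f g" using g(1) by (simp add: is_fourier_L2_def)
  then show ?thesis unfolding fourier_L2_def by (rule someI[of "is_fourier_L2 chi mu f"])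
qed

abbreviation ft :: "('a \<Rightarrow> complex) \<Rightarrow> 'a \<Rightarrow> complex" where
  "ft \<equiv> fourier_L2 chi mu"

lemma ft_L2: "f \<in> L2 mu \<Longrightarrow> ft f \<in> L2 mu"
  using is_fourier_L2_fourier_L2 by (simp add: is_fourier_L2_def)

lemma hat_trunc_converges: "f \<in> L2 mu \<Longrightarrow> L2_converges mu (\<lambda>N. hat (trunc N f)) (ft f)"
  using is_fourier_L2_fourier_L2[of f] trunc_L1 trunc_L2 trunc_converges by (simp add: is_fourier_L2_def)

section \<open>The Calderon sum of a Parseval frame wavelet\<close>

text \<open>
  The transform of a truncation is constant on the cosets of a small ideal, so its integral over a
  larger coset is a finite sum. This sum can be exchanged with the integral that defines the
  transform, and what remains inside is the integral of a character over the coset.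
\<close>

lemma hat_trunc_chi_on:
  assumes f: "f \<in> L2 mu"
  shows "L2_inner mu (hat (trunc N f)) (chi_on y n a)
    = of_real (Q powi (- n)) * cnj (chi (a * y)) * L2_inner mu (trunc N f) (chi_on a (- n) (- y))"
proof -
  obtain M0 where M0: "absv y \<le> Q ^ M0" using ex_power_bound by blast
  \<comment> \<open>Cosets of level \<open>M\<close> are so small that the transform of the truncation and the character of \<open>y\<close> are
    both constant on them, and that \<open>coset n a\<close> is a union of them.\<close>
  define M where "M = max (int N) (max n (int M0))"
  have M: "int N \<le> M" "n \<le> M" "absv y \<le> Q powi M"
  proof -
    have "Q powi (int M0) \<le> Q powi M" unfolding powi_Q_le_iff M_def by simp
    then show "absv y \<le> Q powi M" using M0 by simp
  qed (auto simp: M_def)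
  obtain m where m: "coset n a \<subseteq> coset m 0"
  proof -
    obtain N' where "absv a \<le> Q ^ N'" using ex_power_bound by blast
    then have "a \<in> coset (- int N') 0" by (simp add: mem_coset)
    then have "a \<in> coset (min n (- int N')) 0" using coset_mono[of "min n (- int N')" "- int N'"] by auto
    then show thesis using that coset_subset[of "min n (- int N')" n a 0] by simp
  qed
  have E: "step_set M (coset n a)" "finite (reps M (coset n a))"
    using step_set_coset[OF M(2)] finite_reps[OF m] by auto
  let ?R = "reps M (coset n a)"
  have per: "chi (t * y') = chi (t * x')" if "absv t \<le> Q powi M" "y' \<in> coset M x'" for t x' y'
  proof (rule chi_eqI)
    have "absv t * absv (y' - x') \<le> Q powi M * Q powi (- M)"
      using that less_imp_le[OF powi_Q_pos[of M]] by (intro mult_mono) (auto simp: mem_coset absv_nonneg)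
    then show "absv (t * y' - t * x') \<le> 1"
      using Q_gt_1 by (simp add: absv_mult right_diff_distrib[symmetric] power_int_minus)
  qed
  have "L2_inner mu (hat (trunc N f)) (chi_on y n a)
      = (LINT \<xi>|mu. (hat (trunc N f) \<xi> * cnj (chi (y * \<xi>))) * indicator (coset n a) \<xi>)"
    unfolding L2_inner_def by (rule Bochner_Integration.integral_cong) (auto simp: chi_on_def indicator_def)
  also have "\<dots> = (\<Sum>k\<in>?R. (hat (trunc N f) (rep M k) * cnj (chi (y * rep M k))) * of_real (Q powi (- M)))"
  proof (rule integral_step_set[OF E])
    fix x' y' assume *: "y' \<in> coset M x'"
    then have "y' \<in> coset (int N) x'" using coset_mono[OF M(1)] by blast
    then show "hat (trunc N f) y' * cnj (chi (y * y')) = hat (trunc N f) x' * cnj (chi (y * x'))"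
      using per[OF M(3) *] hat_trunc_const by metis
  qed
  also have "\<dots> = L2_inner mu f (\<lambda>x. \<Sum>k\<in>?R. (of_real (Q powi (- M)) * chi (y * rep M k)) * chi_on (rep M k) (- int N) 0 x)"
    using f by (subst L2_inner_sum_right) (auto simp: chi_on_L2 hat_trunc intro!: sum.cong)
  also have "(\<lambda>x. \<Sum>k\<in>?R. (of_real (Q powi (- M)) * chi (y * rep M k)) * chi_on (rep M k) (- int N) 0 x)
      = trunc N (\<lambda>x. of_real (Q powi (- n)) * chi (a * y) * chi_on a (- n) (- y) x)"
  proof
    fix x
    show "(\<Sum>k\<in>?R. (of_real (Q powi (- M)) * chi (y * rep M k)) * chi_on (rep M k) (- int N) 0 x)
      = trunc N (\<lambda>x. of_real (Q powi (- n)) * chi (a * y) * chi_on a (- n) (- y) x) x"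
    proof (cases "x \<in> coset (- int N) 0")
      case True
      have "absv x \<le> Q powi M"
        using True powi_Q_le_iff[of "int N" M] M(1) by (simp add: mem_coset)
      then have xy: "absv (x + y) \<le> Q powi M" using M(3) by (rule absv_add_le)
      have "(\<Sum>k\<in>?R. (of_real (Q powi (- M)) * chi (y * rep M k)) * chi_on (rep M k) (- int N) 0 x)
          = (\<Sum>k\<in>?R. chi ((x + y) * rep M k) * of_real (Q powi (- M)))"
        using True by (intro sum.cong) (auto simp: chi_on_def distrib_right chi_add mult.commute)
      also have "\<dots> = (LINT \<xi>|mu. chi ((x + y) * \<xi>) * indicator (coset n a) \<xi>)"
        by (rule integral_step_set[OF E, symmetric]) (rule per[OF xy])
      also have "\<dots> = trunc N (\<lambda>x. of_real (Q powi (- n)) * chi (a * y) * chi_on a (- n) (- y) x) x"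
        using True unfolding integral_chi_coset
        by (auto simp: trunc_def chi_on_def mem_coset distrib_left chi_add mult.commute indicator_def)
      finally show ?thesis .
    qed (simp add: chi_on_def trunc_def)
  qed
  also have "L2_inner mu f (trunc N (\<lambda>x. of_real (Q powi (- n)) * chi (a * y) * chi_on a (- n) (- y) x))
      = of_real (Q powi (- n)) * cnj (chi (a * y)) * L2_inner mu (trunc N f) (chi_on a (- n) (- y))"
    unfolding inner_trunc[symmetric] L2_inner_def
    by (subst Bochner_Integration.integral_mult_right_zero[symmetric])
       (rule Bochner_Integration.integral_cong, auto simp: trunc_def indicator_def)
  finally show ?thesis .
qed

text \<open>
  Parseval's identity against a character restricted to a coset: the function
  \<open>chi_on y n a\<close> is the transform of a multiple of \<open>chi_on a (- n) (- y)\<close>.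
\<close>

lemma ft_chi_on:
  assumes f: "f \<in> L2 mu"
  shows "L2_inner mu (ft f) (chi_on y n a)
    = of_real (Q powi (- n)) * cnj (chi (a * y)) * L2_inner mu f (chi_on a (- n) (- y))"
proof (rule LIMSEQ_unique)
  show "(\<lambda>N. L2_inner mu (hat (trunc N f)) (chi_on y n a)) \<longlonglongrightarrow> L2_inner mu (ft f) (chi_on y n a)"
    by (intro L2_converges_inner hat_L2 trunc_L1 trunc_L2 ft_L2 chi_on_L2 hat_trunc_converges f)
  show "(\<lambda>N. L2_inner mu (hat (trunc N f)) (chi_on y n a))
      \<longlonglongrightarrow> of_real (Q powi (- n)) * cnj (chi (a * y)) * L2_inner mu f (chi_on a (- n) (- y))"
    unfolding hat_trunc_chi_on[OF f]
    by (intro tendsto_mult_left L2_converges_inner trunc_L2 chi_on_L2 trunc_converges f)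
qed

text \<open>
  The substitution \<open>x = pp^j (u k + x')\<close> moves dilation and translation from \<open>\<eta>\<close> to the test function,
  which stays a character on a coset, and \<open>ft_chi_on\<close> then expresses the coefficient by the transform.
\<close>

lemma cmod_inner_dil_trans:
  assumes f: "\<eta> \<in> L2 mu"
  shows "(cmod (L2_inner mu (chi_on \<xi> (- N) 0) (dil pp c j (trans_u pp c eps k \<eta>))))\<^sup>2
    = Q powi (2 * N + j) * (cmod (L2_inner mu (ft \<eta>) (chi_on (uu k) (N + j) (pp powi j * \<xi>))))\<^sup>2"
proof -
  have [measurable]: "\<eta> \<in> borel_measurable borel" using L2_measurable[OF f] by (simp add: measurable_mu)
  define s where "s = Q powr (of_int j / 2)"
  have s2: "s * s = Q powi j"
    using Q_gt_1 by (simp add: s_def powr_add[symmetric] powr_real_of_int')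
  let ?a = "pp powi j * \<xi>"
  let ?F = "\<lambda>x. chi_on \<xi> (- N) 0 x * cnj (of_real s * \<eta> (pp powi (- j) * x - uu k))"
  have meas [measurable]: "?F \<in> borel_measurable borel" by measurable
  have pt: "?F (pp powi j * (uu k + x)) = of_real s * chi (?a * uu k) * cnj (\<eta> x * cnj (chi_on ?a (- (N + j)) (- uu k) x))" for x
  proof -
    have "pp powi (- j) * (pp powi j * (uu k + x)) - uu k = x"
      by (simp add: mult.assoc[symmetric] power_int_minus)
    moreover have "chi_on \<xi> (- N) 0 (pp powi j * (uu k + x)) = chi (?a * uu k) * chi_on ?a (- (N + j)) (- uu k) x"
    proof -
      have "pp powi j * (uu k + x) \<in> coset (- N) 0 \<longleftrightarrow> x \<in> coset (- (N + j)) (- uu k)"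
        using scaled_absv_le_iff[of j "uu k + x" N] by (simp add: mem_coset add.commute)
      then show ?thesis
        by (auto simp: chi_on_def indicator_def chi_add[symmetric] algebra_simps)
    qed
    ultimately show ?thesis by simp
  qed
  have "L2_inner mu (chi_on \<xi> (- N) 0) (dil pp c j (trans_u pp c eps k \<eta>)) = (LINT x|mu. ?F x)"
    by (simp add: L2_inner_def dil_def trans_u_def s_def q_eq)
  also have "\<dots> = of_real (Q powi (- j)) * (LINT x|mu. ?F (pp powi j * x))"
    using integral_scale[OF meas, of j] Q_gt_1 by (simp add: power_int_minus)
  also have "(LINT x|mu. ?F (pp powi j * x)) = (LINT x|mu. ?F (pp powi j * (uu k + x)))"
    by (rule integral_translate[symmetric]) measurable
  also have "\<dots> = of_real s * chi (?a * uu k) * cnj (L2_inner mu \<eta> (chi_on ?a (- (N + j)) (- uu k)))"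
    unfolding pt by (simp only: L2_inner_def integral_mult_right_zero Bochner_Integration.integral_cnj)
  finally have "cmod (L2_inner mu (chi_on \<xi> (- N) 0) (dil pp c j (trans_u pp c eps k \<eta>)))
      = Q powi (- j) * s * cmod (L2_inner mu \<eta> (chi_on ?a (- (N + j)) (- uu k)))"
    by (simp add: norm_mult chi_unit norm_power_int s_def del: of_int_minus)
  moreover have "cmod (L2_inner mu (ft \<eta>) (chi_on (uu k) (N + j) ?a))
      = Q powi (- (N + j)) * cmod (L2_inner mu \<eta> (chi_on ?a (- (N + j)) (- uu k)))"
    unfolding ft_chi_on[OF f] by (simp add: norm_mult chi_unit norm_power_int)
  moreover have "(Q powi (- j) * s)\<^sup>2 = Q powi (2 * N + j) * (Q powi (- (N + j)))\<^sup>2"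
  proof -
    have "(Q powi (- j) * s)\<^sup>2 = Q powi (- j) * Q powi (- j) * (s * s)" by (simp add: power2_eq_square)
    also have "\<dots> = Q powi (- j)" unfolding s2 using Q_gt_1 by (simp add: power_int_add[symmetric])
    also have "\<dots> = Q powi (2 * N + j) * (Q powi (- (N + j)))\<^sup>2"
      using Q_gt_1 by (simp add: power2_eq_square power_int_add[symmetric])
    finally show ?thesis .
  qed
  ultimately show ?thesis by (simp add: power_mult_distrib)
qed

definition energy :: "('a \<Rightarrow> complex) \<Rightarrow> 'a set \<Rightarrow> ennreal" where
  "energy g E = (\<integral>\<^sup>+x. ennreal ((cmod (g x))\<^sup>2) * indicator E x \<partial>mu)"

text \<open>
  The characters of the \<open>u k\<close> are orthogonal on every coset of radius at least \<open>1\<close>, their squared norm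
  being its measure. A smaller coset lies in one of radius \<open>1\<close>, to which the function is extended by
  zero; hence the minimum.
\<close>

lemma Bessel_energy:
  assumes g: "g \<in> L2 mu" and A: "finite A"
  shows "ennreal (\<Sum>k\<in>A. (cmod (L2_inner mu g (chi_on (uu k) n a)))\<^sup>2)
    \<le> ennreal (Q powi (- min n 0)) * energy g (coset n a)"
proof -
  let ?g = "\<lambda>x. indicator (coset n a) x * g x"
  have g': "?g \<in> L2 mu" by (rule L2_mult_bounded[OF g, of _ 1]) (auto simp: indicator_def)
  have "L2_inner mu g (chi_on y n a) = L2_inner mu ?g (chi_on y (min n 0) a)" for y
    unfolding L2_inner_def
    by (rule Bochner_Integration.integral_cong)
       (use coset_mono[of "min n 0" n a] in \<open>auto simp: chi_on_def indicator_def\<close>)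
  then have "(\<Sum>k\<in>A. (cmod (L2_inner mu g (chi_on (uu k) n a)))\<^sup>2)
      \<le> Q powi (- min n 0) * (norm_L2 mu ?g)\<^sup>2"
  proof (simp only:, intro Bessel_coset[OF A g'])
    fix k l assume "absv (uu k - uu l) \<le> Q powi min n 0"
    moreover have "Q powi min n 0 \<le> Q powi 0" unfolding powi_Q_le_iff by simp
    ultimately show "k = l" using u_inj[of k l] by simp
  qed
  then have "ennreal (\<Sum>k\<in>A. (cmod (L2_inner mu g (chi_on (uu k) n a)))\<^sup>2)
      \<le> ennreal (Q powi (- min n 0) * (norm_L2 mu ?g)\<^sup>2)" by (rule ennreal_leI)
  also have "\<dots> = ennreal (Q powi (- min n 0)) * ennreal ((norm_L2 mu ?g)\<^sup>2)"
    by (rule ennreal_mult) (simp_all add: less_imp_le)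
  also have "ennreal ((norm_L2 mu ?g)\<^sup>2) = energy g (coset n a)"
    unfolding nn_integral_L2[OF g', symmetric] energy_def
    by (rule nn_integral_cong) (auto simp: indicator_def)
  finally show ?thesis .
qed

definition sphere :: "int \<Rightarrow> 'a set" where
  "sphere j = {x. absv x = Q powi (- j)}"

lemma absv_eq_if_close:
  assumes "absv (y - x) < absv x" shows "absv y = absv x"
  using absv_ultrametric[of "y - x" x] absv_ultrametric[of "x - y" y] absv_diff_commute[of x y] assms
  by (auto simp: max_def split: if_splits)

lemma step_set_sphere: "n > j \<Longrightarrow> step_set n (sphere j)"
proof -
  assume "n > j"
  then have "Q powi (- n) < Q powi (- j)" using powi_Q_le_iff[of "-j" "-n"] by linarith
  then have "absv y = Q powi (- j)"
    if "absv x = Q powi (- j)" "absv (y - x) \<le> Q powi (- n)" for x y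
    using absv_eq_if_close[of y x] that by linarith
  then show ?thesis unfolding step_set_def sphere_def mem_coset[abs_def] coset_def by blast
qed

lemma finite_reps_sphere: "finite (reps n (sphere j))"
  by (rule finite_reps[where m = j]) (auto simp: sphere_def mem_coset)

lemma disjoint_sphere: "disjoint_family sphere"
proof -
  have "j = l" if "Q powi (- j) = Q powi (- l)" for j l
    using that powi_Q_le_iff[of "-j" "-l"] powi_Q_le_iff[of "-l" "-j"] by simp
  then show ?thesis by (fastforce simp: disjoint_family_on_def sphere_def)
qed

lemma sphere_borel [measurable]: "sphere j \<in> sets borel"
  by (rule step_set_borel[of "j + 1"]) (simp add: step_set_sphere)

lemma sphere_scale: "reps (N + j) (sphere j) = reps N (sphere 0)"
  using Q_gt_1 by (auto simp: reps_def sphere_def rep_def absv_mult absv_pp_powi power_int_add)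

text \<open>
  Both sides are the measure of the unit sphere.
\<close>

lemma card_reps_sphere:
  assumes "N > 0" shows "real (card (reps N (sphere 0))) * Q powi (- N) = 1 - 1 / Q"
proof -
  have "measure mu (sphere 0) = measure mu (\<Union>k\<in>reps N (sphere 0). coset N (rep N k))"
    using step_set_eq_Union[OF step_set_sphere[OF assms]] by simp
  also have "\<dots> = (\<Sum>k\<in>reps N (sphere 0). measure mu (coset N (rep N k)))"
    by (rule measure_finite_Union)
       (auto simp: finite_reps_sphere emeasure_coset intro: disjoint_family_on_mono[OF _ disjoint_cosets])
  also have "\<dots> = real (card (reps N (sphere 0))) * Q powi (- N)"
    by (simp add: measure_coset)
  finally have 1: "measure mu (sphere 0) = real (card (reps N (sphere 0))) * Q powi (- N)" .
  have "sphere 0 = coset 0 0 - coset 1 0"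
  proof (rule set_eqI)
    fix x
    have "Q powi (- 1) = 1 / Q" by (simp add: power_int_minus divide_inverse)
    then have "x \<in> coset 1 0 \<longleftrightarrow> absv x < 1" by (simp only: mem_coset diff_zero absv_less_1_iff)
    then show "x \<in> sphere 0 \<longleftrightarrow> x \<in> coset 0 0 - coset 1 0"
      by (auto simp: sphere_def mem_coset)
  qed
  then have "measure mu (sphere 0) = measure mu (coset 0 0) - measure mu (coset 1 0)"
    by (simp only:) (rule measure_Diff, auto simp: emeasure_coset coset_mono)
  then show ?thesis using 1 by (simp add: measure_coset power_int_minus field_simps)
qed

lemma energy_sphere:
  assumes [measurable]: "g \<in> borel_measurable borel" and n: "n > j"
  shows "(\<Sum>k\<in>reps n (sphere j). energy g (coset n (rep n k))) = energy g (sphere j)"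
proof -
  have "energy g (sphere j) = (\<integral>\<^sup>+x. (\<Sum>k\<in>reps n (sphere j). ennreal ((cmod (g x))\<^sup>2) * indicator (coset n (rep n k)) x) \<partial>mu)"
    unfolding energy_def indicator_step_set[OF step_set_sphere[OF n] finite_reps_sphere]
    by (simp only: sum_distrib_left)
  also have "\<dots> = (\<Sum>k\<in>reps n (sphere j). energy g (coset n (rep n k)))"
    unfolding energy_def by (rule nn_integral_sum) measurable
  finally show ?thesis by simp
qed

text \<open>
  The test functions have transforms equal to multiples of the indicators of the cosets \<open>B\<close> of
  radius \<open>q^-N\<close> in the unit sphere. At the scale \<open>j\<close> only the values of the transform of \<open>\<eta>\<close> on
  \<open>pp^j B\<close> matter. If this coset has radius at most \<open>1\<close> then Bessel's inequality costs nothing and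
  the sphere of radius \<open>q^-j\<close> contributes its energy divided by \<open>|\<xi>|\<close>; for the remaining scales it
  costs the measure of \<open>pp^j B\<close>, which leaves the factor \<open>q^-N\<close>.
\<close>

lemma Calderon_lower_bound_approx:
  assumes \<eta>: "parseval_frame_wavelet pp c eps mu \<eta>" and N: "N > 0"
  shows "ennreal (1 - 1 / Q) \<le> (\<integral>\<^sup>+\<xi>. ennreal (1 / absv \<xi> + Q powi (- N)) * ennreal ((cmod (ft \<eta> \<xi>))\<^sup>2) \<partial>mu)"
    (is "_ \<le> ?X")
proof -
  have \<eta>2: "\<eta> \<in> L2 mu" using \<eta> by (simp add: parseval_frame_wavelet_def)
  let ?g = "ft \<eta>"
  have g: "?g \<in> L2 mu" by (rule ft_L2[OF \<eta>2])
  have [measurable]: "?g \<in> borel_measurable borel" using L2_measurable[OF g] by (simp add: measurable_mu)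
  let ?L = "reps N (sphere 0)"
  define t where "t i = (\<lambda>(j, k). (cmod (L2_inner mu (chi_on (rep N i) (- N) 0)
      (dil pp c j (trans_u pp c eps k \<eta>))))\<^sup>2)" for i
  have hs: "(t i has_sum Q powi N) UNIV" for i
  proof -
    have "(t i has_sum (norm_L2 mu (chi_on (rep N i) (- N) 0))\<^sup>2) UNIV"
      using \<eta> chi_on_L2 unfolding parseval_frame_wavelet_def t_def by blast
    then show ?thesis by (simp add: norm_chi_on)
  qed
  have hsum: "((\<lambda>p. \<Sum>i\<in>?L. t i p) has_sum (\<Sum>i\<in>?L. Q powi N)) UNIV"
  proof -
    have "((\<lambda>p. \<Sum>i\<in>L. t i p) has_sum (\<Sum>i\<in>L. Q powi N)) UNIV" if "finite L" for L
      using that by (induction L) (auto intro: has_sum_add hs simp del: sum_constant)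
    then show ?thesis using finite_reps_sphere by blast
  qed
  have block: "(\<Sum>i\<in>?L. ennreal (\<Sum>k\<in>K. t i (j, k))) \<le>
      ennreal (Q powi (2 * N)) * (\<integral>\<^sup>+\<xi>. ennreal (1 / absv \<xi> + Q powi (- N)) * ennreal ((cmod (?g \<xi>))\<^sup>2) * indicator (sphere j) \<xi> \<partial>mu)"
    if K: "finite K" for j K
  proof -
    let ?c = "Q powi j * Q powi (- min (N + j) 0)"
    have nonneg: "0 \<le> Q powi k" for k by (rule less_imp_le) simp
    have "ennreal (\<Sum>k\<in>K. t i (j, k))
        \<le> ennreal (Q powi (2 * N) * ?c) * energy ?g (coset (N + j) (rep (N + j) i))" for i
    proof -
      have "(\<Sum>k\<in>K. t i (j, k)) = Q powi (2 * N + j) *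
          (\<Sum>k\<in>K. (cmod (L2_inner mu ?g (chi_on (uu k) (N + j) (rep (N + j) i))))\<^sup>2)"
        by (simp add: t_def cmod_inner_dil_trans[OF \<eta>2] rep_scale sum_distrib_left add.commute[of j N])
      then have "ennreal (\<Sum>k\<in>K. t i (j, k)) = ennreal (Q powi (2 * N + j)) *
          ennreal (\<Sum>k\<in>K. (cmod (L2_inner mu ?g (chi_on (uu k) (N + j) (rep (N + j) i))))\<^sup>2)"
        by (simp only:) (rule ennreal_mult; simp add: nonneg sum_nonneg)
      also have "\<dots> \<le> ennreal (Q powi (2 * N + j)) *
          (ennreal (Q powi (- min (N + j) 0)) * energy ?g (coset (N + j) (rep (N + j) i)))"
        by (intro mult_left_mono Bessel_energy g K) simp
      also have "\<dots> = ennreal (Q powi (2 * N) * ?c) * energy ?g (coset (N + j) (rep (N + j) i))"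
        using Q_gt_1 by (simp add: mult.assoc[symmetric] ennreal_mult[symmetric] nonneg power_int_add del: of_nat_less_iff)
      finally show ?thesis .
    qed
    then have "(\<Sum>i\<in>?L. ennreal (\<Sum>k\<in>K. t i (j, k)))
        \<le> (\<Sum>i\<in>?L. ennreal (Q powi (2 * N) * ?c) * energy ?g (coset (N + j) (rep (N + j) i)))"
      by (rule sum_mono)
    also have "\<dots> = ennreal (Q powi (2 * N) * ?c) * energy ?g (sphere j)"
      using energy_sphere[of ?g j "N + j"] N by (simp add: sum_distrib_left[symmetric] sphere_scale)
    also have "\<dots> = ennreal (Q powi (2 * N)) * (ennreal ?c * energy ?g (sphere j))"
      by (simp add: ennreal_mult nonneg mult.assoc)
    also have "\<dots> \<le> ennreal (Q powi (2 * N)) * (\<integral>\<^sup>+\<xi>. ennreal (1 / absv \<xi> + Q powi (- N)) * ennreal ((cmod (?g \<xi>))\<^sup>2) * indicator (sphere j) \<xi> \<partial>mu)"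
    proof (rule mult_left_mono)
      have cle: "?c \<le> Q powi j + Q powi (- N)"
      proof (cases "N + j \<ge> 0")
        case True
        then show ?thesis by (simp add: nonneg min_def)
      next
        case False
        then have "?c = Q powi (- N)" using Q_gt_1 by (simp add: min_def power_int_add[symmetric])
        then show ?thesis by (simp add: nonneg)
      qed
      have "ennreal ?c * (ennreal ((cmod (?g \<xi>))\<^sup>2) * indicator (sphere j) \<xi>)
          \<le> ennreal (1 / absv \<xi> + Q powi (- N)) * ennreal ((cmod (?g \<xi>))\<^sup>2) * indicator (sphere j) \<xi>" for \<xi>
      proof (cases "\<xi> \<in> sphere j")
        case True
        then have "1 / absv \<xi> = Q powi j" by (simp add: sphere_def power_int_minus divide_inverse)
        then have "ennreal ?c \<le> ennreal (1 / absv \<xi> + Q powi (- N))" using cle by (simp only: ennreal_leI)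
        from mult_right_mono[OF this zero_le, of "ennreal ((cmod (?g \<xi>))\<^sup>2)"]
        show ?thesis by (simp only: indicator_simps(1)[OF True] mult_1_right)
      qed simp
      then show "ennreal ?c * energy ?g (sphere j)
          \<le> (\<integral>\<^sup>+\<xi>. ennreal (1 / absv \<xi> + Q powi (- N)) * ennreal ((cmod (?g \<xi>))\<^sup>2) * indicator (sphere j) \<xi> \<partial>mu)"
        unfolding energy_def by (subst nn_integral_cmult[symmetric]) (auto intro!: nn_integral_mono)
    qed simp
    finally show ?thesis .
  qed
  have fin: "ennreal (\<Sum>p\<in>F. \<Sum>i\<in>?L. t i p) \<le> ennreal (Q powi (2 * N)) * ?X" if F: "finite F" for F
  proof -
    have tn: "t i p \<ge> 0" for i p by (simp add: t_def split: prod.split)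
    let ?J = "fst ` F" and ?K = "snd ` F"
    have "(\<Sum>p\<in>F. \<Sum>i\<in>?L. t i p) \<le> (\<Sum>p\<in>?J \<times> ?K. \<Sum>i\<in>?L. t i p)"
      using F tn by (intro sum_mono2) (auto intro!: sum_nonneg simp: rev_image_eqI)
    also have "\<dots> = (\<Sum>j\<in>?J. \<Sum>i\<in>?L. \<Sum>k\<in>?K. t i (j, k))"
      by (simp add: sum.cartesian_product' sum.swap[of _ ?L ?K])
    finally have "ennreal (\<Sum>p\<in>F. \<Sum>i\<in>?L. t i p) \<le> ennreal (\<Sum>j\<in>?J. \<Sum>i\<in>?L. \<Sum>k\<in>?K. t i (j, k))"
      by (rule ennreal_leI)
    also have "\<dots> = (\<Sum>j\<in>?J. \<Sum>i\<in>?L. ennreal (\<Sum>k\<in>?K. t i (j, k)))"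
      by (simp add: sum_ennreal sum_nonneg tn)
    also have "\<dots> \<le> (\<Sum>j\<in>?J. ennreal (Q powi (2 * N)) * (\<integral>\<^sup>+\<xi>. ennreal (1 / absv \<xi> + Q powi (- N)) * ennreal ((cmod (?g \<xi>))\<^sup>2) * indicator (sphere j) \<xi> \<partial>mu))"
      using F by (intro sum_mono block) simp
    also have "\<dots> = ennreal (Q powi (2 * N)) * (\<integral>\<^sup>+\<xi>. (\<Sum>j\<in>?J. ennreal (1 / absv \<xi> + Q powi (- N)) * ennreal ((cmod (?g \<xi>))\<^sup>2) * indicator (sphere j) \<xi>) \<partial>mu)"
      by (subst nn_integral_sum) (auto simp: sum_distrib_left)
    also have "\<dots> \<le> ennreal (Q powi (2 * N)) * ?X"
    proof (intro mult_left_mono nn_integral_mono)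
      fix \<xi>
      have "(\<Sum>j\<in>?J. indicator (sphere j) \<xi> :: ennreal) \<le> 1"
        using F disjoint_family_on_mono[OF subset_UNIV disjoint_sphere, of ?J]
        by (subst indicator_UN_disjoint[symmetric]) (auto simp: indicator_def)
      then show "(\<Sum>j\<in>?J. ennreal (1 / absv \<xi> + Q powi (- N)) * ennreal ((cmod (?g \<xi>))\<^sup>2) * indicator (sphere j) \<xi>)
          \<le> ennreal (1 / absv \<xi> + Q powi (- N)) * ennreal ((cmod (?g \<xi>))\<^sup>2)"
        by (simp add: sum_distrib_left[symmetric]) (metis mult.right_neutral mult_left_mono zero_le)
    qed simp
    finally show ?thesis .
  qed
  have total: "(\<Sum>i\<in>?L. Q powi N) = Q powi (2 * N) * (1 - 1 / Q)"
  proof -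
    have "Q powi (2 * N) * (1 - 1 / Q) = Q powi (2 * N) * Q powi (- N) * real (card ?L)"
      using card_reps_sphere[OF N] by (simp add: mult_ac)
    also have "Q powi (2 * N) * Q powi (- N) = Q powi N"
      using Q_gt_1 by (simp add: power_int_add[symmetric])
    finally show ?thesis by (simp add: mult.commute)
  qed
  show ?thesis
  proof (cases "?X = \<infinity>")
    case False
    then obtain X where X: "X \<ge> 0" "?X = ennreal X" by (cases ?X) auto
    have "(\<Sum>i\<in>?L. Q powi N) \<le> Q powi (2 * N) * X"
    proof (rule has_sum_le_finite_sums[OF hsum])
      fix F :: "(int \<times> nat) set" assume "finite F"
      from fin[OF this] have "ennreal (\<Sum>p\<in>F. \<Sum>i\<in>?L. t i p) \<le> ennreal (Q powi (2 * N) * X)"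
        unfolding X(2) using X(1) by (simp add: ennreal_mult less_imp_le)
      then show "(\<Sum>p\<in>F. \<Sum>i\<in>?L. t i p) \<le> Q powi (2 * N) * X"
        using X(1) by (simp add: ennreal_le_iff less_imp_le)
    qed
    then have "1 - 1 / Q \<le> X" unfolding total by (simp only: mult_le_cancel_left_pos powi_Q_pos)
    then show ?thesis unfolding X(2) by (rule ennreal_leI)
  qed simp
qed

text \<open>
  The error term is \<open>q^-N\<close> times the squared norm of the transform.
\<close>

lemma Calderon_lower_bound:
  assumes \<eta>: "parseval_frame_wavelet pp c eps mu \<eta>"
  shows "ennreal (1 - 1 / Q) \<le> (\<integral>\<^sup>+\<xi>. ennreal (1 / absv \<xi>) * ennreal ((cmod (ft \<eta> \<xi>))\<^sup>2) \<partial>mu)"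
    (is "_ \<le> ?Y")
proof -
  have g: "ft \<eta> \<in> L2 mu" using \<eta> by (simp add: parseval_frame_wavelet_def ft_L2)
  have [measurable]: "ft \<eta> \<in> borel_measurable borel" using L2_measurable[OF g] by (simp add: measurable_mu)
  define C where "C = (norm_L2 mu (ft \<eta>))\<^sup>2"
  have le: "ennreal (1 - 1 / Q) \<le> ?Y + ennreal (Q powi (- int (Suc n)) * C)" for n
  proof -
    have nn: "0 \<le> Q powi (- int (Suc n))" by (rule less_imp_le) simp
    have "ennreal (1 - 1 / Q) \<le> (\<integral>\<^sup>+\<xi>. ennreal (1 / absv \<xi> + Q powi (- int (Suc n))) * ennreal ((cmod (ft \<eta> \<xi>))\<^sup>2) \<partial>mu)"
      by (rule Calderon_lower_bound_approx[OF \<eta>]) simp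
    also have "\<dots> = (\<integral>\<^sup>+\<xi>. ennreal (1 / absv \<xi>) * ennreal ((cmod (ft \<eta> \<xi>))\<^sup>2)
        + ennreal (Q powi (- int (Suc n))) * ennreal ((cmod (ft \<eta> \<xi>))\<^sup>2) \<partial>mu)"
      using nn by (intro nn_integral_cong) (simp only: ennreal_plus absv_nonneg zero_le_divide_1_iff distrib_right)
    also have "\<dots> = ?Y + ennreal (Q powi (- int (Suc n))) * ennreal C"
      unfolding C_def nn_integral_L2[OF g, symmetric]
      by (subst nn_integral_add, measurable, subst nn_integral_cmult[of _ mu "ennreal (Q powi (- int (Suc n)))"], measurable)
    finally show ?thesis using nn by (simp only: ennreal_mult C_def zero_le_power2)
  qed
  have "(\<lambda>n. inverse Q ^ Suc n * C) \<longlonglongrightarrow> 0 * C"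
    using Q_gt_1 by (intro tendsto_mult_right LIMSEQ_Suc LIMSEQ_power_zero) (simp add: field_simps)
  then have "(\<lambda>n. Q powi (- int (Suc n)) * C) \<longlonglongrightarrow> 0"
    by (simp only: power_int_minus power_int_of_nat power_inverse mult_zero_left)
  then have "(\<lambda>n. ?Y + ennreal (Q powi (- int (Suc n)) * C)) \<longlonglongrightarrow> ?Y + ennreal 0"
    by (intro tendsto_add tendsto_const tendsto_ennrealI)
  then have "ennreal (1 - 1 / Q) \<le> ?Y + ennreal 0"
    by (rule LIMSEQ_le_const) (use le in blast)
  then show ?thesis by simp
qed

section \<open>The periodization of an orthonormal super-wavelet\<close>

lemma nn_integral_periodization:
  assumes [measurable]: "h \<in> borel_measurable borel"
  shows "(\<integral>\<^sup>+\<xi>. (\<Sum>k. h (\<xi> + uu k)) * indicator (int_ring absv) \<xi> \<partial>mu) = (\<integral>\<^sup>+\<xi>. h \<xi> \<partial>mu)"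
proof -
  have "(\<integral>\<^sup>+\<xi>. (\<Sum>k. h (\<xi> + uu k)) * indicator (int_ring absv) \<xi> \<partial>mu)
      = (\<Sum>k. \<integral>\<^sup>+\<xi>. h (\<xi> + uu k) * indicator (coset 0 0) \<xi> \<partial>mu)"
    unfolding int_ring_eq_coset ennreal_suminf_multc[symmetric] by (rule nn_integral_suminf) measurable
  also have "\<dots> = (\<Sum>k. \<integral>\<^sup>+\<xi>. h \<xi> * indicator (coset 0 (rep 0 k)) \<xi> \<partial>mu)"
  proof (rule suminf_cong)
    fix k
    have "(\<integral>\<^sup>+\<xi>. h \<xi> * indicator (coset 0 (rep 0 k)) \<xi> \<partial>mu)
        = (\<integral>\<^sup>+\<xi>. h (uu k + \<xi>) * indicator (coset 0 (rep 0 k)) (uu k + \<xi>) \<partial>mu)"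
      by (rule nn_integral_translate[symmetric]) measurable
    also have "\<dots> = (\<integral>\<^sup>+\<xi>. h (\<xi> + uu k) * indicator (coset 0 0) \<xi> \<partial>mu)"
      by (rule nn_integral_cong) (auto simp: rep_0 mem_coset indicator_def add.commute)
    finally show "(\<integral>\<^sup>+\<xi>. h (\<xi> + uu k) * indicator (coset 0 0) \<xi> \<partial>mu)
        = (\<integral>\<^sup>+\<xi>. h \<xi> * indicator (coset 0 (rep 0 k)) \<xi> \<partial>mu)" by simp
  qed
  also have "\<dots> = (\<integral>\<^sup>+\<xi>. h \<xi> \<partial>mu)" by (rule nn_integral_cosets[symmetric]) measurable
  finally show ?thesis .
qed

lemma translate_L2:
  assumes "f \<in> L2 mu"
  shows "(\<lambda>x. f (x - a)) \<in> L2 mu" "norm_L2 mu (\<lambda>x. f (x - a)) = norm_L2 mu f"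
proof -
  have [measurable]: "f \<in> borel_measurable borel" using L2_measurable[OF assms] by (simp add: measurable_mu)
  have eq: "(\<integral>\<^sup>+x. ennreal ((cmod (f (x - a)))\<^sup>2) \<partial>mu) = (\<integral>\<^sup>+x. ennreal ((cmod (f x))\<^sup>2) \<partial>mu)"
    using nn_integral_translate[of "\<lambda>x. ennreal ((cmod (f x))\<^sup>2)" "- a"] by simp
  show L2: "(\<lambda>x. f (x - a)) \<in> L2 mu"
    using assms by (simp add: L2_iff_nn_integral eq measurable_mu)
  show "norm_L2 mu (\<lambda>x. f (x - a)) = norm_L2 mu f"
    using eq unfolding nn_integral_L2[OF L2] nn_integral_L2[OF assms] by simp
qed

lemma translate_L1:
  assumes "f \<in> L1 mu" shows "(\<lambda>x. f (x - a)) \<in> L1 mu"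
proof -
  have [measurable]: "f \<in> borel_measurable borel" using assms by (auto simp: L1_def measurable_mu)
  have "(\<integral>\<^sup>+x. ennreal (norm (f (x - a))) \<partial>mu) = (\<integral>\<^sup>+x. ennreal (norm (f x)) \<partial>mu)"
    using nn_integral_translate[of "\<lambda>x. ennreal (norm (f x))" "- a"] by simp
  then show ?thesis using assms by (simp add: L1_def integrable_iff_bounded measurable_mu)
qed

lemma hat_translate:
  assumes "f \<in> L1 mu" shows "hat (\<lambda>x. f (x - a)) \<xi> = cnj (chi (a * \<xi>)) * hat f \<xi>"
proof -
  have [measurable]: "f \<in> borel_measurable borel" using assms by (auto simp: L1_def measurable_mu)
  have "hat (\<lambda>x. f (x - a)) \<xi> = (LINT x|mu. f (a + x - a) * cnj (chi (\<xi> * (a + x))))"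
    unfolding fourier_L1_def by (rule integral_translate[symmetric]) measurable
  also have "\<dots> = (LINT x|mu. cnj (chi (a * \<xi>)) * (f x * cnj (chi (\<xi> * x))))"
    by (rule Bochner_Integration.integral_cong) (simp_all add: distrib_left chi_add mult.commute)
  also have "\<dots> = cnj (chi (a * \<xi>)) * hat f \<xi>" by (simp only: fourier_L1_def integral_mult_right_zero)
  finally show ?thesis .
qed

definition trig_poly :: "nat set \<Rightarrow> (nat \<Rightarrow> complex) \<Rightarrow> 'a \<Rightarrow> complex" where
  "trig_poly A b \<xi> = (\<Sum>l\<in>A. b l * cnj (chi (uu l * \<xi>)))"

definition translate_sum :: "nat set \<Rightarrow> (nat \<Rightarrow> complex) \<Rightarrow> ('a \<Rightarrow> complex) \<Rightarrow> 'a \<Rightarrow> complex" where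
  "translate_sum A b f x = (\<Sum>l\<in>A. b l * f (x - uu l))"

lemma trig_poly_borel [measurable]: "trig_poly A b \<in> borel_measurable borel"
  unfolding trig_poly_def[abs_def] by measurable

lemma trig_poly_bounded: "cmod (trig_poly A b \<xi>) \<le> (\<Sum>l\<in>A. cmod (b l))"
  unfolding trig_poly_def by (rule order_trans[OF norm_sum]) (simp add: norm_mult chi_unit)

lemma translate_sum_L2: "f \<in> L2 mu \<Longrightarrow> translate_sum A b f \<in> L2 mu"
  unfolding translate_sum_def[abs_def] by (intro L2_sum L2_cmult translate_L2)

lemma translate_sum_L1: "f \<in> L1 mu \<Longrightarrow> translate_sum A b f \<in> L1 mu"
  using translate_L1[of f] by (simp add: translate_sum_def[abs_def] L1_def)

lemma hat_translate_sum:
  assumes f: "f \<in> L1 mu" shows "hat (translate_sum A b f) \<xi> = trig_poly A b \<xi> * hat f \<xi>"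
proof -
  have "hat (translate_sum A b f) \<xi> = (LINT x|mu. (\<Sum>l\<in>A. b l * (f (x - uu l) * cnj (chi (\<xi> * x)))))"
    by (simp add: fourier_L1_def translate_sum_def sum_distrib_right mult.assoc)
  also have "\<dots> = (\<Sum>l\<in>A. (LINT x|mu. b l * (f (x - uu l) * cnj (chi (\<xi> * x)))))"
    by (rule Bochner_Integration.integral_sum) (intro integrable_mult_right hat_integrable translate_L1 f)
  also have "\<dots> = (\<Sum>l\<in>A. b l * hat (\<lambda>x. f (x - uu l)) \<xi>)"
    by (simp only: integral_mult_right_zero fourier_L1_def)
  finally show ?thesis by (simp add: hat_translate[OF f] trig_poly_def sum_distrib_right mult.assoc)
qed

text \<open>
  Multiplying the transform by a trigonometric polynomial amounts to combining translates of the
  function. For the truncations this is an identity of integrals, and both sides converge in the mean.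
\<close>

lemma norm_trig_poly_ft_le:
  assumes f: "f \<in> L2 mu"
  shows "(\<lambda>\<xi>. trig_poly A b \<xi> * ft f \<xi>) \<in> L2 mu"
    and "norm_L2 mu (\<lambda>\<xi>. trig_poly A b \<xi> * ft f \<xi>) \<le> norm_L2 mu (translate_sum A b f)"
proof -
  have tb: "trig_poly A b \<in> borel_measurable mu" by (simp add: measurable_mu)
  note mult = L2_mult_bounded[OF _ tb trig_poly_bounded]
  show "(\<lambda>\<xi>. trig_poly A b \<xi> * ft f \<xi>) \<in> L2 mu" by (rule mult[OF ft_L2[OF f]])
  note h = hat_L2[OF trunc_L1[OF f] trunc_L2[OF f]]
  show "norm_L2 mu (\<lambda>\<xi>. trig_poly A b \<xi> * ft f \<xi>) \<le> norm_L2 mu (translate_sum A b f)"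
  proof (rule LIMSEQ_le)
    show "(\<lambda>N. norm_L2 mu (\<lambda>\<xi>. trig_poly A b \<xi> * hat (trunc N f) \<xi>)) \<longlonglongrightarrow> norm_L2 mu (\<lambda>\<xi>. trig_poly A b \<xi> * ft f \<xi>)"
      by (intro L2_converges_norm mult h ft_L2 f
          L2_converges_mult_bounded[OF h(1) ft_L2[OF f] tb trig_poly_bounded hat_trunc_converges[OF f]])
    show "(\<lambda>N. norm_L2 mu (translate_sum A b (trunc N f))) \<longlonglongrightarrow> norm_L2 mu (translate_sum A b f)"
    proof (intro L2_converges_norm translate_sum_L2 trunc_L2 f)
      have "L2_converges mu (\<lambda>N x. trunc N f (x - a)) (\<lambda>x. f (x - a))" for a
        using trunc_converges[OF f] translate_L2(2)[OF L2_diff[OF trunc_L2[OF f] f]]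
        unfolding L2_converges_iff[OF trunc_L2[OF f] f]
          L2_converges_iff[OF translate_L2(1)[OF trunc_L2[OF f]] translate_L2(1)[OF f]] by simp
      then show "L2_converges mu (\<lambda>N. translate_sum A b (trunc N f)) (translate_sum A b f)"
        unfolding translate_sum_def[abs_def]
        by (intro L2_converges_sum L2_cmult translate_L2 trunc_L2 f
            L2_converges_mult_bounded[where g = "\<lambda>_. b l" and B = "cmod (b l)" for l]) auto
    qed
    have "norm_L2 mu (\<lambda>\<xi>. trig_poly A b \<xi> * hat (trunc N f) \<xi>) \<le> norm_L2 mu (translate_sum A b (trunc N f))" for N
    proof -
      have "hat (translate_sum A b (trunc N f)) = (\<lambda>\<xi>. trig_poly A b \<xi> * hat (trunc N f) \<xi>)"
        by (rule ext) (rule hat_translate_sum[OF trunc_L1[OF f]])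
      then show ?thesis
        using hat_L2(2)[of "translate_sum A b (trunc N f)"] translate_sum_L1[OF trunc_L1[OF f]] translate_sum_L2[OF trunc_L2[OF f]]
        by metis
    qed
    then show "\<exists>N0. \<forall>N\<ge>N0. norm_L2 mu (\<lambda>\<xi>. trig_poly A b \<xi> * hat (trunc N f) \<xi>) \<le> norm_L2 mu (translate_sum A b (trunc N f))"
      by blast
  qed
qed

text \<open>
  The sum is the integral of the character of \<open>z\<close> over the ball of radius \<open>q^n\<close>: the \<open>u l\<close> with
  \<open>l < q^n\<close> represent its cosets of radius \<open>1\<close>, on which this character is constant.
\<close>

lemma chi_sum_u:
  assumes "absv z \<le> 1"
  shows "(\<Sum>l<q ^ n. chi (uu l * z)) = (if absv z \<le> Q powi (- int n) then of_real (Q ^ n) else 0)"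
proof -
  have reps: "reps 0 (coset (- int n) 0) = {..<q ^ n}"
    using absv_u_le_iff[of _ n] by (auto simp: reps_def rep_0 mem_coset)
  have "(\<Sum>l<q ^ n. chi (uu l * z)) = (\<Sum>l\<in>reps 0 (coset (- int n) 0). chi (z * rep 0 l) * of_real (Q powi (- 0)))"
    by (simp add: reps rep_0 mult.commute)
  also have "\<dots> = (LINT x|mu. chi (z * x) * indicator (coset (- int n) 0) x)"
  proof (rule integral_step_set[symmetric])
    fix x y assume "y \<in> coset 0 x"
    then have "absv (z * y - z * x) \<le> 1"
      using assms by (simp add: mem_coset right_diff_distrib[symmetric] absv_mult mult_le_one absv_nonneg)
    then show "chi (z * y) = chi (z * x)" by (rule chi_eqI)
  qed (auto simp: step_set_coset reps)
  finally show ?thesis unfolding integral_chi_coset by simp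
qed

text \<open>
  On the ring of integers the indicator of a coset is a trigonometric polynomial in the characters
  of the \<open>u l\<close>, so the integral of the periodization over this coset is the squared norm of
  \<open>trig_poly A b * ft f\<close>, the transform of a combination of translates.
\<close>

lemma periodization_coset_le:
  assumes f: "f \<in> L2 mu" and a: "absv a \<le> 1"
  shows "(\<integral>\<^sup>+\<xi>. (\<Sum>k. ennreal ((cmod (ft f (\<xi> + uu k)))\<^sup>2)) * indicator (coset (int n) a) \<xi> \<partial>mu)
    \<le> ennreal ((norm_L2 mu (translate_sum {..<q ^ n} (\<lambda>l. of_real (Q powi (- int n)) * chi (uu l * a)) f))\<^sup>2)"
proof -
  let ?b = "\<lambda>l. of_real (Q powi (- int n)) * chi (uu l * a)"
  let ?t = "trig_poly {..<q ^ n} ?b"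
  have [measurable]: "ft f \<in> borel_measurable borel" using L2_measurable[OF ft_L2[OF f]] by (simp add: measurable_mu)
  have t_per: "?t (\<xi> + uu k) = ?t \<xi>" for \<xi> k
    by (simp add: trig_poly_def distrib_left chi_add chi_u)
  have t_ind: "?t \<xi> = indicator (coset (int n) a) \<xi>" if "absv \<xi> \<le> 1" for \<xi>
  proof -
    have "?t \<xi> = of_real (Q powi (- int n)) * cnj (\<Sum>l<q ^ n. chi (uu l * (\<xi> - a)))"
      unfolding trig_poly_def sum_distrib_left cnj_sum by (rule sum.cong) (simp_all add: right_diff_distrib chi_diff)
    also have "\<dots> = indicator (coset (int n) a) \<xi>"
      using chi_sum_u[OF absv_diff_le[OF that a]] Q_gt_1
      by (simp add: mem_coset indicator_def power_int_minus)
    finally show ?thesis .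
  qed
  have sub: "coset (int n) a \<subseteq> int_ring absv"
    unfolding int_ring_eq_coset using a by (intro coset_subset) (auto simp: mem_coset)
  have "(\<integral>\<^sup>+\<xi>. (\<Sum>k. ennreal ((cmod (ft f (\<xi> + uu k)))\<^sup>2)) * indicator (coset (int n) a) \<xi> \<partial>mu)
      = (\<integral>\<^sup>+\<xi>. (\<Sum>k. ennreal ((cmod (?t (\<xi> + uu k) * ft f (\<xi> + uu k)))\<^sup>2)) * indicator (int_ring absv) \<xi> \<partial>mu)"
  proof (rule nn_integral_cong)
    fix \<xi>
    show "(\<Sum>k. ennreal ((cmod (ft f (\<xi> + uu k)))\<^sup>2)) * indicator (coset (int n) a) \<xi>
      = (\<Sum>k. ennreal ((cmod (?t (\<xi> + uu k) * ft f (\<xi> + uu k)))\<^sup>2)) * indicator (int_ring absv) \<xi>"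
    proof (cases "\<xi> \<in> int_ring absv")
      case True
      then have "?t \<xi> = indicator (coset (int n) a) \<xi>" using t_ind by (simp add: int_ring_def)
      then show ?thesis unfolding t_per using True by (simp add: indicator_def)
    next
      case False
      then have "\<xi> \<notin> coset (int n) a" using sub by blast
      then show ?thesis using False by simp
    qed
  qed
  also have "\<dots> = (\<integral>\<^sup>+\<xi>. ennreal ((cmod (?t \<xi> * ft f \<xi>))\<^sup>2) \<partial>mu)"
    by (rule nn_integral_periodization) measurable
  also have "\<dots> = ennreal ((norm_L2 mu (\<lambda>\<xi>. ?t \<xi> * ft f \<xi>))\<^sup>2)"
    by (rule nn_integral_L2[OF norm_trig_poly_ft_le(1)[OF f]])
  also have "\<dots> \<le> ennreal ((norm_L2 mu (translate_sum {..<q ^ n} ?b f))\<^sup>2)"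
    by (intro ennreal_leI power_mono norm_trig_poly_ft_le f) simp
  finally show ?thesis .
qed

text \<open>
  Dilation with \<open>j = 0\<close> is the identity, so the translates are members of the orthonormal family.
\<close>

lemma sum_norm_translate_sum:
  assumes \<eta>: "super_wavelet pp c eps mu m \<eta>" and A: "finite A"
  shows "(\<Sum>i=1..m. (norm_L2 mu (translate_sum A b (\<eta> i)))\<^sup>2) = (\<Sum>l\<in>A. (cmod (b l))\<^sup>2)"
proof -
  have L2: "\<eta> i \<in> L2 mu" if "i \<in> {1..m}" for i
    using \<eta> that by (auto simp: super_wavelet_def parseval_frame_wavelet_def)
  have dil0: "dil pp c 0 (trans_u pp c eps k f) = (\<lambda>x. f (x - uu k))" for k f
    using char_pos by (auto simp: dil_def trans_u_def)
  have "dsum_inner mu m (\<lambda>i. dil pp c 0 (trans_u pp c eps k (\<eta> i))) (\<lambda>i. dil pp c 0 (trans_u pp c eps l (\<eta> i)))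
      = (if k = l then 1 else 0)" for k l
    using \<eta> unfolding super_wavelet_def dsum_orthonormal_basis_def
    by (elim conjE allE[of _ "(0 :: int, k)"] allE[of _ "(0 :: int, l)"]) auto
  then have orth: "(\<Sum>i=1..m. L2_inner mu (\<lambda>x. \<eta> i (x - uu k)) (\<lambda>x. \<eta> i (x - uu l))) = (if k = l then 1 else 0)" for k l
    unfolding dsum_inner_def dil0 by simp
  have "complex_of_real (\<Sum>i=1..m. (norm_L2 mu (translate_sum A b (\<eta> i)))\<^sup>2)
      = (\<Sum>i=1..m. L2_inner mu (translate_sum A b (\<eta> i)) (translate_sum A b (\<eta> i)))"
    using L2_inner_self[OF translate_sum_L2[OF L2]] by simp
  also have "\<dots> = (\<Sum>i=1..m. \<Sum>k\<in>A. \<Sum>l\<in>A. b k * cnj (b l) * L2_inner mu (\<lambda>x. \<eta> i (x - uu k)) (\<lambda>x. \<eta> i (x - uu l)))"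
  proof (rule sum.cong)
    fix i assume i: "i \<in> {1..m}"
    note t = translate_L2(1)[OF L2[OF i]]
    show "L2_inner mu (translate_sum A b (\<eta> i)) (translate_sum A b (\<eta> i))
      = (\<Sum>k\<in>A. \<Sum>l\<in>A. b k * cnj (b l) * L2_inner mu (\<lambda>x. \<eta> i (x - uu k)) (\<lambda>x. \<eta> i (x - uu l)))"
      using translate_sum_L2[OF L2[OF i], of A b] unfolding translate_sum_def[abs_def]
      by (simp add: L2_inner_sum_left[OF t] L2_inner_sum_right[OF t t] sum_distrib_left mult.assoc)
  qed simp
  also have "\<dots> = (\<Sum>k\<in>A. \<Sum>l\<in>A. b k * cnj (b l) * (\<Sum>i=1..m. L2_inner mu (\<lambda>x. \<eta> i (x - uu k)) (\<lambda>x. \<eta> i (x - uu l))))"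
    by (subst sum.swap, rule sum.cong[OF refl], subst sum.swap) (simp add: sum_distrib_left)
  also have "\<dots> = (\<Sum>k\<in>A. b k * cnj (b k))"
    unfolding orth using A by (simp add: if_distrib cong: if_cong)
  also have "\<dots> = complex_of_real (\<Sum>l\<in>A. (cmod (b l))\<^sup>2)"
    by (simp add: complex_norm_square[symmetric])
  finally show ?thesis by (simp only: of_real_eq_iff)
qed

definition periodization :: "nat \<Rightarrow> (nat \<Rightarrow> 'a \<Rightarrow> complex) \<Rightarrow> 'a \<Rightarrow> ennreal" where
  "periodization m \<eta> \<xi> = (\<Sum>i=1..m. \<Sum>k. ennreal ((cmod (ft (\<eta> i) (\<xi> + uu k)))\<^sup>2))"

lemma periodization_borel:
  assumes \<eta>: "super_wavelet pp c eps mu m \<eta>"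
  shows "periodization m \<eta> \<in> borel_measurable borel"
proof -
  have [measurable]: "ft (\<eta> i) \<in> borel_measurable borel" if "i \<in> {1..m}" for i
    using \<eta> that L2_measurable[OF ft_L2] by (auto simp: super_wavelet_def parseval_frame_wavelet_def measurable_mu)
  show ?thesis unfolding periodization_def[abs_def] by (rule borel_measurable_sum) measurable
qed

lemma periodization_le_on_coset:
  assumes \<eta>: "super_wavelet pp c eps mu m \<eta>" and a: "absv a \<le> 1"
  shows "(\<integral>\<^sup>+\<xi>. periodization m \<eta> \<xi> * indicator (coset (int n) a) \<xi> \<partial>mu) \<le> emeasure mu (coset (int n) a)"
proof -
  have L2: "\<eta> i \<in> L2 mu" if "i \<in> {1..m}" for i
    using \<eta> that by (auto simp: super_wavelet_def parseval_frame_wavelet_def)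
  have meas: "ft (\<eta> i) \<in> borel_measurable borel" if "i \<in> {1..m}" for i
    using L2_measurable[OF ft_L2[OF L2[OF that]]] by (simp add: measurable_mu)
  let ?b = "\<lambda>l. of_real (Q powi (- int n)) * chi (uu l * a)"
  have "(\<integral>\<^sup>+\<xi>. periodization m \<eta> \<xi> * indicator (coset (int n) a) \<xi> \<partial>mu)
      = (\<Sum>i=1..m. \<integral>\<^sup>+\<xi>. (\<Sum>k. ennreal ((cmod (ft (\<eta> i) (\<xi> + uu k)))\<^sup>2)) * indicator (coset (int n) a) \<xi> \<partial>mu)"
    unfolding periodization_def sum_distrib_right
  proof (rule nn_integral_sum)
    fix i assume "i \<in> {1..m}"
    note [measurable] = meas[OF this]
    show "(\<lambda>\<xi>. (\<Sum>k. ennreal ((cmod (ft (\<eta> i) (\<xi> + uu k)))\<^sup>2)) * indicator (coset (int n) a) \<xi>) \<in> borel_measurable mu"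
      by measurable
  qed
  also have "\<dots> \<le> (\<Sum>i=1..m. ennreal ((norm_L2 mu (translate_sum {..<q ^ n} ?b (\<eta> i)))\<^sup>2))"
    by (intro sum_mono periodization_coset_le L2 a)
  also have "\<dots> = ennreal (\<Sum>l<q ^ n. (cmod (?b l))\<^sup>2)"
    unfolding sum_norm_translate_sum[OF \<eta> finite_lessThan, where b = ?b, symmetric] by (rule sum_ennreal) simp
  also have "(\<Sum>l<q ^ n. (cmod (?b l))\<^sup>2) = Q powi (- int n)"
  proof -
    have "(cmod (?b l))\<^sup>2 = Q powi (- int n) * Q powi (- int n)" for l
      by (simp only: norm_mult norm_of_real chi_unit abs_of_pos[OF powi_Q_pos] mult_1_right power2_eq_square)
    moreover have "Q ^ n * (Q powi (- int n) * Q powi (- int n)) = Q powi (- int n)"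
      using Q_gt_1 by (simp add: power_int_minus)
    ultimately show ?thesis by simp
  qed
  finally show ?thesis by (simp only: emeasure_coset)
qed

lemma periodization_le_on_step_set:
  assumes \<eta>: "super_wavelet pp c eps mu m \<eta>" and E: "step_set (int n) E" "E \<subseteq> int_ring absv"
  shows "(\<integral>\<^sup>+\<xi>. periodization m \<eta> \<xi> * indicator E \<xi> \<partial>mu) \<le> emeasure mu E"
proof -
  note [measurable] = periodization_borel[OF \<eta>]
  let ?R = "reps (int n) E"
  have fin: "finite ?R" using E(2) finite_reps unfolding int_ring_eq_coset by blast
  note ind = indicator_step_set[OF E(1) fin]
  have "(\<integral>\<^sup>+\<xi>. periodization m \<eta> \<xi> * indicator E \<xi> \<partial>mu)
      = (\<Sum>k\<in>?R. \<integral>\<^sup>+\<xi>. periodization m \<eta> \<xi> * indicator (coset (int n) (rep (int n) k)) \<xi> \<partial>mu)"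
    unfolding ind sum_distrib_left by (rule nn_integral_sum) measurable
  also have "\<dots> \<le> (\<Sum>k\<in>?R. emeasure mu (coset (int n) (rep (int n) k)))"
    using E(2) by (intro sum_mono periodization_le_on_coset \<eta>) (auto simp: reps_def int_ring_def)
  also have "\<dots> = emeasure mu (\<Union>k\<in>?R. coset (int n) (rep (int n) k))"
    by (rule sum_emeasure) (auto simp: fin intro: disjoint_family_on_mono[OF _ disjoint_cosets])
  also have "\<dots> = emeasure mu E" using step_set_eq_Union[OF E(1)] by simp
  finally show ?thesis .
qed

text \<open>
  The sets that can be approximated by unions of cosets form a Dynkin system: complements of such
  unions are again such unions, and a disjoint union is approximated by finitely many of its members.
  The cosets belong to it, and they are stable under intersection.
\<close>

lemma approx_step_set:
  assumes M: "finite_measure M" "sets M = sets borel" and A: "A \<in> sets borel" and e: "e > 0"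
  shows "\<exists>n E. step_set (int n) E \<and> measure M ((A - E) \<union> (E - A)) < e"
proof -
  interpret finite_measure M by (rule M(1))
  have sp: "space M = UNIV" using sets_eq_imp_space_eq[OF M(2)] by simp
  have subset_Pow: "cosets \<subseteq> Pow UNIV" by simp
  have st: "E \<in> sets M" if "step_set n E" for n E using step_set_borel[OF that] M(2) by simp
  have "A \<in> sigma_sets UNIV cosets" using A sets_borel_cosets by simp
  then have "\<forall>e>0. \<exists>n E. step_set (int n) E \<and> measure M ((A - E) \<union> (E - A)) < e"
  proof (induction rule: sigma_sets_induct_disjoint[OF Int_stable_cosets subset_Pow, consumes 1, case_names basic empty compl union])
    case (basic A)
    then consider "A = {}" | n a where "A = coset n a" by (auto simp: cosets_def)
    then obtain n where "step_set (int n) A"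
    proof cases
      case 1 then show ?thesis using that[of 0] by (simp add: step_set_def)
    next
      case (2 n a) then show ?thesis using that[of "nat n"] step_set_coset[of n "int (nat n)" a] by simp
    qed
    then show ?case by (intro allI impI exI[of _ n] exI[of _ A]) simp
  next
    case empty
    show ?case by (intro allI impI exI[of _ 0] exI[of _ "{}"]) (simp add: step_set_def)
  next
    case (compl A)
    show ?case
    proof (intro allI impI)
      fix e :: real assume "e > 0"
      then obtain n E where E: "step_set (int n) E" "measure M ((A - E) \<union> (E - A)) < e" using compl by blast
      have "step_set (int n) (- E)" using step_set_mem_iff[OF E(1)] by (auto simp: step_set_def)
      moreover have "(UNIV - A - - E) \<union> (- E - (UNIV - A)) = (A - E) \<union> (E - A)" by blast
      ultimately show "\<exists>n E. step_set (int n) E \<and> measure M ((UNIV - A - E) \<union> (E - (UNIV - A))) < e"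
        using E(2) by metis
    qed
  next
    case (union A)
    have A: "A i \<in> sets M" for i using union(2) M(2) sets_borel_cosets by auto
    show ?case
    proof (intro allI impI)
      fix e :: real assume e: "e > 0"
      let ?U = "\<Union>i. A i"
      have "(\<lambda>n. measure M (\<Union>i<n. A i)) \<longlonglongrightarrow> measure M (\<Union>n. \<Union>i<n. A i)"
      proof (rule finite_Lim_measure_incseq)
        show "incseq (\<lambda>n. \<Union>i<n. A i)" by (rule incseq_SucI) (auto simp: lessThan_Suc)
      qed (use A in auto)
      moreover have "(\<Union>n. \<Union>i<n. A i) = ?U" by blast
      ultimately have "(\<lambda>n. measure M (\<Union>i<n. A i)) \<longlonglongrightarrow> measure M ?U" by simp
      then have "\<forall>\<^sub>F n in sequentially. measure M ?U - e / 2 < measure M (\<Union>i<n. A i)"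
        by (rule order_tendstoD) (use e in simp)
      then obtain N where N: "measure M ?U - e / 2 < measure M (\<Union>i<N. A i)"
        by (auto simp: eventually_sequentially)
      have tail: "measure M (?U - (\<Union>i<N. A i)) < e / 2"
        using N A by (subst finite_measure_Diff) auto
      have "\<exists>n E. step_set (int n) E \<and> measure M ((A i - E) \<union> (E - A i)) < e / (2 * real (Suc N))" for i
        using union(3) e by simp
      then obtain n E where E: "\<And>i. step_set (int (n i)) (E i)"
          "\<And>i. measure M ((A i - E i) \<union> (E i - A i)) < e / (2 * real (Suc N))" by metis
      define k where "k = (\<Sum>i<N. n i)"
      have "step_set (int k) (\<Union>i<N. E i)"
      proof -
        have "step_set (int k) (E i)" if "i < N" for i
        proof (rule step_set_mono[OF E(1)])
          have "n i \<le> k" unfolding k_def by (rule member_le_sum) (use that in auto)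
          then show "int (n i) \<le> int k" by simp
        qed
        then show ?thesis by (fastforce simp: step_set_def)
      qed
      moreover have "measure M ((?U - (\<Union>i<N. E i)) \<union> ((\<Union>i<N. E i) - ?U)) < e"
      proof -
        have Em: "E i \<in> sets M" for i using E(1) st by blast
        have "measure M ((?U - (\<Union>i<N. E i)) \<union> ((\<Union>i<N. E i) - ?U))
            \<le> measure M ((?U - (\<Union>i<N. A i)) \<union> (\<Union>i<N. (A i - E i) \<union> (E i - A i)))"
          by (rule finite_measure_mono) (use A Em in auto)
        also have "\<dots> \<le> measure M (?U - (\<Union>i<N. A i)) + measure M (\<Union>i<N. (A i - E i) \<union> (E i - A i))"
          by (rule measure_subadditive) (use A Em in auto)
        also have "measure M (\<Union>i<N. (A i - E i) \<union> (E i - A i)) \<le> (\<Sum>i<N. measure M ((A i - E i) \<union> (E i - A i)))"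
          by (rule measure_subadditive_finite) (use A Em in auto)
        also have "\<dots> \<le> (\<Sum>i<N. e / (2 * real (Suc N)))" by (intro sum_mono less_imp_le E(2))
        also have "\<dots> \<le> e / 2" using e by (simp add: field_simps)
        finally show ?thesis using tail by simp
      qed
      ultimately show "\<exists>n E. step_set (int n) E \<and> measure M ((?U - E) \<union> (E - ?U)) < e" by blast
    qed
  qed
  then show ?thesis using e by blast
qed

text \<open>
  A bound by the measure for unions of cosets passes to Borel sets by approximation. The approximation
  is taken in the measure with density \<open>F + 1\<close>, which controls at once the change of the integral of
  \<open>F\<close> and the change of the measure.
\<close>

lemma periodization_le_on_borel:
  assumes \<eta>: "super_wavelet pp c eps mu m \<eta>" and A: "A \<in> sets borel" "A \<subseteq> int_ring absv"
  shows "(\<integral>\<^sup>+\<xi>. periodization m \<eta> \<xi> * indicator A \<xi> \<partial>mu) \<le> emeasure mu A"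
proof -
  note [measurable] = periodization_borel[OF \<eta>] A(1)
  let ?F = "periodization m \<eta>" and ?O = "int_ring absv"
  have Om [measurable]: "?O \<in> sets borel" unfolding int_ring_eq_coset by measurable
  define M where "M = density mu (\<lambda>\<xi>. (?F \<xi> + 1) * indicator ?O \<xi>)"
  have sM: "sets M = sets borel" by (simp add: M_def sets_mu)
  have eM: "emeasure M B = (\<integral>\<^sup>+\<xi>. ?F \<xi> * indicator B \<xi> \<partial>mu) + emeasure mu B" if B: "B \<in> sets borel" "B \<subseteq> ?O" for B
  proof -
    note [measurable] = B(1)
    have "emeasure M B = (\<integral>\<^sup>+\<xi>. (?F \<xi> + 1) * indicator ?O \<xi> * indicator B \<xi> \<partial>mu)"
      unfolding M_def by (rule emeasure_density) (simp_all add: sets_mu measurable_mu)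
    also have "\<dots> = (\<integral>\<^sup>+\<xi>. ?F \<xi> * indicator B \<xi> + indicator B \<xi> \<partial>mu)"
      using B(2) by (intro nn_integral_cong) (auto simp: indicator_def)
    also have "\<dots> = (\<integral>\<^sup>+\<xi>. ?F \<xi> * indicator B \<xi> \<partial>mu) + (\<integral>\<^sup>+\<xi>. indicator B \<xi> \<partial>mu)"
      by (rule nn_integral_add) measurable
    finally show ?thesis using B(1) by (simp add: sets_mu)
  qed
  have fM: "finite_measure M"
  proof
    have "emeasure M (space M) = emeasure M ?O"
    proof -
      have "emeasure M (- ?O) = (\<integral>\<^sup>+\<xi>. (?F \<xi> + 1) * indicator ?O \<xi> * indicator (- ?O) \<xi> \<partial>mu)"
        unfolding M_def by (rule emeasure_density) (simp_all add: sets_mu measurable_mu)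
      also have "\<dots> = (\<integral>\<^sup>+\<xi>. 0 \<partial>mu)" by (rule nn_integral_cong) (auto simp: indicator_def)
      finally have "emeasure M (- ?O) = 0" by simp
      then have "emeasure M (?O \<union> - ?O) = emeasure M ?O"
        by (subst emeasure_Un_null_set) (auto simp: null_sets_def sM)
      then show ?thesis by (simp add: M_def)
    qed
    also have "\<dots> \<le> emeasure mu ?O + emeasure mu ?O"
      unfolding eM[OF Om subset_refl] using periodization_le_on_step_set[OF \<eta>, of 0 ?O]
      by (intro add_right_mono) (simp add: int_ring_eq_coset step_set_coset)
    also have "\<dots> < \<infinity>" by (simp add: normalised)
    finally show "emeasure M (space M) \<noteq> \<infinity>" by simp
  qed
  interpret finite_measure M by (rule fM)
  show ?thesis
  proof (rule ennreal_le_epsilon)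
    fix e :: real assume e: "e > 0"
    obtain n E' where E': "step_set (int n) E'" "measure M ((A - E') \<union> (E' - A)) < e"
      using approx_step_set[OF fM sM A(1) e] by blast
    define E where "E = E' \<inter> ?O"
    have E: "step_set (int n) E" "E \<subseteq> ?O"
      using E'(1) step_set_coset[of 0 "int n" 0] unfolding E_def int_ring_eq_coset step_set_def by auto
    have [measurable]: "E \<in> sets borel" "E' \<in> sets borel" using step_set_borel E(1) E'(1) by auto
    have le1: "(\<integral>\<^sup>+\<xi>. ?F \<xi> * indicator A \<xi> \<partial>mu) \<le> (\<integral>\<^sup>+\<xi>. ?F \<xi> * indicator E \<xi> \<partial>mu) + (\<integral>\<^sup>+\<xi>. ?F \<xi> * indicator (A - E) \<xi> \<partial>mu)"
      by (subst nn_integral_add[symmetric]) (measurable, auto intro!: nn_integral_mono simp: indicator_def)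
    have le2: "emeasure mu E \<le> emeasure mu A + emeasure mu (E - A)"
      by (rule order_trans[OF emeasure_mono emeasure_subadditive]) (auto simp: sets_mu)
    have "(\<integral>\<^sup>+\<xi>. ?F \<xi> * indicator A \<xi> \<partial>mu) \<le> emeasure mu A + (emeasure mu (E - A) + (\<integral>\<^sup>+\<xi>. ?F \<xi> * indicator (A - E) \<xi> \<partial>mu))"
      using order_trans[OF le1 add_right_mono[OF order_trans[OF periodization_le_on_step_set[OF \<eta> E] le2]]]
      by (simp only: add.assoc)
    also have "\<dots> \<le> emeasure mu A + (emeasure M (E - A) + emeasure M (A - E))"
      using A(2) E(2) by (subst (1 2) eM) (auto intro!: add_mono)
    also have "emeasure M (E - A) + emeasure M (A - E) = emeasure M ((E - A) \<union> (A - E))"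
      by (rule plus_emeasure) (auto simp: sM)
    also have "\<dots> \<le> emeasure M ((A - E') \<union> (E' - A))"
      using A(2) by (intro emeasure_mono) (auto simp: E_def sM)
    also have "\<dots> \<le> ennreal e" using E'(2) by (simp add: emeasure_eq_measure ennreal_leI)
    finally show "(\<integral>\<^sup>+\<xi>. ?F \<xi> * indicator A \<xi> \<partial>mu) \<le> emeasure mu A + ennreal e" by (simp add: add_left_mono)
  qed
qed

lemma periodization_le_1:
  assumes \<eta>: "super_wavelet pp c eps mu m \<eta>"
  shows "AE \<xi> in mu. \<xi> \<in> int_ring absv \<longrightarrow> periodization m \<eta> \<xi> \<le> 1"
proof -
  note [measurable] = periodization_borel[OF \<eta>]
  let ?F = "periodization m \<eta>" and ?O = "int_ring absv"
  have Om [measurable]: "?O \<in> sets borel" unfolding int_ring_eq_coset by measurable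
  define A where "A = {\<xi>. ?F \<xi> > 1} \<inter> ?O"
  have Am [measurable]: "A \<in> sets borel" unfolding A_def by measurable
  have A: "A \<subseteq> ?O" by (simp add: A_def)
  let ?D = "\<integral>\<^sup>+\<xi>. (?F \<xi> - 1) * indicator A \<xi> \<partial>mu"
  have fin: "emeasure mu A < \<infinity>"
    using emeasure_mono[OF A, of mu] by (simp add: normalised sets_mu) (metis ennreal_one_less_top order_le_less_trans)
  have "?D + emeasure mu A = (\<integral>\<^sup>+\<xi>. (?F \<xi> - 1) * indicator A \<xi> \<partial>mu) + (\<integral>\<^sup>+\<xi>. indicator A \<xi> \<partial>mu)"
    by (simp add: sets_mu)
  also have "\<dots> = (\<integral>\<^sup>+\<xi>. (?F \<xi> - 1) * indicator A \<xi> + indicator A \<xi> \<partial>mu)"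
    by (rule nn_integral_add[symmetric]) measurable
  also have "\<dots> = (\<integral>\<^sup>+\<xi>. ?F \<xi> * indicator A \<xi> \<partial>mu)"
    by (rule nn_integral_cong) (auto simp: A_def indicator_def diff_add_cancel_ennreal)
  also have "\<dots> \<le> 0 + emeasure mu A" using periodization_le_on_borel[OF \<eta> Am A] by simp
  finally have "?D = 0" 
    using fin by (simp add: add.commute[of _ "emeasure mu A"] ennreal_add_left_cancel_le[of "emeasure mu A" _ 0, simplified])
      auto
  then have "AE \<xi> in mu. (?F \<xi> - 1) * indicator A \<xi> = 0"
    by (subst (asm) nn_integral_0_iff_AE) (simp_all add: measurable_mu)
  then show ?thesis
  proof eventually_elim
    case (elim \<xi>)
    show ?case
    proof (rule impI, rule ccontr)
      assume "\<xi> \<in> ?O" "\<not> ?F \<xi> \<le> 1"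
      then have "\<xi> \<in> A" "1 < ?F \<xi>" by (auto simp: A_def)
      then have "?F \<xi> - 1 = 0" using elim by simp
      then show False using \<open>1 < ?F \<xi>\<close> unfolding diff_eq_0_iff_ennreal using leD by blast
    qed
  qed
qed

section \<open>The lower bound\<close>

lemma AE_nonzero: "AE \<xi> in mu. \<xi> \<noteq> 0"
proof -
  have z: "{0 :: 'a} \<in> sets mu" by (simp add: sets_mu)
  have le: "emeasure mu {0} \<le> ennreal (Q powi (- int n))" for n
    using emeasure_mono[of "{0}" "coset (int n) 0" mu] by (simp add: emeasure_coset)
  have "emeasure mu {0} \<le> 0"
  proof (rule ennreal_le_epsilon)
    fix e :: real assume "e > 0"
    then obtain n where "Q powi (- int n) < e" using powi_small by blast
    then have "ennreal (Q powi (- int n)) \<le> ennreal e" by (intro ennreal_leI less_imp_le)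
    from order_trans[OF le this] show "emeasure mu {0} \<le> 0 + ennreal e" by simp
  qed
  then show ?thesis using z by (intro AE_I[of _ _ "{0}"]) auto
qed

text \<open>
  Unfolding the integral over the field into the translates of the ring of integers replaces the
  weight \<open>1 / |\<xi>|\<close> by \<open>1 / |\<xi> + u k|\<close>, which for \<open>\<xi> \<noteq> 0\<close> in the ring of integers is not larger.
\<close>

lemma weighted_periodization_ge:
  assumes f: "parseval_frame_wavelet pp c eps mu f"
  shows "ennreal (1 - 1 / Q) \<le> (\<integral>\<^sup>+\<xi>. ennreal (1 / absv \<xi>) * (\<Sum>k. ennreal ((cmod (ft f (\<xi> + uu k)))\<^sup>2)) * indicator (int_ring absv) \<xi> \<partial>mu)"
proof -
  have "ft f \<in> L2 mu" using f by (simp add: parseval_frame_wavelet_def ft_L2)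
  from L2_measurable[OF this] have [measurable]: "ft f \<in> borel_measurable borel" by (simp add: measurable_mu)
  have "ennreal (1 - 1 / Q) \<le> (\<integral>\<^sup>+\<xi>. ennreal (1 / absv \<xi>) * ennreal ((cmod (ft f \<xi>))\<^sup>2) \<partial>mu)"
    by (rule Calderon_lower_bound[OF f])
  also have "\<dots> = (\<integral>\<^sup>+\<xi>. (\<Sum>k. ennreal (1 / absv (\<xi> + uu k)) * ennreal ((cmod (ft f (\<xi> + uu k)))\<^sup>2)) * indicator (int_ring absv) \<xi> \<partial>mu)"
    by (rule nn_integral_periodization[symmetric]) measurable
  also have "\<dots> \<le> (\<integral>\<^sup>+\<xi>. ennreal (1 / absv \<xi>) * (\<Sum>k. ennreal ((cmod (ft f (\<xi> + uu k)))\<^sup>2)) * indicator (int_ring absv) \<xi> \<partial>mu)"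
  proof (rule nn_integral_mono_AE, use AE_nonzero in eventually_elim)
    fix \<xi> :: 'a assume nz: "\<xi> \<noteq> 0"
    show "(\<Sum>k. ennreal (1 / absv (\<xi> + uu k)) * ennreal ((cmod (ft f (\<xi> + uu k)))\<^sup>2)) * indicator (int_ring absv) \<xi>
      \<le> ennreal (1 / absv \<xi>) * (\<Sum>k. ennreal ((cmod (ft f (\<xi> + uu k)))\<^sup>2)) * indicator (int_ring absv) \<xi>"
    proof (cases "\<xi> \<in> int_ring absv")
      case True
      have pos: "absv \<xi> > 0" using nz absv_nonneg[of \<xi>] absv_eq_0_iff[of \<xi>] by linarith
      have "absv \<xi> \<le> absv (\<xi> + uu k)" for k
      proof (cases "k = 0")
        case False
        have "absv (uu k) > 1" by (rule absv_u_gt_1[OF False])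
        then have "absv (\<xi> + uu k) > 1"
          using absv_diff_le[of "\<xi> + uu k" 1 \<xi>] True by (fastforce simp: int_ring_def)
        then show ?thesis using True by (simp add: int_ring_def)
      qed simp
      then have "1 / absv (\<xi> + uu k) \<le> 1 / absv \<xi>" for k
        using pos by (intro divide_left_mono) (auto intro: mult_pos_pos less_le_trans)
      then show ?thesis
        unfolding ennreal_suminf_cmult[symmetric] by (intro mult_right_mono suminf_le ennreal_leI) auto
    qed simp
  qed
  finally show ?thesis .
qed

text \<open>
  Almost everywhere \<open>1 - G 1\<close> dominates the sum of the remaining periodizations. It is therefore
  nonnegative, and the negative part of the integrand vanishes.
\<close>

lemma extension_lower_bound:
  assumes \<eta>: "super_wavelet pp c eps mu (m + 1) \<eta>"
  shows "ereal (real m * (1 - 1 / Q)) \<le> ext_set_integral mu (int_ring absv)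
    (\<lambda>\<xi>. (1 - (\<Sum>k. ereal ((cmod (ft (\<eta> 1) (\<xi> + uu k)))\<^sup>2))) / ereal (absv \<xi>))"
proof -
  let ?O = "int_ring absv"
  define G where "G i \<xi> = (\<Sum>k. ennreal ((cmod (ft (\<eta> i) (\<xi> + uu k)))\<^sup>2))" for i \<xi>
  let ?f = "\<lambda>\<xi>. (1 - (\<Sum>k. ereal ((cmod (ft (\<eta> 1) (\<xi> + uu k)))\<^sup>2))) / ereal (absv \<xi>)"
  have pw: "parseval_frame_wavelet pp c eps mu (\<eta> i)" if "i \<in> {1..m+1}" for i
    using \<eta> that by (simp add: super_wavelet_def)
  have meas [measurable]: "ft (\<eta> i) \<in> borel_measurable borel" if "i \<in> {1..m+1}" for i
    using L2_measurable[OF ft_L2] pw[OF that] by (auto simp: parseval_frame_wavelet_def measurable_mu)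
  have Gm [measurable]: "G i \<in> borel_measurable borel" if "i \<in> {1..m+1}" for i
    unfolding G_def[abs_def] using meas[OF that] by measurable
  have Om [measurable]: "?O \<in> sets borel" unfolding int_ring_eq_coset by measurable
  have per: "periodization (m + 1) \<eta> \<xi> = G 1 \<xi> + (\<Sum>i=2..m+1. G i \<xi>)" for \<xi>
  proof -
    have "periodization (m + 1) \<eta> \<xi> = (\<Sum>i=1..m+1. G i \<xi>)" by (simp only: periodization_def G_def)
    also have "\<dots> = G 1 \<xi> + (\<Sum>i=Suc 1..m+1. G i \<xi>)" by (rule sum.atLeast_Suc_atMost) simp
    finally show ?thesis by (simp only: Suc_1)
  qed
  have pointwise: "e2ennreal (- ?f \<xi>) = 0 \<and> ennreal (1 / absv \<xi>) * (\<Sum>i=2..m+1. G i \<xi>) \<le> e2ennreal (?f \<xi>)"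
    if "G 1 \<xi> + (\<Sum>i=2..m+1. G i \<xi>) \<le> 1" "\<xi> \<noteq> 0" for \<xi>
  proof -
    let ?r = "\<lambda>k. (cmod (ft (\<eta> 1) (\<xi> + uu k)))\<^sup>2"
    have "G 1 \<xi> \<le> 1" 
      by (rule order_trans[OF add_increasing2[OF zero_le order_refl] that(1)])
    then have fin: "(\<Sum>k. ennreal (?r k)) \<noteq> top" by (auto simp: G_def top_unique)
    have sm: "summable ?r" by (rule summable_suminf_not_top[OF _ fin]) simp
    define s where "s = suminf ?r"
    have s0: "s \<ge> 0" unfolding s_def by (rule suminf_nonneg[OF sm]) simp
    have G1: "G 1 \<xi> = ennreal s" unfolding G_def s_def by (rule suminf_ennreal2[OF _ sm]) simp
    have "(\<Sum>k. ereal (?r k)) = ereal s"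
      using summable_sums[OF sm] unfolding s_def sums_ereal[symmetric] by (rule sums_unique[symmetric])
    moreover have pos: "absv \<xi> > 0" using that(2) absv_nonneg[of \<xi>] absv_eq_0_iff[of \<xi>] by linarith
    ultimately have f: "?f \<xi> = ereal ((1 - s) / absv \<xi>)" by (simp add: one_ereal_def)
    have s1: "s \<le> 1" using \<open>G 1 \<xi> \<le> 1\<close> unfolding G1 by (simp add: s0)
    have "e2ennreal (- ?f \<xi>) = 0" unfolding f using s1 pos
      by (intro e2ennreal_neg) simp
    moreover have "(\<Sum>i=2..m+1. G i \<xi>) \<le> ennreal (1 - s)"
    proof -
      have "ennreal s + (\<Sum>i=2..m+1. G i \<xi>) \<le> ennreal s + ennreal (1 - s)"
        using that(1) s0 s1 unfolding G1 by (simp add: ennreal_plus[symmetric] del: ennreal_plus)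
      then show ?thesis by (simp add: ennreal_add_left_cancel_le)
    qed
    then have "ennreal (1 / absv \<xi>) * (\<Sum>i=2..m+1. G i \<xi>) \<le> ennreal (1 / absv \<xi>) * ennreal (1 - s)"
      by (rule mult_left_mono) simp
    moreover have "ennreal (1 / absv \<xi>) * ennreal (1 - s) = e2ennreal (?f \<xi>)"
      unfolding f using s1 pos by (simp add: ennreal_mult[symmetric] ennreal_def[symmetric] e2ennreal_ereal)
    ultimately show ?thesis by simp
  qed
  have ae: "AE \<xi> in mu. \<xi> \<in> ?O \<longrightarrow> e2ennreal (- ?f \<xi>) = 0 \<and> ennreal (1 / absv \<xi>) * (\<Sum>i=2..m+1. G i \<xi>) \<le> e2ennreal (?f \<xi>)"
    using periodization_le_1[OF \<eta>] AE_nonzero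
  proof eventually_elim
    case (elim \<xi>)
    then show ?case using pointwise[of \<xi>] by (simp only: per) blast
  qed
  have N: "(\<integral>\<^sup>+\<xi>. e2ennreal (- ?f \<xi>) * indicator ?O \<xi> \<partial>mu) = 0"
  proof -
    have "(\<integral>\<^sup>+\<xi>. e2ennreal (- ?f \<xi>) * indicator ?O \<xi> \<partial>mu) = (\<integral>\<^sup>+\<xi>. 0 \<partial>mu)"
      by (rule nn_integral_cong_AE, use ae in eventually_elim) (auto simp: indicator_def)
    then show ?thesis by simp
  qed
  have "ennreal (real m * (1 - 1 / Q)) = (\<Sum>i=2..m+1. ennreal (1 - 1 / Q))"
    using Q_gt_1 by (simp add: ennreal_mult ennreal_of_nat_eq_real_of_nat)
  also have "\<dots> \<le> (\<Sum>i=2..m+1. \<integral>\<^sup>+\<xi>. ennreal (1 / absv \<xi>) * G i \<xi> * indicator ?O \<xi> \<partial>mu)"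
    unfolding G_def by (intro sum_mono weighted_periodization_ge pw) auto
  also have "\<dots> = (\<integral>\<^sup>+\<xi>. (\<Sum>i=2..m+1. ennreal (1 / absv \<xi>) * G i \<xi> * indicator ?O \<xi>) \<partial>mu)"
    by (rule nn_integral_sum[symmetric]) (use Gm in auto)
  also have "\<dots> \<le> (\<integral>\<^sup>+\<xi>. e2ennreal (?f \<xi>) * indicator ?O \<xi> \<partial>mu)"
    by (rule nn_integral_mono_AE, use ae in eventually_elim)
       (auto simp: indicator_def sum_distrib_left[symmetric] simp del: sum.cl_ivl_Suc)
  finally have P: "ennreal (real m * (1 - 1 / Q)) \<le> (\<integral>\<^sup>+\<xi>. e2ennreal (?f \<xi>) * indicator ?O \<xi> \<partial>mu)" .
  have "ereal (real m * (1 - 1 / Q)) = enn2ereal (ennreal (real m * (1 - 1 / Q)))"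
    using Q_gt_1 by (simp add: enn2ereal_ennreal)
  also have "\<dots> \<le> enn2ereal (\<integral>\<^sup>+\<xi>. e2ennreal (?f \<xi>) * indicator ?O \<xi> \<partial>mu)"
    using P by (simp add: less_eq_ennreal.rep_eq)
  finally show ?thesis
    unfolding ext_set_integral_def Let_def N by (simp add: zero_ennreal.rep_eq)
qed

end

theorem proposition5p4:
  fixes absv :: "'a::{field,metric_space} \<Rightarrow> real"
    and pp :: 'a and c :: nat and eps :: "nat \<Rightarrow> 'a"
    and chi :: "'a \<Rightarrow> complex" and mu :: "'a measure"
    and \<psi> :: "'a \<Rightarrow> complex" and m q :: nat
  assumes "local_field_setup absv pp c eps chi mu"
    and "q = CHAR('a) ^ c"
    and "parseval_frame_wavelet pp c eps mu \<psi>"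
    and "m \<ge> 1"
    and "extendable_to_super_wavelet pp c eps mu \<psi> (m + 1)"
  shows "ext_set_integral mu (int_ring absv)
           (\<lambda>\<xi>. (1 - (\<Sum>k. ereal ((cmod (fourier_L2 chi mu \<psi> (\<xi> + u pp c eps k)))\<^sup>2)))
                  / ereal (absv \<xi>))
         \<ge> ereal (real m * ((real q - 1) / real q))"
proof -
  interpret local_field_setup absv pp c eps chi mu by (rule assms(1))
  obtain \<eta> where \<eta>: "\<eta> 1 = \<psi>" "super_wavelet pp c eps mu (m + 1) \<eta>"
    using assms(5) by (auto simp: extendable_to_super_wavelet_def)
  have "real q > 0" using char_pos by (simp add: assms(2))
  then have "(real q - 1) / real q = 1 - 1 / real q" by (simp add: field_simps)
  then show ?thesis using extension_lower_bound[OF \<eta>(2)] \<eta>(1) by (simp add: q_eq assms(2))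
qed

end
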